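(* For every (external) natural number $k$, $\mathsf{RCA}^*_0+\mathrm{Tot}(F_k)$ proves: for every transition relation $R\subseteq\mathbb{N}^2$, if $R$ is bounded by $F_k$ then there exist $T_0,\dots,T_{k+1}\subseteq\mathbb{N}^2$ such that $R^+\subseteq T_0\cup\dots\cup T_{k+1}$ and each $T_i$ is $H$-bounded by $F_0$.
   Context: $\mathsf{RCA}^*_0$ is second-order arithmetic with exponentiation, $\Delta^0_0$-induction and $\Delta^0_1$-comprehension. $F_0(x)=x+1$, $F_{n+1}(x)=F_n^{(x+1)}(x)$; $\mathrm{Tot}(F_k)$ states that $F_k$ is total. $R^+$ is the transitive closure of $R$. A relation $Q$ is bounded by $g$ if every finite $Q$-decreasing sequence $\langle a_0,\dots,a_{l-1}\rangle$ ($a_{i+1}\,Q\,a_i$) has $l\le g(a_0)$; $Q$ is $H$-bounded by $g$ if every finite transitive $Q$-decreasing sequence $\langle a_0,\dots,a_{l-1}\rangle$ ($a_j\,Q\,a_i$ for all $i<j<l$) has $l\le g(a_0)$.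
   Formalization: The claim is proved for those R whose transitive closure R^+ exists as a set; RCA*_0 does not prove this existence, and with R^+ read as a mere Σ^0_1 class the claim fails in the ω-model of recursive sets. *)

theory Defs
  imports Main
begin

section \<open>Second-order arithmetic with exponentiation\<close>

text \<open>
  Two-sorted syntax with de Bruijn indices: numbers and sets have separate index spaces, so
  \<^term>\<open>0\<close> refers to the innermost quantifier of the respective sort. Equality is primitive for
  numbers only.
\<close>

datatype tm =
    Var nat
  | Zero
  | One
  | Add tm tm  (infixl "\<^bold>+" 65)
  | Mul tm tm  (infixl "\<^bold>*" 70)
  | Exp tm tm  (infixr "\<^bold>^" 80)

datatype fm =
    Eq tm tm    (infix "\<^bold>=" 50)
  | Less tm tm  (infix "\<^bold><" 50)
  | Mem tm nat  (infix "\<^bold>\<in>" 50)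
  | Fls         ("\<^bold>\<bottom>")
  | Imp fm fm   (infixr "\<^bold>\<longrightarrow>" 25)
  | AllN fm
  | AllS fm

definition Neg :: "fm \<Rightarrow> fm"  ("\<^bold>\<not> _" [40] 40)
  where "(\<^bold>\<not> p) = (p \<^bold>\<longrightarrow> \<^bold>\<bottom>)"
definition Conj :: "fm \<Rightarrow> fm \<Rightarrow> fm"  (infixr "\<^bold>\<and>" 35)
  where "(p \<^bold>\<and> q) = (\<^bold>\<not> (p \<^bold>\<longrightarrow> \<^bold>\<not> q))"
definition Disj :: "fm \<Rightarrow> fm \<Rightarrow> fm"  (infixr "\<^bold>\<or>" 30)
  where "(p \<^bold>\<or> q) = (\<^bold>\<not> p \<^bold>\<longrightarrow> q)"
definition Iff :: "fm \<Rightarrow> fm \<Rightarrow> fm"  (infixr "\<^bold>\<longleftrightarrow>" 25)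
  where "(p \<^bold>\<longleftrightarrow> q) = ((p \<^bold>\<longrightarrow> q) \<^bold>\<and> (q \<^bold>\<longrightarrow> p))"
definition ExN :: "fm \<Rightarrow> fm"
  where "ExN p = (\<^bold>\<not> AllN (\<^bold>\<not> p))"
definition ExS :: "fm \<Rightarrow> fm"
  where "ExS p = (\<^bold>\<not> AllS (\<^bold>\<not> p))"
definition Le :: "tm \<Rightarrow> tm \<Rightarrow> fm"  (infix "\<^bold>\<le>" 50)
  where "(s \<^bold>\<le> t) = (s \<^bold>< t \<^bold>\<or> s \<^bold>= t)"

primrec substt :: "(nat \<Rightarrow> tm) \<Rightarrow> tm \<Rightarrow> tm" where
  "substt \<sigma> (Var n) = \<sigma> n"
| "substt \<sigma> Zero = Zero"
| "substt \<sigma> One = One"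
| "substt \<sigma> (s \<^bold>+ t) = substt \<sigma> s \<^bold>+ substt \<sigma> t"
| "substt \<sigma> (s \<^bold>* t) = substt \<sigma> s \<^bold>* substt \<sigma> t"
| "substt \<sigma> (s \<^bold>^ t) = substt \<sigma> s \<^bold>^ substt \<sigma> t"

definition lift :: "tm \<Rightarrow> tm"  ("\<up>_" [100] 100)
  where "\<up>t = substt (\<lambda>n. Var (Suc n)) t"

text \<open>Simultaneous capture-avoiding substitution of terms (\<open>\<sigma>\<close>) and set variables (\<open>\<rho>\<close>).\<close>

primrec subst :: "(nat \<Rightarrow> tm) \<Rightarrow> (nat \<Rightarrow> nat) \<Rightarrow> fm \<Rightarrow> fm" where
  "subst \<sigma> \<rho> (s \<^bold>= t) = (substt \<sigma> s \<^bold>= substt \<sigma> t)"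
| "subst \<sigma> \<rho> (s \<^bold>< t) = (substt \<sigma> s \<^bold>< substt \<sigma> t)"
| "subst \<sigma> \<rho> (t \<^bold>\<in> X) = (substt \<sigma> t \<^bold>\<in> \<rho> X)"
| "subst \<sigma> \<rho> \<^bold>\<bottom> = \<^bold>\<bottom>"
| "subst \<sigma> \<rho> (p \<^bold>\<longrightarrow> q) = (subst \<sigma> \<rho> p \<^bold>\<longrightarrow> subst \<sigma> \<rho> q)"
| "subst \<sigma> \<rho> (AllN p) = AllN (subst (case_nat (Var 0) (\<lambda>n. \<up>(\<sigma> n))) \<rho> p)"
| "subst \<sigma> \<rho> (AllS p) = AllS (subst \<sigma> (case_nat 0 (\<lambda>n. Suc (\<rho> n))) p)"

definition liftN :: "fm \<Rightarrow> fm"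
  where "liftN = subst (\<lambda>n. Var (Suc n)) id"
definition liftS :: "fm \<Rightarrow> fm"
  where "liftS = subst Var Suc"
definition instN :: "tm \<Rightarrow> fm \<Rightarrow> fm"
  where "instN t = subst (case_nat t Var) id"
definition instS :: "nat \<Rightarrow> fm \<Rightarrow> fm"
  where "instS X = subst Var (case_nat X id)"

text \<open>The bounding term is lifted here, so \<open>BAll t p\<close> is \<open>\<forall>x<t. p\<close> with \<open>x\<close> not occurring in \<open>t\<close>.\<close>

definition BAll :: "tm \<Rightarrow> fm \<Rightarrow> fm"
  where "BAll t p = AllN (Var 0 \<^bold>< \<up>t \<^bold>\<longrightarrow> p)"
definition BEx :: "tm \<Rightarrow> fm \<Rightarrow> fm"
  where "BEx t p = (\<^bold>\<not> BAll t (\<^bold>\<not> p))"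


section \<open>Provability\<close>

text \<open>
  Natural deduction for two-sorted classical logic. Formulas of the theory \<open>T\<close> may have free
  variables and stand for their universal closures; this is why \<open>T\<close>, in contrast to the context
  \<open>\<Gamma>\<close> of open assumptions, is not shifted in the generalization rules.
\<close>

inductive deriv :: "fm set \<Rightarrow> fm set \<Rightarrow> fm \<Rightarrow> bool" for T :: "fm set" where
  Ax: "p \<in> T \<Longrightarrow> deriv T \<Gamma> p"
| Assm: "p \<in> \<Gamma> \<Longrightarrow> deriv T \<Gamma> p"
| ImpI: "deriv T (insert p \<Gamma>) q \<Longrightarrow> deriv T \<Gamma> (p \<^bold>\<longrightarrow> q)"
| ImpE: "deriv T \<Gamma> (p \<^bold>\<longrightarrow> q) \<Longrightarrow> deriv T \<Gamma> p \<Longrightarrow> deriv T \<Gamma> q"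
| Classical: "deriv T (insert (\<^bold>\<not> p) \<Gamma>) \<^bold>\<bottom> \<Longrightarrow> deriv T \<Gamma> p"
| AllNI: "deriv T (liftN ` \<Gamma>) p \<Longrightarrow> deriv T \<Gamma> (AllN p)"
| AllNE: "deriv T \<Gamma> (AllN p) \<Longrightarrow> deriv T \<Gamma> (instN t p)"
| AllSI: "deriv T (liftS ` \<Gamma>) p \<Longrightarrow> deriv T \<Gamma> (AllS p)"
| AllSE: "deriv T \<Gamma> (AllS p) \<Longrightarrow> deriv T \<Gamma> (instS X p)"
| EqRefl: "deriv T \<Gamma> (t \<^bold>= t)"
| EqSubst: "deriv T \<Gamma> (s \<^bold>= t) \<Longrightarrow> deriv T \<Gamma> (instN s p) \<Longrightarrow> deriv T \<Gamma> (instN t p)"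

definition proves :: "fm set \<Rightarrow> fm \<Rightarrow> bool"  (infix "\<^bold>\<turnstile>" 20)
  where "(T \<^bold>\<turnstile> p) \<longleftrightarrow> deriv T {} p"


section \<open>The theory \<open>RCA\<^sup>*\<^sub>0\<close>\<close>

inductive delta00 :: "fm \<Rightarrow> bool" where
  "delta00 (s \<^bold>= t)"
| "delta00 (s \<^bold>< t)"
| "delta00 (t \<^bold>\<in> X)"
| "delta00 \<^bold>\<bottom>"
| "delta00 p \<Longrightarrow> delta00 q \<Longrightarrow> delta00 (p \<^bold>\<longrightarrow> q)"
| "delta00 p \<Longrightarrow> delta00 (BAll t p)"

definition sigma01 :: "fm \<Rightarrow> bool"
  where "sigma01 p \<longleftrightarrow> (\<exists>q. delta00 q \<and> p = ExN q)"
definition pi01 :: "fm \<Rightarrow> bool"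
  where "pi01 p \<longleftrightarrow> (\<exists>q. delta00 q \<and> p = AllN q)"

definition basic_axioms :: "fm set" where
  "basic_axioms =
    {\<^bold>\<not> Var 0 \<^bold>+ One \<^bold>= Zero,
     Var 0 \<^bold>+ One \<^bold>= Var 1 \<^bold>+ One \<^bold>\<longrightarrow> Var 0 \<^bold>= Var 1,
     Var 0 \<^bold>+ Zero \<^bold>= Var 0,
     Var 0 \<^bold>+ (Var 1 \<^bold>+ One) \<^bold>= (Var 0 \<^bold>+ Var 1) \<^bold>+ One,
     Var 0 \<^bold>* Zero \<^bold>= Zero,
     Var 0 \<^bold>* (Var 1 \<^bold>+ One) \<^bold>= Var 0 \<^bold>* Var 1 \<^bold>+ Var 0,
     \<^bold>\<not> Var 0 \<^bold>< Zero,
     Var 0 \<^bold>< Var 1 \<^bold>+ One \<^bold>\<longleftrightarrow> Var 0 \<^bold>< Var 1 \<^bold>\<or> Var 0 \<^bold>= Var 1}"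

definition exp_axioms :: "fm set" where
  "exp_axioms =
    {Var 0 \<^bold>^ Zero \<^bold>= One,
     Var 0 \<^bold>^ (Var 1 \<^bold>+ One) \<^bold>= Var 0 \<^bold>^ Var 1 \<^bold>* Var 0}"

text \<open>
  In the schemes, number variable 0 of \<open>p\<close> (and \<open>q\<close>) is the distinguished one; all other free
  variables are parameters. In the induction step \<open>p\<close> is instantiated to the successor of that
  variable without shifting the parameters.
\<close>

definition induction_axiom :: "fm \<Rightarrow> fm" where
  "induction_axiom p =
    (instN Zero p \<^bold>\<and> AllN (p \<^bold>\<longrightarrow> subst (case_nat (Var 0 \<^bold>+ One) (\<lambda>n. Var (Suc n))) id p)
      \<^bold>\<longrightarrow> AllN p)"

definition comprehension_axiom :: "fm \<Rightarrow> fm \<Rightarrow> fm" where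
  "comprehension_axiom p q =
    (AllN (p \<^bold>\<longleftrightarrow> q) \<^bold>\<longrightarrow> ExS (AllN (Var 0 \<^bold>\<in> 0 \<^bold>\<longleftrightarrow> liftS p)))"

definition RCA0_star :: "fm set" where
  "RCA0_star = basic_axioms \<union> exp_axioms
    \<union> {induction_axiom p |p. delta00 p}
    \<union> {comprehension_axiom p q |p q. sigma01 p \<and> pi01 q}"


section \<open>Finite sequences and binary relations\<close>

text \<open>
  A finite sequence is coded by two numbers \<open>c\<close> and \<open>b\<close> (and its length): its \<open>i\<close>-th entry is the
  \<open>i\<close>-th digit of \<open>c\<close> in base \<open>b\<close>. \<open>entry c b i a\<close> says that this entry is \<open>a\<close>.
\<close>

definition entry :: "tm \<Rightarrow> tm \<Rightarrow> tm \<Rightarrow> tm \<Rightarrow> fm" where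
  "entry c b i a =
    (a \<^bold>< b \<^bold>\<and>
     BEx (c \<^bold>+ One) (BEx (\<up>(b \<^bold>^ i))
       (\<up>\<up>c \<^bold>= (Var 1 \<^bold>* \<up>\<up>b \<^bold>+ \<up>\<up>a) \<^bold>* \<up>\<up>(b \<^bold>^ i) \<^bold>+ Var 0)))"

text \<open>\<open>P a\<^sub>i a\<^sub>j\<close> holds, where \<open>P\<close> is a formula without number variables other than its arguments.\<close>

definition entries_rel :: "(tm \<Rightarrow> tm \<Rightarrow> fm) \<Rightarrow> tm \<Rightarrow> tm \<Rightarrow> tm \<Rightarrow> tm \<Rightarrow> fm" where
  "entries_rel P c b i j =
    BEx b (BEx (\<up>b)
      (entry (\<up>\<up>c) (\<up>\<up>b) (\<up>\<up>i) (Var 1) \<^bold>\<and> entry (\<up>\<up>c) (\<up>\<up>b) (\<up>\<up>j) (Var 0) \<^bold>\<and> P (Var 1) (Var 0)))"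

text \<open>\<open>P a\<^sub>i a\<^bsub>i+1\<^esub>\<close> for all \<open>i < m\<close>; this concerns the sequence \<open>a\<^sub>0, \<dots>, a\<^sub>m\<close> of length \<open>m + 1\<close>.\<close>

definition chain :: "(tm \<Rightarrow> tm \<Rightarrow> fm) \<Rightarrow> tm \<Rightarrow> tm \<Rightarrow> tm \<Rightarrow> fm" where
  "chain P c b m = BAll m (entries_rel P (\<up>c) (\<up>b) (Var 0) (Var 0 \<^bold>+ One))"

text \<open>\<open>P a\<^sub>i a\<^sub>j\<close> for all \<open>i < j < m + 1\<close>.\<close>

definition trans_chain :: "(tm \<Rightarrow> tm \<Rightarrow> fm) \<Rightarrow> tm \<Rightarrow> tm \<Rightarrow> tm \<Rightarrow> fm" where
  "trans_chain P c b m =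
    BAll (m \<^bold>+ One) (BAll (Var 0) (entries_rel P (\<up>\<up>c) (\<up>\<up>b) (Var 0) (Var 1)))"

definition pair :: "tm \<Rightarrow> tm \<Rightarrow> tm"
  where "pair x y = (x \<^bold>+ y) \<^bold>* (x \<^bold>+ y) \<^bold>+ x"

definition rel :: "nat \<Rightarrow> tm \<Rightarrow> tm \<Rightarrow> fm"
  where "rel Q x y = (pair x y \<^bold>\<in> Q)"

text \<open>\<open>Q \<subseteq> \<nat>\<^sup>2\<close>, i.e. \<open>Q\<close> consists of codes of pairs.\<close>

definition is_rel :: "nat \<Rightarrow> fm"
  where "is_rel Q = AllN (Var 0 \<^bold>\<in> Q \<^bold>\<longrightarrow> ExN (ExN (Var 2 \<^bold>= pair (Var 1) (Var 0))))"

text \<open>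
  \<open>x Q\<^sup>+ y\<close>: there are \<open>x = a\<^sub>0 Q a\<^sub>1 Q \<dots> Q a\<^sub>m = y\<close> with \<open>m > 0\<close>. The quantified variables are
  \<open>c = Var 2\<close>, \<open>b = Var 1\<close>, \<open>m = Var 0\<close>.
\<close>

definition trancl_fm :: "nat \<Rightarrow> tm \<Rightarrow> tm \<Rightarrow> fm" where
  "trancl_fm Q x y =
    ExN (ExN (ExN (Zero \<^bold>< Var 0
      \<^bold>\<and> entry (Var 2) (Var 1) Zero (\<up>\<up>\<up>x) \<^bold>\<and> entry (Var 2) (Var 1) (Var 0) (\<up>\<up>\<up>y)
      \<^bold>\<and> chain (rel Q) (Var 2) (Var 1) (Var 0))))"


section \<open>The fast growing hierarchy and bounds\<close>

text \<open>
  \<open>F_graph n x y\<close> is a bounded formula expressing \<open>F\<^sub>n(x) = y\<close>. In the step,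
  \<open>y = F\<^sub>n\<^bsup>(x+1)\<^esup>(x)\<close> is witnessed by the sequence of the iterates \<open>a\<^sub>0 = x, \<dots>, a\<^bsub>x+1\<^esub> = y\<close>. As
  \<open>F\<^sub>n(z) > z\<close>, all of them are at most \<open>y\<close>, so base \<open>y + 1\<close> suffices for coding them.
\<close>

primrec F_graph :: "nat \<Rightarrow> tm \<Rightarrow> tm \<Rightarrow> fm" where
  "F_graph 0 = (\<lambda>x y. y \<^bold>= x \<^bold>+ One)"
| "F_graph (Suc n) = (\<lambda>x y.
    BEx ((y \<^bold>+ One) \<^bold>^ (x \<^bold>+ One \<^bold>+ One))
      (entry (Var 0) (\<up>y \<^bold>+ One) Zero (\<up>x)
       \<^bold>\<and> entry (Var 0) (\<up>y \<^bold>+ One) (\<up>x \<^bold>+ One) (\<up>y)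
       \<^bold>\<and> chain (F_graph n) (Var 0) (\<up>y \<^bold>+ One) (\<up>x \<^bold>+ One)))"

definition Tot :: "nat \<Rightarrow> fm"
  where "Tot k = AllN (ExN (F_graph k (Var 1) (Var 0)))"

text \<open>
  A function \<open>g\<close> is given by a formula \<open>G\<close> for its graph. The variables \<open>Var 3, \<dots>, Var 0\<close> are \<open>c, b\<close>,
  \<open>m\<close> and \<open>a\<^sub>0\<close>; under \<open>ExN\<close>, \<open>Var 0\<close> is \<open>g(a\<^sub>0)\<close>. The length of the sequence is \<open>m + 1\<close>: the empty
  sequence, for which \<open>a\<^sub>0\<close> is meaningless, imposes no condition.
\<close>

definition bounded_by :: "nat \<Rightarrow> (tm \<Rightarrow> tm \<Rightarrow> fm) \<Rightarrow> fm" where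
  "bounded_by Q G =
    AllN (AllN (AllN (AllN (
      entry (Var 3) (Var 2) Zero (Var 0)
      \<^bold>\<and> chain (\<lambda>u v. rel Q v u) (Var 3) (Var 2) (Var 1)
      \<^bold>\<longrightarrow> ExN (G (Var 1) (Var 0) \<^bold>\<and> Var 2 \<^bold>+ One \<^bold>\<le> Var 0)))))"

definition H_bounded_by :: "nat \<Rightarrow> (tm \<Rightarrow> tm \<Rightarrow> fm) \<Rightarrow> fm" where
  "H_bounded_by Q G =
    AllN (AllN (AllN (AllN (
      entry (Var 3) (Var 2) Zero (Var 0)
      \<^bold>\<and> trans_chain (\<lambda>u v. rel Q v u) (Var 3) (Var 2) (Var 1)
      \<^bold>\<longrightarrow> ExN (G (Var 1) (Var 0) \<^bold>\<and> Var 2 \<^bold>+ One \<^bold>\<le> Var 0)))))"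

definition big_disj :: "fm list \<Rightarrow> fm"
  where "big_disj ps = foldr (\<^bold>\<or>) ps \<^bold>\<bottom>"
definition big_conj :: "fm list \<Rightarrow> fm"
  where "big_conj ps = foldr (\<^bold>\<and>) ps (\<^bold>\<not> \<^bold>\<bottom>)"

text \<open>
  In the formula below, \<open>R\<^sup>+\<close> is a set of the second-order universe. \<open>RCA\<^sup>*\<^sub>0\<close> does not prove that
  every \<open>R\<close> has such a set as its transitive closure, so the formula refers to \<open>R\<^sup>+\<close> by quantifying
  over the set \<open>P\<close> with \<open>P = R\<^sup>+\<close> (unique up to extensionality). Reading \<open>R\<^sup>+ \<subseteq> T\<^sub>0 \<union> \<dots>\<close> as a statement
  about the \<open>\<Sigma>\<^sup>0\<^sub>1\<close> class \<open>trancl_fm\<close>, whether or not it is a set, would make the formula false in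
  the model of the recursive sets. (Diagonalize against all recursive \<open>T\<^sub>0, \<dots>, T\<^bsub>k+1\<^esub>\<close>, each with its own
  infinite set \<open>A\<close> of numbers \<open>\<ge> 2\<close>: if \<open>x < y\<close> in \<open>A\<close> are found such that no \<open>T\<^sub>i\<close> contains \<open>(y, x)\<close>,
  put \<open>(z, x)\<close> and \<open>(y, z)\<close> into \<open>R\<close> for a fresh large \<open>z\<close>. If there are none, some \<open>T\<^sub>i\<close> is not
  H-bounded by \<open>F\<^sub>0\<close>, by Ramsey's theorem. This \<open>R\<close> is recursive and bounded by \<open>F\<^sub>0\<close>.)

  Below the set quantifiers, \<open>T\<^sub>i\<close> is set variable \<open>i\<close> for \<open>i < k + 2\<close>, \<open>P\<close> is \<open>k + 2\<close> and \<open>R\<close> is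
  \<open>k + 3\<close>.
\<close>

definition is_trancl :: "nat \<Rightarrow> nat \<Rightarrow> fm" where
  "is_trancl P R =
    (is_rel P \<^bold>\<and> AllN (AllN (rel P (Var 1) (Var 0) \<^bold>\<longleftrightarrow> trancl_fm R (Var 1) (Var 0))))"

definition termination_fm :: "nat \<Rightarrow> fm" where
  "termination_fm k =
    AllS (is_rel 0 \<^bold>\<and> bounded_by 0 (F_graph k) \<^bold>\<longrightarrow>
      AllS (is_trancl 0 1 \<^bold>\<longrightarrow>
        (ExS ^^ (k + 2))
          (big_conj (map is_rel [0..<k + 2])
           \<^bold>\<and> AllN (AllN (rel (k + 2) (Var 1) (Var 0)
                \<^bold>\<longrightarrow> big_disj (map (\<lambda>i. rel i (Var 1) (Var 0)) [0..<k + 2])))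
           \<^bold>\<and> big_conj (map (\<lambda>i. H_bounded_by i (F_graph 0)) [0..<k + 2]))))"

end

theory Submission
  imports Defs "HOL-Library.Countable"
begin

text \<open>
  By completeness it suffices to argue in a (possibly nonstandard) model of \<open>RCA\<^sup>*\<^sub>0\<close>. Let \<open>P = R\<^sup>+\<close>.
  The pairs \<open>x P y\<close> with \<open>x < y\<close> form \<open>T\<^sub>0\<close>, and \<open>x P x\<close> is impossible because \<open>R\<close>-cycles give
  arbitrarily long \<open>R\<close>-descents. For \<open>x > y\<close>, consider chains \<open>a\<^sub>0 < a\<^sub>1 < \<dots> < a\<^sub>m = x\<close> in which each
  \<open>a\<^bsub>i+1\<^esub> P a\<^sub>i\<close>, and let a tuple of \<open>k + 1\<close> numbers run along them: it starts with all entries \<open>a\<^sub>0\<close>,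
  and at \<open>a\<^bsub>i+1\<^esub>\<close> its lowest nonzero entry is decremented while the entries below it are reset to
  \<open>a\<^bsub>i+1\<^esub>\<close>. Such a tuple reaches 0 only after \<open>F\<^sub>k(a\<^sub>0) - 1\<close> steps, so a chain with tuple 0 has no
  extension, since \<open>R\<close> is bounded by \<open>F\<^sub>k\<close>. Hence the lexicographically least tuple with which \<open>x\<close> is
  reached is smaller than that of \<open>y\<close> whenever \<open>x P y\<close> and \<open>x > y\<close>; some entry \<open>j \<le> k\<close> decreases, and
  \<open>(x, y)\<close> is put into \<open>T\<^bsub>j+1\<^esub>\<close>. As the entries at \<open>x\<close> are at most \<open>x\<close>, this relation is bounded by \<open>F\<^sub>0\<close>.
\<close>

section \<open>Substitution\<close>

text \<open>The model has only bounded induction, so every object in the combinatorial argument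
  needs an explicit bound. This is why the chains are required to increase: a chain ending in x has
  at most x + 1 elements, all at most x, and together with its tuples it is coded below a power of x
  + 1. Hence reachability is a bounded property and least tuples exist. Increase also gives a_i >=
  a_0 + i, which makes a reset entry large enough for the next iterate of F. The R-paths behind the
  P-steps have no such bound; collection bounds the codes of all those along one chain
  simultaneously, and only then can they be joined by bounded induction.

  A tuple has k + 1 entries rather than k because k entries starting at a_0 are only guaranteed to
  last F_k(a_0) - 1 - a_0 steps; one more entry, also starting at a_0, accounts for the missing a_0.
  With T_0 this makes k + 2 relations. All recursion along the index of the hierarchy takes place
  outside the model, as k is standard.\<close>

abbreviation up :: "(nat \<Rightarrow> tm) \<Rightarrow> nat \<Rightarrow> tm" where
  "up \<sigma> \<equiv> case_nat (Var 0) (\<lambda>n. \<up>(\<sigma> n))"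
abbreviation upS :: "(nat \<Rightarrow> nat) \<Rightarrow> nat \<Rightarrow> nat" where
  "upS \<rho> \<equiv> case_nat 0 (\<lambda>n. Suc (\<rho> n))"

lemma substt_substt: "substt \<sigma> (substt \<tau> t) = substt (\<lambda>n. substt \<sigma> (\<tau> n)) t"
  by (induction t) auto

lemma substt_Var [simp]: "substt Var t = t"
  by (induction t) auto

lemma substt_case_lift [simp]: "substt (case_nat u \<sigma>) (\<up>t) = substt \<sigma> t"
  by (simp add: lift_def substt_substt)

lemma up_comp: "(\<lambda>n. substt (up \<sigma>) (up \<tau> n)) = up (\<lambda>n. substt \<sigma> (\<tau> n))"
  by (rule ext) (simp add: lift_def substt_substt split: nat.split)

lemma subst_subst:
  "subst \<sigma> \<rho> (subst \<tau> \<pi> p) = subst (\<lambda>n. substt \<sigma> (\<tau> n)) (\<lambda>n. \<rho> (\<pi> n)) p"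
proof (induction p arbitrary: \<sigma> \<rho> \<tau> \<pi>)
  case (AllN p)
  show ?case by (simp only: subst.simps AllN.IH up_comp)
next
  case (AllS p)
  have "(\<lambda>n. upS \<rho> (upS \<pi> n)) = upS (\<lambda>n. \<rho> (\<pi> n))"
    by (rule ext) (simp split: nat.split)
  then show ?case by (simp only: subst.simps AllS.IH)
qed (auto simp: substt_substt)

lemma up_Var: "up Var = Var"
  by (rule ext) (simp add: lift_def split: nat.split)

lemma upS_id: "upS (\<lambda>n. n) = (\<lambda>n. n)"
  by (rule ext) (simp split: nat.split)

lemma subst_Var [simp]: "subst Var (\<lambda>n. n) p = p"
  by (induction p) (auto simp: up_Var upS_id)

text \<open>Normal form for what follows: instantiating below a substituted binder collapses to one
  simultaneous substitution.\<close>

lemma instN_subst_up: "instN t (subst (up \<sigma>) \<rho> p) = subst (case_nat t \<sigma>) \<rho> p"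
proof -
  have "(\<lambda>n. substt (case_nat t Var) (up \<sigma> n)) = case_nat t \<sigma>"
    by (rule ext) (simp split: nat.split)
  then show ?thesis by (simp add: instN_def subst_subst)
qed

lemma instS_subst_up: "instS X (subst \<sigma> (upS \<rho>) p) = subst \<sigma> (case_nat X \<rho>) p"
proof -
  have "(\<lambda>n. case_nat X id (upS \<rho> n)) = case_nat X \<rho>"
    by (rule ext) (simp split: nat.split)
  then show ?thesis by (simp add: instS_def subst_subst)
qed

lemma subst_instN: "subst \<sigma> \<rho> (instN t p) = instN (substt \<sigma> t) (subst (up \<sigma>) \<rho> p)"
proof -
  have "(\<lambda>n. substt \<sigma> (case_nat t Var n)) = case_nat (substt \<sigma> t) \<sigma>"
    by (rule ext) (simp split: nat.split)
  then show ?thesis by (simp only: instN_subst_up) (simp add: instN_def subst_subst)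
qed

lemma subst_instS: "subst \<sigma> \<rho> (instS X p) = instS (\<rho> X) (subst \<sigma> (upS \<rho>) p)"
proof -
  have "(\<lambda>n. \<rho> (case_nat X id n)) = case_nat (\<rho> X) \<rho>"
    by (rule ext) (simp split: nat.split)
  then show ?thesis by (simp only: instS_subst_up) (simp add: instS_def subst_subst)
qed

lemma subst_liftN: "subst (up \<sigma>) \<rho> (liftN p) = liftN (subst \<sigma> \<rho> p)"
  by (simp add: liftN_def subst_subst lift_def)

lemma subst_liftS: "subst \<sigma> (upS \<rho>) (liftS p) = liftS (subst \<sigma> \<rho> p)"
  by (simp add: liftS_def subst_subst)

text \<open>A common strict bound for the free variables of both sorts; it is not optimal under
  quantifiers.\<close>

primrec vbt :: "tm \<Rightarrow> nat" where
  "vbt (Var n) = Suc n"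
| "vbt Zero = 0"
| "vbt One = 0"
| "vbt (s \<^bold>+ t) = max (vbt s) (vbt t)"
| "vbt (s \<^bold>* t) = max (vbt s) (vbt t)"
| "vbt (s \<^bold>^ t) = max (vbt s) (vbt t)"

primrec vb :: "fm \<Rightarrow> nat" where
  "vb (s \<^bold>= t) = max (vbt s) (vbt t)"
| "vb (s \<^bold>< t) = max (vbt s) (vbt t)"
| "vb (t \<^bold>\<in> X) = max (vbt t) (Suc X)"
| "vb \<^bold>\<bottom> = 0"
| "vb (p \<^bold>\<longrightarrow> q) = max (vb p) (vb q)"
| "vb (AllN p) = vb p"
| "vb (AllS p) = vb p"

lemma substt_cong: "(\<And>n. n < vbt t \<Longrightarrow> \<sigma> n = \<tau> n) \<Longrightarrow> substt \<sigma> t = substt \<tau> t"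
  by (induction t) auto

lemma subst_cong:
  "(\<And>n. n < vb p \<Longrightarrow> \<sigma> n = \<tau> n) \<Longrightarrow> (\<And>n. n < vb p \<Longrightarrow> \<rho> n = \<pi> n)
    \<Longrightarrow> subst \<sigma> \<rho> p = subst \<tau> \<pi> p"
proof (induction p arbitrary: \<sigma> \<rho> \<tau> \<pi>)
  case (AllN p)
  have "subst (up \<sigma>) \<rho> p = subst (up \<tau>) \<pi> p"
    using AllN.prems by (intro AllN.IH) (auto split: nat.split)
  then show ?case by simp
next
  case (AllS p)
  have "subst \<sigma> (upS \<rho>) p = subst \<tau> (upS \<pi>) p"
    using AllS.prems by (intro AllS.IH) (auto split: nat.split)
  then show ?case by simp
next
  case (Imp p q)
  have "subst \<sigma> \<rho> p = subst \<tau> \<pi> p" "subst \<sigma> \<rho> q = subst \<tau> \<pi> q"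
    using Imp.prems by (auto intro!: Imp.IH)
  then show ?case by simp
qed (auto intro!: substt_cong)


section \<open>Derivations\<close>

lemma deriv_mono: "deriv T \<Gamma> p \<Longrightarrow> T \<subseteq> U \<Longrightarrow> \<Gamma> \<subseteq> \<Delta> \<Longrightarrow> deriv U \<Delta> p"
proof (induction arbitrary: \<Delta> rule: deriv.induct)
  case (ImpI p \<Gamma> q)
  show ?case by (rule deriv.ImpI, rule ImpI.IH) (use ImpI.prems in auto)
next
  case (ImpE \<Gamma> p q)
  show ?case by (rule deriv.ImpE[of _ _ p]) (use ImpE in auto)
next
  case (Classical p \<Gamma>)
  show ?case by (rule deriv.Classical, rule Classical.IH) (use Classical.prems in auto)
next
  case (AllNI \<Gamma> p)
  show ?case by (rule deriv.AllNI, rule AllNI.IH) (use AllNI.prems in auto)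
next
  case (AllSI \<Gamma> p)
  show ?case by (rule deriv.AllSI, rule AllSI.IH) (use AllSI.prems in auto)
next
  case (AllNE \<Gamma> p t)
  show ?case by (rule deriv.AllNE, rule AllNE.IH) (use AllNE.prems in auto)
next
  case (AllSE \<Gamma> p t)
  show ?case by (rule deriv.AllSE, rule AllSE.IH) (use AllSE.prems in auto)
next
  case (EqSubst \<Gamma> s t p)
  show ?case by (rule deriv.EqSubst[of _ _ s]) (use EqSubst in auto)
qed (auto intro: deriv.Ax deriv.Assm deriv.EqRefl)

section \<open>Closure of derivability under substitution\<close>

lemma deriv_AllN_inst:
  "deriv T \<Gamma> ((AllN ^^ n) p) \<Longrightarrow> deriv T \<Gamma> (subst (\<lambda>i. if i < n then \<sigma> i else Var (i - n)) (\<lambda>n. n) p)"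
proof (induction n arbitrary: p \<sigma>)
  case (Suc n)
  let ?\<tau> = "\<lambda>i. if i < n then \<sigma> (Suc i) else Var (i - n)"
  have "deriv T \<Gamma> (subst ?\<tau> (\<lambda>n. n) (AllN p))"
    by (rule Suc.IH) (use Suc.prems in \<open>simp add: funpow_swap1\<close>)
  then have "deriv T \<Gamma> (instN (\<sigma> 0) (subst (up ?\<tau>) (\<lambda>n. n) p))"
    by (simp only: subst.simps) (rule deriv.AllNE)
  moreover have "case_nat (\<sigma> 0) ?\<tau> = (\<lambda>i. if i < Suc n then \<sigma> i else Var (i - Suc n))"
    by (rule ext) (simp split: nat.split)
  ultimately show ?case by (simp only: instN_subst_up)
qed simp

lemma deriv_AllS_inst:
  "deriv T \<Gamma> ((AllS ^^ n) p) \<Longrightarrow> deriv T \<Gamma> (subst Var (\<lambda>i. if i < n then \<rho> i else i - n) p)"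
proof (induction n arbitrary: p \<rho>)
  case (Suc n)
  let ?\<tau> = "\<lambda>i. if i < n then \<rho> (Suc i) else i - n"
  have "deriv T \<Gamma> (subst Var ?\<tau> (AllS p))"
    by (rule Suc.IH) (use Suc.prems in \<open>simp add: funpow_swap1\<close>)
  then have "deriv T \<Gamma> (instS (\<rho> 0) (subst Var (upS ?\<tau>) p))"
    by (simp only: subst.simps) (rule deriv.AllSE)
  moreover have "case_nat (\<rho> 0) ?\<tau> = (\<lambda>i. if i < Suc n then \<rho> i else i - Suc n)"
    by (rule ext) (simp split: nat.split)
  ultimately show ?case by (simp only: instS_subst_up)
qed simp

lemma deriv_gen:
  assumes "deriv T {} p"
  shows "deriv T {} ((AllN ^^ n) p)" "deriv T {} ((AllS ^^ n) p)"
proof -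
  show "deriv T {} ((AllN ^^ n) p)"
    by (induction n) (use assms in \<open>auto intro: deriv.AllNI\<close>)
  show "deriv T {} ((AllS ^^ n) p)"
    by (induction n) (use assms in \<open>auto intro: deriv.AllSI\<close>)
qed

text \<open>Without open assumptions every free variable may be generalized and then instantiated at
  will. Numbers come first; sets follow, with the variable bound of the formula already
  obtained.\<close>

lemma deriv_closed_subst:
  assumes "deriv T {} p"
  shows "deriv T {} (subst \<sigma> \<rho> p)"
proof -
  let ?q = "subst \<sigma> (\<lambda>n. n) p"
  have "deriv T {} (subst (\<lambda>i. if i < vb p then \<sigma> i else Var (i - vb p)) (\<lambda>n. n) p)"
    by (intro deriv_AllN_inst deriv_gen assms)
  also have "subst (\<lambda>i. if i < vb p then \<sigma> i else Var (i - vb p)) (\<lambda>n. n) p = ?q"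
    by (rule subst_cong) auto
  finally have "deriv T {} (subst Var (\<lambda>i. if i < vb ?q then \<rho> i else i - vb ?q) ?q)"
    by (intro deriv_AllS_inst deriv_gen)
  also have "subst Var (\<lambda>i. if i < vb ?q then \<rho> i else i - vb ?q) ?q = subst Var \<rho> ?q"
    by (rule subst_cong) auto
  finally show ?thesis by (simp add: subst_subst)
qed

text \<open>The context is substituted into while the theory stays fixed, since its members act as
  universal closures; the case of an axiom is therefore \<open>deriv_closed_subst\<close>.\<close>

lemma deriv_subst: "deriv T \<Gamma> p \<Longrightarrow> deriv T (subst \<sigma> \<rho> ` \<Gamma>) (subst \<sigma> \<rho> p)"
proof (induction arbitrary: \<sigma> \<rho> rule: deriv.induct)
  case (Ax p \<Gamma>)
  show ?case
    by (rule deriv_mono[of T "{}"]) (auto intro: deriv_closed_subst deriv.Ax Ax)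
next
  case (ImpI p \<Gamma> q)
  show ?case using ImpI.IH[of \<sigma> \<rho>] by (simp add: deriv.ImpI)
next
  case (ImpE \<Gamma> p q)
  show ?case using ImpE.IH(1)[of \<sigma> \<rho>] ImpE.IH(2)[of \<sigma> \<rho>] by (simp add: deriv.ImpE)
next
  case (Classical p \<Gamma>)
  show ?case
    by (rule deriv.Classical) (use Classical.IH[of \<sigma> \<rho>] in \<open>simp add: Neg_def\<close>)
next
  case (AllNI \<Gamma> p)
  have "subst (up \<sigma>) \<rho> ` liftN ` \<Gamma> = liftN ` subst \<sigma> \<rho> ` \<Gamma>"
    by (simp add: image_image subst_liftN)
  then show ?case using AllNI.IH[of "up \<sigma>" \<rho>] by (simp add: deriv.AllNI)
next
  case (AllNE \<Gamma> p t)
  show ?case using AllNE.IH[of \<sigma> \<rho>] unfolding subst_instN subst.simps by (rule deriv.AllNE)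
next
  case (AllSI \<Gamma> p)
  have "subst \<sigma> (upS \<rho>) ` liftS ` \<Gamma> = liftS ` subst \<sigma> \<rho> ` \<Gamma>"
    by (simp add: image_image subst_liftS)
  then show ?case using AllSI.IH[of \<sigma> "upS \<rho>"] by (simp add: deriv.AllSI)
next
  case (AllSE \<Gamma> p X)
  show ?case using AllSE.IH[of \<sigma> \<rho>] unfolding subst_instS subst.simps by (rule deriv.AllSE)
next
  case (EqSubst \<Gamma> s t p)
  show ?case
    using EqSubst.IH(1)[of \<sigma> \<rho>] EqSubst.IH(2)[of \<sigma> \<rho>] unfolding subst_instN subst.simps
    by (rule deriv.EqSubst)
qed (auto intro: deriv.Assm deriv.EqRefl)


section \<open>Saturated sets\<close>

definition consis :: "fm set \<Rightarrow> fm set \<Rightarrow> bool"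
  where "consis T \<Gamma> \<longleftrightarrow> \<not> deriv T \<Gamma> \<^bold>\<bottom>"

lemma consis_NegI: "consis T \<Gamma> \<Longrightarrow> \<not> consis T (insert p \<Gamma>) \<Longrightarrow> consis T (insert (\<^bold>\<not> p) \<Gamma>)"
  unfolding consis_def using deriv.ImpE[OF deriv.ImpI] deriv.Classical by blast

lemma consis_NegE: "consis T \<Gamma> \<Longrightarrow> p \<in> \<Gamma> \<Longrightarrow> (\<^bold>\<not> p) \<in> \<Gamma> \<Longrightarrow> False"
  unfolding consis_def Neg_def using deriv.ImpE deriv.Assm by blast

lemma consis_neg_deriv:
  assumes "\<not> consis T (insert (\<^bold>\<not> p) \<Gamma>)"
  shows "deriv T \<Gamma> p"
  using assms unfolding consis_def by (auto intro: deriv.Classical)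

text \<open>Henkin step without new constants: a variable above all indices of
  \<open>\<Gamma>\<close> serves as witness. If adding the negated instance were inconsistent,
  renaming that variable to index 0 would yield the premise of the generalization rule.\<close>

lemma consis_witnessN:
  assumes c: "consis T \<Gamma>" and q: "(\<^bold>\<not> AllN q) \<in> \<Gamma>" and x: "\<And>p. p \<in> \<Gamma> \<Longrightarrow> vb p \<le> x"
  shows "consis T (insert (\<^bold>\<not> instN (Var x) q) \<Gamma>)"
proof (rule ccontr)
  assume "\<not> ?thesis"
  then have d: "deriv T \<Gamma> (instN (Var x) q)" by (rule consis_neg_deriv)
  \<comment> \<open>On \<open>\<Gamma>\<close>, where \<open>x\<close> does not occur, this acts as
    \<open>liftN\<close>; on the instance it undoes the instantiation.\<close>
  define \<sigma> where "\<sigma> n = (if n = x then Var 0 else Var (Suc n))" for n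
  have vq: "vb q \<le> x" using x[OF q] by (simp add: Neg_def)
  have "subst \<sigma> (\<lambda>n. n) p = liftN p" if "p \<in> \<Gamma>" for p
    unfolding liftN_def by (rule subst_cong) (use x[OF that] in \<open>auto simp: \<sigma>_def\<close>)
  then have im: "subst \<sigma> (\<lambda>n. n) ` \<Gamma> = liftN ` \<Gamma>" by force
  have "subst \<sigma> (\<lambda>n. n) (instN (Var x) q)
      = subst (\<lambda>n. substt \<sigma> (case_nat (Var x) Var n)) (\<lambda>n. n) q"
    by (simp add: instN_def subst_subst)
  also have "\<dots> = subst Var (\<lambda>n. n) q"
    by (rule subst_cong) (use vq in \<open>auto simp: \<sigma>_def split: nat.split\<close>)
  finally have "deriv T (liftN ` \<Gamma>) q"
    using deriv_subst[OF d, of \<sigma> "\<lambda>n. n"] by (simp add: im)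
  then have "deriv T \<Gamma> (AllN q)" by (rule deriv.AllNI)
  moreover have "deriv T \<Gamma> (AllN q \<^bold>\<longrightarrow> \<^bold>\<bottom>)" using q by (simp add: Neg_def deriv.Assm)
  ultimately show False using c unfolding consis_def by (blast intro: deriv.ImpE)
qed

lemma consis_witnessS:
  assumes c: "consis T \<Gamma>" and q: "(\<^bold>\<not> AllS q) \<in> \<Gamma>" and x: "\<And>p. p \<in> \<Gamma> \<Longrightarrow> vb p \<le> x"
  shows "consis T (insert (\<^bold>\<not> instS x q) \<Gamma>)"
proof (rule ccontr)
  assume "\<not> ?thesis"
  then have d: "deriv T \<Gamma> (instS x q)" by (rule consis_neg_deriv)
  define \<rho> where "\<rho> n = (if n = x then 0 else Suc n)" for n
  have vq: "vb q \<le> x" using x[OF q] by (simp add: Neg_def)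
  have "subst Var \<rho> p = liftS p" if "p \<in> \<Gamma>" for p
    unfolding liftS_def by (rule subst_cong) (use x[OF that] in \<open>auto simp: \<rho>_def\<close>)
  then have im: "subst Var \<rho> ` \<Gamma> = liftS ` \<Gamma>" by force
  have "subst Var \<rho> (instS x q) = subst Var (\<lambda>n. \<rho> (case_nat x id n)) q"
    by (simp add: instS_def subst_subst)
  also have "\<dots> = subst Var (\<lambda>n. n) q"
    by (rule subst_cong) (use vq in \<open>auto simp: \<rho>_def split: nat.split\<close>)
  finally have "deriv T (liftS ` \<Gamma>) q"
    using deriv_subst[OF d, of Var \<rho>] by (simp add: im)
  then have "deriv T \<Gamma> (AllS q)" by (rule deriv.AllSI)
  moreover have "deriv T \<Gamma> (AllS q \<^bold>\<longrightarrow> \<^bold>\<bottom>)" using q by (simp add: Neg_def deriv.Assm)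
  ultimately show False using c unfolding consis_def by (blast intro: deriv.ImpE)
qed

instance tm :: countable by countable_datatype
instance fm :: countable by countable_datatype

text \<open>Conjunction binds more tightly than disjunction, so witnesses are demanded only when the
  negation of \<open>p\<close> is the member.\<close>

definition decides :: "fm set \<Rightarrow> fm \<Rightarrow> bool" where
  "decides \<Gamma> p \<longleftrightarrow> p \<in> \<Gamma> \<or> (\<^bold>\<not> p) \<in> \<Gamma>
    \<and> (\<forall>q. p = AllN q \<longrightarrow> (\<exists>t. (\<^bold>\<not> instN t q) \<in> \<Gamma>))
    \<and> (\<forall>q. p = AllS q \<longrightarrow> (\<exists>X. (\<^bold>\<not> instS X q) \<in> \<Gamma>))"

lemma decides_mono: "decides \<Gamma> p \<Longrightarrow> \<Gamma> \<subseteq> \<Delta> \<Longrightarrow> decides \<Delta> p"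
  unfolding decides_def by blast

lemma decides_ex:
  assumes "finite \<Gamma>" "consis T \<Gamma>"
  shows "\<exists>\<Delta>. \<Gamma> \<subseteq> \<Delta> \<and> finite \<Delta> \<and> consis T \<Delta> \<and> decides \<Delta> p"
proof (cases "consis T (insert p \<Gamma>)")
  case True
  then show ?thesis using assms by (intro exI[of _ "insert p \<Gamma>"]) (auto simp: decides_def)
next
  case False
  let ?\<Gamma> = "insert (\<^bold>\<not> p) \<Gamma>"
  have c: "consis T ?\<Gamma>" and f: "finite ?\<Gamma>" using consis_NegI False assms by auto
  \<comment> \<open>\<open>vb\<close> bounds the variables of both sorts, so this index is fresh
    both as a number variable and as a set variable.\<close>
  define x where "x = Max (vb ` ?\<Gamma>)"
  have x: "\<And>p. p \<in> ?\<Gamma> \<Longrightarrow> vb p \<le> x" unfolding x_def using f by (intro Max_ge) auto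
  consider (N) q where "p = AllN q" | (S) q where "p = AllS q"
    | (O) "\<nexists>q. p = AllN q" "\<nexists>q. p = AllS q" by blast
  then show ?thesis
  proof cases
    case N
    have "consis T (insert (\<^bold>\<not> instN (Var x) q) ?\<Gamma>)"
      by (rule consis_witnessN[OF c _ x]) (simp_all add: N)
    then show ?thesis using f N
      by (intro exI[of _ "insert (\<^bold>\<not> instN (Var x) q) ?\<Gamma>"]) (auto simp: decides_def)
  next
    case S
    have "consis T (insert (\<^bold>\<not> instS x q) ?\<Gamma>)"
      by (rule consis_witnessS[OF c _ x]) (simp_all add: S)
    then show ?thesis using f S
      by (intro exI[of _ "insert (\<^bold>\<not> instS x q) ?\<Gamma>"]) (auto simp: decides_def)
  next
    case O
    then show ?thesis using f c by (intro exI[of _ ?\<Gamma>]) (auto simp: decides_def)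
  qed
qed

text \<open>Consistency is asked of finite subsets only. This suffices for closure under derivations
  from finitely many members, and it passes to the union of a chain of finite stages without
  compactness of \<open>deriv\<close>.\<close>

definition saturated :: "fm set \<Rightarrow> fm set \<Rightarrow> bool" where
  "saturated T H \<longleftrightarrow> (\<forall>F. finite F \<longrightarrow> F \<subseteq> H \<longrightarrow> consis T F) \<and> (\<forall>p. decides H p)"

theorem saturated_ex:
  assumes "finite \<Gamma>" "consis T \<Gamma>"
  shows "\<exists>H. \<Gamma> \<subseteq> H \<and> saturated T H"
proof -
  define ok where "ok \<Delta> \<longleftrightarrow> finite \<Delta> \<and> consis T \<Delta>" for \<Delta>
  \<comment> \<open>Stage \<open>n\<close> settles the formula with number \<open>n\<close>. The
    stages stay finite, so fresh variables never run out.\<close>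
  have "\<exists>f. \<forall>n. (ok (f n) \<and> (n = 0 \<longrightarrow> f n = \<Gamma>)) \<and>
      (f n \<subseteq> f (Suc n) \<and> decides (f (Suc n)) (from_nat n))"
  proof (rule dependent_nat_choice)
    show "\<exists>\<Delta>. ok \<Delta> \<and> (0 = (0::nat) \<longrightarrow> \<Delta> = \<Gamma>)" using assms by (auto simp: ok_def)
  next
    fix \<Delta> and n :: nat
    assume "ok \<Delta> \<and> (n = 0 \<longrightarrow> \<Delta> = \<Gamma>)"
    then show "\<exists>\<Delta>'. (ok \<Delta>' \<and> (Suc n = 0 \<longrightarrow> \<Delta>' = \<Gamma>)) \<and> \<Delta> \<subseteq> \<Delta>' \<and> decides \<Delta>' (from_nat n)"
      using decides_ex[of \<Delta> T "from_nat n"] unfolding ok_def by auto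
  qed
  then obtain f where f': "\<forall>n. (ok (f n) \<and> (n = 0 \<longrightarrow> f n = \<Gamma>)) \<and>
      (f n \<subseteq> f (Suc n) \<and> decides (f (Suc n)) (from_nat n))" ..
  have f: "\<And>n. ok (f n)" "f 0 = \<Gamma>" "\<And>n. f n \<subseteq> f (Suc n)"
    "\<And>n. decides (f (Suc n)) (from_nat n)"
    using f' by simp_all
  have mono: "mono f" using f(3) by (simp add: mono_iff_le_Suc)
  let ?H = "\<Union>n. f n"
  have "decides ?H p" for p
  proof -
    have "decides (f (Suc (to_nat p))) p" using f(4)[of "to_nat p"] by simp
    then show ?thesis by (rule decides_mono) (rule UN_upper, simp)
  qed
  moreover have "consis T F" if F: "finite F" "F \<subseteq> ?H" for F
  proof -
    have "\<exists>n. F \<subseteq> f n" using F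
    proof (induction F rule: finite_induct)
      case (insert a F)
      then obtain n i where "F \<subseteq> f n" "a \<in> f i" by auto
      then have "insert a F \<subseteq> f (max n i)"
        using monoD[OF mono, of n "max n i"] monoD[OF mono, of i "max n i"] by auto
      then show ?case ..
    qed auto
    then obtain n where "F \<subseteq> f n" ..
    then show ?thesis using f(1)[of n] deriv_mono[of T F "\<^bold>\<bottom>" T "f n"] unfolding ok_def consis_def by auto
  qed
  moreover have "\<Gamma> \<subseteq> ?H" using f(2) by auto
  ultimately show ?thesis unfolding saturated_def by blast
qed

context
  fixes T H assumes sat: "saturated T H"
begin

lemma saturated_closed:
  assumes "finite F" "F \<subseteq> H" "deriv T F p"
  shows "p \<in> H"
proof (rule ccontr)
  assume "p \<notin> H"
  then have "(\<^bold>\<not> p) \<in> H" using sat unfolding saturated_def decides_def by blast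
  then have "consis T (insert (\<^bold>\<not> p) F)" using assms sat unfolding saturated_def by simp
  moreover have "deriv T (insert (\<^bold>\<not> p) F) p" using assms(3) by (rule deriv_mono) auto
  moreover have "deriv T (insert (\<^bold>\<not> p) F) (p \<^bold>\<longrightarrow> \<^bold>\<bottom>)" by (rule deriv.Assm) (simp add: Neg_def)
  ultimately show False unfolding consis_def by (blast intro: deriv.ImpE)
qed

lemma saturated_Fls: "\<^bold>\<bottom> \<notin> H"
proof
  assume "\<^bold>\<bottom> \<in> H"
  then have "consis T {\<^bold>\<bottom>}" using sat unfolding saturated_def by simp
  then show False unfolding consis_def by (simp add: deriv.Assm)
qed

lemma saturated_Neg: "(\<^bold>\<not> p) \<in> H \<longleftrightarrow> p \<notin> H"
proof
  assume *: "(\<^bold>\<not> p) \<in> H"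
  show "p \<notin> H"
  proof
    assume "p \<in> H"
    then have "consis T {p, \<^bold>\<not> p}" using sat * unfolding saturated_def by simp
    then show False by (rule consis_NegE[of _ _ p]) auto
  qed
next
  assume "p \<notin> H"
  then show "(\<^bold>\<not> p) \<in> H" using sat unfolding saturated_def decides_def by blast
qed

lemma saturated_Imp: "(p \<^bold>\<longrightarrow> q) \<in> H \<longleftrightarrow> (p \<in> H \<longrightarrow> q \<in> H)"
proof
  assume *: "(p \<^bold>\<longrightarrow> q) \<in> H"
  show "p \<in> H \<longrightarrow> q \<in> H"
  proof
    assume "p \<in> H"
    moreover have "deriv T {p \<^bold>\<longrightarrow> q, p} q"
      by (rule deriv.ImpE[of _ _ p]) (auto intro: deriv.Assm)
    ultimately show "q \<in> H" using * by (intro saturated_closed[of "{p \<^bold>\<longrightarrow> q, p}"]) auto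
  qed
next
  assume *: "p \<in> H \<longrightarrow> q \<in> H"
  show "(p \<^bold>\<longrightarrow> q) \<in> H"
  proof (cases "q \<in> H")
    case True
    have "deriv T {q} (p \<^bold>\<longrightarrow> q)" by (rule deriv.ImpI, rule deriv.Assm) simp
    then show ?thesis using True by (intro saturated_closed[of "{q}"]) auto
  next
    case False
    then have np: "(\<^bold>\<not> p) \<in> H" using * by (simp add: saturated_Neg)
    have "deriv T {\<^bold>\<not> p} (p \<^bold>\<longrightarrow> q)"
    proof (rule deriv.ImpI, rule deriv.Classical, rule deriv.ImpE[of _ _ p])
      show "deriv T {\<^bold>\<not> q, p, \<^bold>\<not> p} (p \<^bold>\<longrightarrow> \<^bold>\<bottom>)" by (rule deriv.Assm) (simp add: Neg_def)
    qed (rule deriv.Assm, simp)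
    then show ?thesis using np by (intro saturated_closed[of "{\<^bold>\<not> p}"]) auto
  qed
qed

lemma saturated_AllN: "AllN p \<in> H \<longleftrightarrow> (\<forall>t. instN t p \<in> H)"
proof
  assume *: "AllN p \<in> H"
  have "deriv T {AllN p} (instN t p)" for t
    by (rule deriv.AllNE, rule deriv.Assm) simp
  then show "\<forall>t. instN t p \<in> H" using * by (auto intro: saturated_closed[of "{AllN p}"])
next
  assume *: "\<forall>t. instN t p \<in> H"
  have "decides H (AllN p)" using sat unfolding saturated_def by simp
  then show "AllN p \<in> H" using * by (auto simp: decides_def saturated_Neg)
qed

lemma saturated_AllS: "AllS p \<in> H \<longleftrightarrow> (\<forall>X. instS X p \<in> H)"
proof
  assume *: "AllS p \<in> H"
  have "deriv T {AllS p} (instS X p)" for X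
    by (rule deriv.AllSE, rule deriv.Assm) simp
  then show "\<forall>X. instS X p \<in> H" using * by (auto intro: saturated_closed[of "{AllS p}"])
next
  assume *: "\<forall>X. instS X p \<in> H"
  have "decides H (AllS p)" using sat unfolding saturated_def by simp
  then show "AllS p \<in> H" using * by (auto simp: decides_def saturated_Neg)
qed

lemma saturated_axiom: "p \<in> T \<Longrightarrow> subst \<sigma> \<rho> p \<in> H"
  by (rule saturated_closed[of "{}"]) (auto intro: deriv_closed_subst deriv.Ax)

lemma saturated_eq_refl: "(t \<^bold>= t) \<in> H"
  by (rule saturated_closed[of "{}"]) (auto intro: deriv.EqRefl)

lemma saturated_eq_subst:
  assumes "(s \<^bold>= t) \<in> H" "instN s p \<in> H"
  shows "instN t p \<in> H"
proof -
  have "deriv T {s \<^bold>= t, instN s p} (instN t p)"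
    by (rule deriv.EqSubst[of _ _ s]) (auto intro: deriv.Assm)
  then show ?thesis using assms by (intro saturated_closed[of "{s \<^bold>= t, instN s p}"]) auto
qed

end


section \<open>Semantics\<close>

class arith_struct = zero + one + plus + times + ord +
  fixes pw :: "'a \<Rightarrow> 'a \<Rightarrow> 'a"  (infixr "^^^" 80)

primrec val :: "(nat \<Rightarrow> 'a::arith_struct) \<Rightarrow> tm \<Rightarrow> 'a" where
  "val e (Var n) = e n"
| "val e Zero = 0"
| "val e One = 1"
| "val e (s \<^bold>+ t) = val e s + val e t"
| "val e (s \<^bold>* t) = val e s * val e t"
| "val e (s \<^bold>^ t) = val e s ^^^ val e t"

primrec sem :: "'a set set \<Rightarrow> (nat \<Rightarrow> 'a::arith_struct) \<Rightarrow> (nat \<Rightarrow> 'a set) \<Rightarrow> fm \<Rightarrow> bool" where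
  "sem U e s (t \<^bold>= u) \<longleftrightarrow> val e t = val e u"
| "sem U e s (t \<^bold>< u) \<longleftrightarrow> val e t < val e u"
| "sem U e s (t \<^bold>\<in> X) \<longleftrightarrow> val e t \<in> s X"
| "sem U e s \<^bold>\<bottom> \<longleftrightarrow> False"
| "sem U e s (p \<^bold>\<longrightarrow> q) \<longleftrightarrow> (sem U e s p \<longrightarrow> sem U e s q)"
| "sem U e s (AllN p) \<longleftrightarrow> (\<forall>a. sem U (case_nat a e) s p)"
| "sem U e s (AllS p) \<longleftrightarrow> (\<forall>A\<in>U. sem U e (case_nat A s) p)"

lemma val_substt: "val e (substt \<sigma> t) = val (\<lambda>n. val e (\<sigma> n)) t"
  by (induction t) auto

lemma val_lift [simp]: "val (case_nat a e) (\<up>t) = val e t"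
  by (simp add: lift_def val_substt)

lemma val_up: "(\<lambda>n. val (case_nat a e) (up \<sigma> n)) = case_nat a (\<lambda>n. val e (\<sigma> n))"
  by (rule ext) (simp split: nat.split)

lemma sem_subst: "sem U e s (subst \<sigma> \<rho> p) = sem U (\<lambda>n. val e (\<sigma> n)) (\<lambda>n. s (\<rho> n)) p"
proof (induction p arbitrary: e s \<sigma> \<rho>)
  case (AllN p)
  show ?case by (simp add: AllN.IH val_up del: nat.case)
next
  case (AllS p)
  have "(\<lambda>n. case_nat A s (upS \<rho> n)) = case_nat A (\<lambda>n. s (\<rho> n))" for A
    by (rule ext) (simp split: nat.split)
  then show ?case by (simp add: AllS.IH)
qed (auto simp: val_substt)

lemma sem_instN: "sem U e s (instN t p) = sem U (case_nat (val e t) e) s p"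
proof -
  have "(\<lambda>n. val e (case_nat t Var n)) = case_nat (val e t) e"
    by (rule ext) (simp split: nat.split)
  then show ?thesis by (simp add: instN_def sem_subst)
qed

lemma sem_instS: "sem U e s (instS X p) = sem U e (case_nat (s X) s) p"
proof -
  have "(\<lambda>n. s (case_nat X id n)) = case_nat (s X) s"
    by (rule ext) (simp split: nat.split)
  then show ?thesis by (simp add: instS_def sem_subst)
qed

lemma sem_liftN: "sem U (case_nat a e) s (liftN p) = sem U e s p"
  by (simp add: liftN_def sem_subst)

lemma sem_liftS: "sem U e (case_nat A s) (liftS p) = sem U e s p"
  by (simp add: liftS_def sem_subst)

lemma sem_connectives [simp]:
  "sem U e s (\<^bold>\<not> p) \<longleftrightarrow> \<not> sem U e s p"
  "sem U e s (p \<^bold>\<and> q) \<longleftrightarrow> sem U e s p \<and> sem U e s q"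
  "sem U e s (p \<^bold>\<or> q) \<longleftrightarrow> sem U e s p \<or> sem U e s q"
  "sem U e s (p \<^bold>\<longleftrightarrow> q) \<longleftrightarrow> (sem U e s p \<longleftrightarrow> sem U e s q)"
  "sem U e s (ExN p) \<longleftrightarrow> (\<exists>a. sem U (case_nat a e) s p)"
  "sem U e s (ExS p) \<longleftrightarrow> (\<exists>A\<in>U. sem U e (case_nat A s) p)"
  "sem U e s (t \<^bold>\<le> u) \<longleftrightarrow> val e t < val e u \<or> val e t = val e u"
  "sem U e s (BAll t p) \<longleftrightarrow> (\<forall>a. a < val e t \<longrightarrow> sem U (case_nat a e) s p)"
  "sem U e s (BEx t p) \<longleftrightarrow> (\<exists>a. a < val e t \<and> sem U (case_nat a e) s p)"
  by (auto simp: Neg_def Conj_def Disj_def Iff_def ExN_def ExS_def Le_def BAll_def BEx_def)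

text \<open>The full set universe admits every assignment of sets, so the set quantifier rules need
  no side condition on \<open>s\<close>.\<close>

lemma sem_sound:
  fixes e :: "nat \<Rightarrow> 'a::arith_struct"
  shows "deriv T \<Gamma> p \<Longrightarrow> (\<And>q (e :: nat \<Rightarrow> 'a) s. q \<in> T \<Longrightarrow> sem UNIV e s q)
    \<Longrightarrow> (\<And>q. q \<in> \<Gamma> \<Longrightarrow> sem UNIV e s q) \<Longrightarrow> sem UNIV e s p"
proof (induction arbitrary: e s rule: deriv.induct)
  case (Ax p \<Gamma>)
  show ?case using Ax.hyps by (rule Ax.prems)
next
  case (AllNI \<Gamma> p)
  show ?case
  proof (simp only: sem.simps, rule allI)
    fix a
    show "sem UNIV (case_nat a e) s p"
      by (rule AllNI.IH) (use AllNI.prems in \<open>auto simp: sem_liftN\<close>)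
  qed
next
  case (AllSI \<Gamma> p)
  show ?case
  proof (simp only: sem.simps, rule ballI)
    fix A
    show "sem UNIV e (case_nat A s) p"
      by (rule AllSI.IH) (use AllSI.prems in \<open>auto simp: sem_liftS\<close>)
  qed
next
  case (Classical p \<Gamma>)
  show ?case
  proof (rule ccontr)
    assume "\<not> ?thesis"
    then have "sem UNIV e s \<^bold>\<bottom>" by (intro Classical.IH) (use Classical.prems in auto)
    then show False by simp
  qed
next
  case (AllNE \<Gamma> p t)
  then have "sem UNIV e s (AllN p)" by blast
  then show ?case by (simp add: sem_instN)
next
  case (AllSE \<Gamma> p t)
  then have "sem UNIV e s (AllS p)" by blast
  then show ?case by (simp add: sem_instS)
next
  case (EqSubst \<Gamma> u t p)
  then have "sem UNIV e s (u \<^bold>= t)" "sem UNIV e s (instN u p)" by blast+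
  then show ?case by (simp add: sem_instN)
next
  case (ImpI p \<Gamma> q)
  show ?case
  proof (simp only: sem.simps, rule impI)
    assume "sem UNIV e s p"
    then show "sem UNIV e s q" by (intro ImpI.IH) (use ImpI.prems in auto)
  qed
next
  case (ImpE \<Gamma> p q)
  then have "sem UNIV e s (p \<^bold>\<longrightarrow> q)" "sem UNIV e s p" by blast+
  then show ?case by simp
qed auto

section \<open>Consistency by the standard model\<close>

instantiation nat :: arith_struct
begin
definition "pw = ((^) :: nat \<Rightarrow> nat \<Rightarrow> nat)"
instance ..
end

lemma sem_induction_axiom:
  "sem U e s (induction_axiom p) \<longleftrightarrow>
    (sem U (case_nat 0 e) s p \<and> (\<forall>a. sem U (case_nat a e) s p \<longrightarrow> sem U (case_nat (a + 1) e) s p)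
      \<longrightarrow> (\<forall>a. sem U (case_nat a e) s p))"
proof -
  have "(\<lambda>n. val (case_nat a e) (case n of 0 \<Rightarrow> Var 0 \<^bold>+ One | Suc n \<Rightarrow> Var (Suc n)))
      = case_nat (a + 1) e" for a
    by (rule ext) (simp split: nat.split)
  then show ?thesis by (simp add: induction_axiom_def sem_instN sem_subst)
qed

lemma sem_comprehension_axiom:
  "sem U e s (comprehension_axiom p q) \<longleftrightarrow>
    ((\<forall>a. sem U (case_nat a e) s p \<longleftrightarrow> sem U (case_nat a e) s q)
      \<longrightarrow> (\<exists>A\<in>U. \<forall>a. a \<in> A \<longleftrightarrow> sem U (case_nat a e) s p))"
  by (simp add: comprehension_axiom_def sem_liftS)

lemma nat_model: "p \<in> RCA0_star \<Longrightarrow> sem UNIV (e :: nat \<Rightarrow> nat) s p"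
proof -
  have "sem UNIV e s (induction_axiom p)" for p
    unfolding sem_induction_axiom
  proof (intro impI allI)
    fix a
    assume *: "sem UNIV (case_nat 0 e) s p
      \<and> (\<forall>a. sem UNIV (case_nat a e) s p \<longrightarrow> sem UNIV (case_nat (a + 1) e) s p)"
    show "sem UNIV (case_nat a e) s p" by (induction a) (use * in auto)
  qed
  moreover have "sem UNIV e s (comprehension_axiom p q)" for p q
    unfolding sem_comprehension_axiom
    by (intro impI bexI[of _ "{a. sem UNIV (case_nat a e) s p}"]) auto
  moreover have "p \<in> basic_axioms \<union> exp_axioms \<Longrightarrow> sem UNIV e s p"
    by (auto simp: basic_axioms_def exp_axioms_def pw_nat_def)
  ultimately show "p \<in> RCA0_star \<Longrightarrow> sem UNIV e s p"
    unfolding RCA0_star_def by blast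
qed

text \<open>Guarantees that some saturated set exists for the choice in \<open>Thy\<close> even when
  no instance of the theorem is refutable.\<close>

lemma consis_RCA0_star: "consis RCA0_star {}"
  unfolding consis_def
proof
  assume "deriv RCA0_star {} \<^bold>\<bottom>"
  then have "sem UNIV (\<lambda>_. 0 :: nat) (\<lambda>_. {}) \<^bold>\<bottom>"
    by (rule sem_sound) (auto intro: nat_model)
  then show False by simp
qed


section \<open>The term model\<close>

text \<open>One saturated set which refutes all instances of the theorem that are refutable in this way
  suffices; making it a constant turns the domain of its term model into a type.\<close>

definition Thy :: "fm set" where
  "Thy = (SOME H. saturated RCA0_star H \<and>
    ((\<exists>k. \<not> (RCA0_star \<^bold>\<turnstile> termination_fm k)) \<longrightarrow> (\<exists>k. (\<^bold>\<not> termination_fm k) \<in> H)))"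

lemma Thy: "saturated RCA0_star Thy"
  "\<not> (RCA0_star \<^bold>\<turnstile> termination_fm k) \<Longrightarrow> \<exists>k. (\<^bold>\<not> termination_fm k) \<in> Thy"
proof -
  have "\<exists>H. saturated RCA0_star H \<and>
    ((\<exists>k. \<not> (RCA0_star \<^bold>\<turnstile> termination_fm k)) \<longrightarrow> (\<exists>k. (\<^bold>\<not> termination_fm k) \<in> H))"
  proof (cases "\<exists>k. \<not> (RCA0_star \<^bold>\<turnstile> termination_fm k)")
    case True
    then obtain k where "\<not> deriv RCA0_star {} (termination_fm k)" unfolding proves_def by blast
    then have "consis RCA0_star {\<^bold>\<not> termination_fm k}"
      using consis_neg_deriv by blast
    then show ?thesis using saturated_ex[of "{\<^bold>\<not> termination_fm k}" RCA0_star] by auto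
  next
    case False
    then show ?thesis using saturated_ex[OF _ consis_RCA0_star] by auto
  qed
  then have *: "saturated RCA0_star Thy \<and>
    ((\<exists>k. \<not> (RCA0_star \<^bold>\<turnstile> termination_fm k)) \<longrightarrow> (\<exists>k. (\<^bold>\<not> termination_fm k) \<in> Thy))"
    unfolding Thy_def by (rule someI_ex)
  then show "saturated RCA0_star Thy" ..
  show "\<not> (RCA0_star \<^bold>\<turnstile> termination_fm k) \<Longrightarrow> \<exists>k. (\<^bold>\<not> termination_fm k) \<in> Thy"
    using * by blast
qed

lemmas Thy_simps = saturated_Fls[OF Thy(1)] saturated_Imp[OF Thy(1)]
  saturated_AllN[OF Thy(1)] saturated_AllS[OF Thy(1)]

text \<open>Replacement in one variable while all others are substituted arbitrarily; symmetry,
  transitivity and the congruence laws are instances for suitable \<open>p\<close>.\<close>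

lemma Thy_eq_subst:
  assumes "(s \<^bold>= t) \<in> Thy"
  shows "subst (case_nat s \<sigma>) \<rho> p \<in> Thy \<longleftrightarrow> subst (case_nat t \<sigma>) \<rho> p \<in> Thy"
proof -
  have sym: "(t \<^bold>= s) \<in> Thy"
    using saturated_eq_subst[OF Thy(1) assms, of "Var 0 \<^bold>= \<up>s"] saturated_eq_refl[OF Thy(1), of s]
    by (simp add: instN_def)
  show ?thesis
    using saturated_eq_subst[OF Thy(1) assms, of "subst (up \<sigma>) \<rho> p"]
      saturated_eq_subst[OF Thy(1) sym, of "subst (up \<sigma>) \<rho> p"]
    by (auto simp only: instN_subst_up)
qed

lemma Thy_eq_fun: "(s \<^bold>= t) \<in> Thy \<Longrightarrow>
    (substt (case_nat s Var) u \<^bold>= substt (case_nat t Var) u) \<in> Thy"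
  using Thy_eq_subst[of s t Var "\<lambda>n. n" "\<up>(substt (case_nat s Var) u) \<^bold>= u"]
    saturated_eq_refl[OF Thy(1)]
  by simp

definition teq :: "tm \<Rightarrow> tm \<Rightarrow> bool" where "teq s t \<longleftrightarrow> (s \<^bold>= t) \<in> Thy"

lemma equivp_teq: "equivp teq"
proof (rule equivpI)
  show "reflp teq" by (simp add: reflp_def teq_def saturated_eq_refl[OF Thy(1)])
  show "symp teq"
  proof (rule sympI)
    fix s t assume "teq s t"
    then show "teq t s"
      using Thy_eq_subst[of s t Var "\<lambda>n. n" "Var 0 \<^bold>= \<up>s"] saturated_eq_refl[OF Thy(1)]
      by (simp add: teq_def)
  qed
  show "transp teq"
  proof (rule transpI)
    fix s t u assume "teq s t" "teq t u"
    then show "teq s u"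
      using Thy_eq_subst[of t u Var "\<lambda>n. n" "\<up>s \<^bold>= Var 0"] by (simp add: teq_def)
  qed
qed

quotient_type num = tm / teq
  by (rule equivp_teq)

lemma teq_trans: "teq s t \<Longrightarrow> teq t u \<Longrightarrow> teq s u"
  using equivp_teq by (rule equivp_transp)

lemma teq_cong:
  assumes "teq s s'" "teq t t'"
  shows "teq (s \<^bold>+ t) (s' \<^bold>+ t')" "teq (s \<^bold>* t) (s' \<^bold>* t')" "teq (s \<^bold>^ t) (s' \<^bold>^ t')"
    "(s \<^bold>< t) \<in> Thy \<longleftrightarrow> (s' \<^bold>< t') \<in> Thy"
proof -
  note fs = Thy_eq_fun[OF assms(1)[unfolded teq_def], folded teq_def]
  note ft = Thy_eq_fun[OF assms(2)[unfolded teq_def], folded teq_def]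
  show "teq (s \<^bold>+ t) (s' \<^bold>+ t')"
    using fs[of "Var 0 \<^bold>+ \<up>t"] ft[of "\<up>s' \<^bold>+ Var 0"] by (auto intro: teq_trans)
  show "teq (s \<^bold>* t) (s' \<^bold>* t')"
    using fs[of "Var 0 \<^bold>* \<up>t"] ft[of "\<up>s' \<^bold>* Var 0"] by (auto intro: teq_trans)
  show "teq (s \<^bold>^ t) (s' \<^bold>^ t')"
    using fs[of "Var 0 \<^bold>^ \<up>t"] ft[of "\<up>s' \<^bold>^ Var 0"] by (auto intro: teq_trans)
  show "(s \<^bold>< t) \<in> Thy \<longleftrightarrow> (s' \<^bold>< t') \<in> Thy"
    using Thy_eq_subst[OF assms(1)[unfolded teq_def], of Var "\<lambda>n. n" "Var 0 \<^bold>< \<up>t"]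
      Thy_eq_subst[OF assms(2)[unfolded teq_def], of Var "\<lambda>n. n" "\<up>s' \<^bold>< Var 0"]
    by simp
qed

instantiation num :: arith_struct
begin

lift_definition zero_num :: num is Zero .
lift_definition one_num :: num is One .
lift_definition plus_num :: "num \<Rightarrow> num \<Rightarrow> num" is "(\<^bold>+)" by (rule teq_cong)
lift_definition times_num :: "num \<Rightarrow> num \<Rightarrow> num" is "\<lambda>s t. s \<^bold>* t" by (rule teq_cong)
lift_definition pw_num :: "num \<Rightarrow> num \<Rightarrow> num" is "(\<^bold>^)" by (rule teq_cong)
lift_definition less_num :: "num \<Rightarrow> num \<Rightarrow> bool" is "\<lambda>s t. (s \<^bold>< t) \<in> Thy" by (rule teq_cong)
definition less_eq_num :: "num \<Rightarrow> num \<Rightarrow> bool" where "less_eq_num a b \<longleftrightarrow> a < b \<or> a = b"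
instance ..

end

lift_definition mem_set :: "nat \<Rightarrow> num \<Rightarrow> bool" is "\<lambda>X t. (t \<^bold>\<in> X) \<in> Thy"
proof -
  fix X s t assume "teq s t"
  then show "(s \<^bold>\<in> X) \<in> Thy \<longleftrightarrow> (t \<^bold>\<in> X) \<in> Thy"
    using Thy_eq_subst[of s t Var "\<lambda>n. n" "Var 0 \<^bold>\<in> X"] by (simp add: teq_def)
qed

text \<open>Set variables name all sets of the model; this is enough because a saturated set
  witnesses refuted set quantifiers by set variables.\<close>

definition Sets :: "num set set" where "Sets = range (\<lambda>X. Collect (mem_set X))"

lemma val_abs_num: "val (\<lambda>n. abs_num (\<sigma> n)) t = abs_num (substt \<sigma> t)"
  by (induction t)
    (simp_all add: zero_num.abs_eq one_num.abs_eq plus_num.abs_eq times_num.abs_eq pw_num.abs_eq)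

lemma abs_num_surj: "\<exists>t. a = abs_num t"
  by (induction a rule: num.abs_induct) blast

text \<open>Truth lemma. Every number is the class of a term and every set is named by a variable,
  so a quantifier ranges over exactly the instances that saturation speaks of.\<close>

lemma sem_Sets:
  "sem Sets (\<lambda>n. abs_num (\<sigma> n)) (\<lambda>n. Collect (mem_set (\<rho> n))) p \<longleftrightarrow> subst \<sigma> \<rho> p \<in> Thy"
proof (induction p arbitrary: \<sigma> \<rho>)
  case (Eq s t)
  show ?case by (simp add: val_abs_num num.abs_eq_iff teq_def)
next
  case (Less s t)
  show ?case by (simp add: val_abs_num less_num.abs_eq)
next
  case (Mem t X)
  show ?case by (simp add: val_abs_num mem_set.abs_eq)
next
  case (AllN p)
  have "case_nat (abs_num t) (\<lambda>n. abs_num (\<sigma> n)) = (\<lambda>n. abs_num (case_nat t \<sigma> n))" for t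
    by (rule ext) (simp split: nat.split)
  then have "sem Sets (case_nat (abs_num t) (\<lambda>n. abs_num (\<sigma> n))) (\<lambda>n. Collect (mem_set (\<rho> n))) p
      \<longleftrightarrow> instN t (subst (up \<sigma>) \<rho> p) \<in> Thy" for t
    by (simp only: AllN.IH instN_subst_up)
  moreover have "(\<forall>a. Q a) \<longleftrightarrow> (\<forall>t. Q (abs_num t))" for Q :: "num \<Rightarrow> bool"
    by (rule iffI; rule allI) (auto intro: num.abs_induct)
  ultimately show ?case by (simp add: Thy_simps)
next
  case (AllS p)
  have "case_nat (Collect (mem_set X)) (\<lambda>n. Collect (mem_set (\<rho> n))) = (\<lambda>n. Collect (mem_set (case_nat X \<rho> n)))" for X
    by (rule ext) (simp split: nat.split)
  then have "sem Sets (\<lambda>n. abs_num (\<sigma> n)) (case_nat (Collect (mem_set X)) (\<lambda>n. Collect (mem_set (\<rho> n)))) p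
      \<longleftrightarrow> instS X (subst \<sigma> (upS \<rho>) p) \<in> Thy" for X
    by (simp only: AllS.IH instS_subst_up)
  then show ?case by (simp add: Thy_simps Sets_def)
qed (auto simp: Thy_simps)

lemma assignment_abs: "\<exists>\<sigma>. e = (\<lambda>n. abs_num (\<sigma> n))"
proof -
  have "\<exists>\<sigma>. \<forall>n. e n = abs_num (\<sigma> n)" by (rule choice) (rule allI, rule abs_num_surj)
  then show ?thesis by auto
qed

lemma assignment_ext:
  assumes "range s \<subseteq> Sets"
  shows "\<exists>\<rho>. s = (\<lambda>n. Collect (mem_set (\<rho> n)))"
proof -
  have "\<exists>\<rho>. \<forall>n. s n = Collect (mem_set (\<rho> n))"
    by (rule choice) (use assms in \<open>auto simp: Sets_def\<close>)
  then show ?thesis by auto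
qed

lemma sem_axiom:
  assumes "p \<in> RCA0_star" "range s \<subseteq> Sets"
  shows "sem Sets e s p"
proof -
  obtain \<sigma> where "e = (\<lambda>n. abs_num (\<sigma> n))" using assignment_abs by blast
  moreover obtain \<rho> where "s = (\<lambda>n. Collect (mem_set (\<rho> n)))" using assignment_ext assms(2) by blast
  ultimately show ?thesis using saturated_axiom[OF Thy(1) assms(1)] by (simp add: sem_Sets)
qed

text \<open>\<open>Thy\<close> is one fixed set and may refute an instance other than the given one,
  so the premise has to cover all instances at once.\<close>

theorem provable_if_sem:
  assumes "\<And>k e s. range s \<subseteq> Sets \<Longrightarrow> sem Sets e s (termination_fm k)"
  shows "RCA0_star \<^bold>\<turnstile> termination_fm k"
proof (rule ccontr)
  assume "\<not> ?thesis"
  then obtain j where "(\<^bold>\<not> termination_fm j) \<in> Thy" using Thy(2) by blast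
  then have "termination_fm j \<notin> Thy" by (simp add: saturated_Neg[OF Thy(1)])
  moreover have "sem Sets (\<lambda>n. abs_num (Var n)) (\<lambda>n. Collect (mem_set n)) (termination_fm j)"
    by (rule assms) (auto simp: Sets_def)
  ultimately show False by (simp add: sem_Sets)
qed


section \<open>Bounded definability in the term model\<close>

definition mix :: "(nat \<Rightarrow> 'a) \<Rightarrow> (nat \<Rightarrow> 'a) \<Rightarrow> nat \<Rightarrow> 'a" where
  "mix e c n = (if even n then e (n div 2) else c (n div 2))"

lemma mix_simps [simp]: "mix e c (2 * n) = e n" "mix e c (Suc (2 * n)) = c n"
  by (simp_all add: mix_def)

text \<open>A bounded formula with parameters is evaluated at \<open>mix e c\<close>: the even variables are read from the
  assignment \<open>e\<close>, the odd ones from the number parameters \<open>c\<close>.\<close>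

definition trep :: "(nat \<Rightarrow> num) \<Rightarrow> ((nat \<Rightarrow> num) \<Rightarrow> num) \<Rightarrow> bool" where
  "trep c f \<longleftrightarrow> (\<exists>t. \<forall>e. f e = val (mix e c) t)"
definition frep :: "(nat \<Rightarrow> num) \<Rightarrow> (nat \<Rightarrow> num set) \<Rightarrow> ((nat \<Rightarrow> num) \<Rightarrow> bool) \<Rightarrow> bool" where
  "frep c s P \<longleftrightarrow> (\<exists>p. delta00 p \<and> (\<forall>e. P e \<longleftrightarrow> sem Sets (mix e c) s p))"
definition tmf :: "((nat \<Rightarrow> num) \<Rightarrow> num) \<Rightarrow> bool" where
  "tmf f \<longleftrightarrow> (\<exists>c. trep c f)"
text \<open>With the parameters hidden behind existential quantifiers, definability becomes a
  predicate on HOL functions of assignments and can be proved by introduction rules that follow the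
  syntax.\<close>

definition D :: "((nat \<Rightarrow> num) \<Rightarrow> bool) \<Rightarrow> bool" where
  "D P \<longleftrightarrow> (\<exists>c s. range s \<subseteq> Sets \<and> frep c s P)"

lemma delta00_subst: "delta00 p \<Longrightarrow> delta00 (subst \<sigma> \<rho> p)"
proof (induction arbitrary: \<sigma> \<rho> rule: delta00.induct)
  case (6 p t)
  have "subst \<sigma> \<rho> (BAll t p) = BAll (substt \<sigma> t) (subst (up \<sigma>) \<rho> p)"
    by (simp add: BAll_def lift_def substt_substt)
  then show ?case using 6 by (simp add: delta00.intros)
qed (auto intro: delta00.intros)

text \<open>Merging two parameter lists by \<open>mix\<close> moves parameter m of the first list to
  position 2 m, that is, from variable 2 m + 1 to variable 4 m + 1.\<close>

lemma mix_left: "mix e c n = mix e (mix c d) (if even n then n else 2 * n - 1)"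
proof (cases "even n")
  case False
  then obtain m where n: "n = Suc (2 * m)" by (auto elim: oddE)
  then have i: "(if even n then n else 2 * n - 1) = Suc (2 * (2 * m))" by simp
  show ?thesis unfolding i by (simp only: n mix_simps)
qed (simp add: mix_def)

lemma mix_right: "mix e d n = mix e (mix c d) (if even n then n else 2 * n + 1)"
proof (cases "even n")
  case False
  then obtain m where n: "n = Suc (2 * m)" by (auto elim: oddE)
  then have i: "(if even n then n else 2 * n + 1) = Suc (2 * Suc (2 * m))" by simp
  show ?thesis unfolding i by (simp only: n mix_simps)
qed (simp add: mix_def)

lemma trep_left: "trep c f \<Longrightarrow> trep (mix c d) f"
  unfolding trep_def
proof (elim exE)
  fix t assume "\<forall>e. f e = val (mix e c) t"
  then have "\<forall>e. f e = val (mix e (mix c d)) (substt (\<lambda>n. Var (if even n then n else 2 * n - 1)) t)"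
    by (simp only: val_substt val.simps mix_left[symmetric] simp_thms)
  then show "\<exists>t. \<forall>e. f e = val (mix e (mix c d)) t" ..
qed

lemma trep_right: "trep d f \<Longrightarrow> trep (mix c d) f"
  unfolding trep_def
proof (elim exE)
  fix t assume "\<forall>e. f e = val (mix e d) t"
  then have "\<forall>e. f e = val (mix e (mix c d)) (substt (\<lambda>n. Var (if even n then n else 2 * n + 1)) t)"
    by (simp only: val_substt val.simps mix_right[symmetric] simp_thms)
  then show "\<exists>t. \<forall>e. f e = val (mix e (mix c d)) t" ..
qed

lemma frep_left: "frep c s P \<Longrightarrow> frep (mix c d) (mix s r) P"
  unfolding frep_def
proof (elim exE conjE)
  fix p assume "delta00 p" "\<forall>e. P e \<longleftrightarrow> sem Sets (mix e c) s p"
  then have "delta00 (subst (\<lambda>n. Var (if even n then n else 2 * n - 1)) (\<lambda>n. 2 * n) p) \<and> (\<forall>e. P e \<longleftrightarrow>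
      sem Sets (mix e (mix c d)) (mix s r) (subst (\<lambda>n. Var (if even n then n else 2 * n - 1)) (\<lambda>n. 2 * n) p))"
    by (simp only: sem_subst val.simps mix_left[symmetric] mix_simps delta00_subst simp_thms)
  then show "\<exists>p. delta00 p \<and> (\<forall>e. P e \<longleftrightarrow> sem Sets (mix e (mix c d)) (mix s r) p)" ..
qed

lemma frep_right: "frep d r P \<Longrightarrow> frep (mix c d) (mix s r) P"
  unfolding frep_def
proof (elim exE conjE)
  fix p assume "delta00 p" "\<forall>e. P e \<longleftrightarrow> sem Sets (mix e d) r p"
  then have "delta00 (subst (\<lambda>n. Var (if even n then n else 2 * n + 1)) (\<lambda>n. Suc (2 * n)) p) \<and> (\<forall>e. P e \<longleftrightarrow>
      sem Sets (mix e (mix c d)) (mix s r) (subst (\<lambda>n. Var (if even n then n else 2 * n + 1)) (\<lambda>n. Suc (2 * n)) p))"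
    by (simp only: sem_subst val.simps mix_right[symmetric] mix_simps delta00_subst simp_thms)
  then show "\<exists>p. delta00 p \<and> (\<forall>e. P e \<longleftrightarrow> sem Sets (mix e (mix c d)) (mix s r) p)" ..
qed

lemma range_mix: "range s \<subseteq> A \<Longrightarrow> range r \<subseteq> A \<Longrightarrow> range (mix s r) \<subseteq> A"
  by (auto simp: mix_def)

lemma tmf2:
  assumes "tmf f" "tmf g"
  obtains c where "trep c f" "trep c g"
  using assms trep_left trep_right unfolding tmf_def by metis

lemma tmf_var: "tmf (\<lambda>e. e n)"
  unfolding tmf_def trep_def
  by (intro exI[of _ "\<lambda>_. 0"] exI[of _ "Var (2 * n)"]) simp

lemma tmf_const: "tmf (\<lambda>e. a)"
  unfolding tmf_def trep_def
  by (intro exI[of _ "\<lambda>_. a"] exI[of _ "Var (Suc (2 * 0))"]) (simp only: val.simps mix_simps, simp)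

lemma tmf_add: assumes "tmf f" "tmf g" shows "tmf (\<lambda>e. f e + g e)"
proof -
  obtain c where "trep c f" "trep c g" by (rule tmf2[OF assms])
  then obtain t u where "\<forall>e. f e = val (mix e c) t" "\<forall>e. g e = val (mix e c) u"
    unfolding trep_def by blast
  then have "\<forall>e. f e + g e = val (mix e c) (t \<^bold>+ u)" by simp
  then show ?thesis unfolding tmf_def trep_def by blast
qed

lemma tmf_mult: assumes "tmf f" "tmf g" shows "tmf (\<lambda>e. f e * g e)"
proof -
  obtain c where "trep c f" "trep c g" by (rule tmf2[OF assms])
  then obtain t u where "\<forall>e. f e = val (mix e c) t" "\<forall>e. g e = val (mix e c) u"
    unfolding trep_def by blast
  then have "\<forall>e. f e * g e = val (mix e c) (t \<^bold>* u)" by simp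
  then show ?thesis unfolding tmf_def trep_def by blast
qed

lemma tmf_pw: assumes "tmf f" "tmf g" shows "tmf (\<lambda>e. f e ^^^ g e)"
proof -
  obtain c where "trep c f" "trep c g" by (rule tmf2[OF assms])
  then obtain t u where "\<forall>e. f e = val (mix e c) t" "\<forall>e. g e = val (mix e c) u"
    unfolding trep_def by blast
  then have "\<forall>e. f e ^^^ g e = val (mix e c) (t \<^bold>^ u)" by simp
  then show ?thesis unfolding tmf_def trep_def by blast
qed

lemmas tmf_intros = tmf_var tmf_const tmf_add tmf_mult tmf_pw

lemma Sets_nonempty: "\<exists>s :: nat \<Rightarrow> num set. range s \<subseteq> Sets"
  by (rule exI[of _ "\<lambda>X. Collect (mem_set X)"]) (simp add: Sets_def)

lemma D_eq_tmf: assumes "tmf f" "tmf g" shows "D (\<lambda>e. f e = g e)"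
proof -
  obtain s :: "nat \<Rightarrow> num set" where s: "range s \<subseteq> Sets" using Sets_nonempty ..
  obtain c where "trep c f" "trep c g" by (rule tmf2[OF assms])
  then obtain t u where "\<forall>e. f e = val (mix e c) t" "\<forall>e. g e = val (mix e c) u"
    unfolding trep_def by blast
  then have "\<forall>e. (f e = g e) = sem Sets (mix e c) s (t \<^bold>= u)" by simp
  then show ?thesis using s delta00.intros(1) unfolding D_def frep_def by blast
qed

lemma D_less_tmf: assumes "tmf f" "tmf g" shows "D (\<lambda>e. f e < g e)"
proof -
  obtain s :: "nat \<Rightarrow> num set" where s: "range s \<subseteq> Sets" using Sets_nonempty ..
  obtain c where "trep c f" "trep c g" by (rule tmf2[OF assms])
  then obtain t u where "\<forall>e. f e = val (mix e c) t" "\<forall>e. g e = val (mix e c) u"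
    unfolding trep_def by blast
  then have "\<forall>e. (f e < g e) = sem Sets (mix e c) s (t \<^bold>< u)" by simp
  then show ?thesis using s delta00.intros(2) unfolding D_def frep_def by blast
qed

lemma D_mem_tmf: assumes "tmf f" "A \<in> Sets" shows "D (\<lambda>e. f e \<in> A)"
proof -
  obtain c t where "\<forall>e. f e = val (mix e c) t" using assms(1) unfolding tmf_def trep_def by blast
  then have "\<forall>e. (f e \<in> A) = sem Sets (mix e c) (\<lambda>_. A) (t \<^bold>\<in> 0)" by simp
  moreover have "range (\<lambda>_ :: nat. A) \<subseteq> Sets" using assms(2) by auto
  ultimately show ?thesis using delta00.intros(3) unfolding D_def frep_def by blast
qed

lemma D_False: "D (\<lambda>e. False)"
proof -
  obtain s :: "nat \<Rightarrow> num set" where s: "range s \<subseteq> Sets" using Sets_nonempty ..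
  have "\<forall>e. False = sem Sets (mix e (\<lambda>_. 0)) s \<^bold>\<bottom>" by simp
  then show ?thesis using s delta00.intros(4) unfolding D_def frep_def by blast
qed

lemma D_imp: assumes "D P" "D Q" shows "D (\<lambda>e. P e \<longrightarrow> Q e)"
proof -
  obtain c s where 1: "range s \<subseteq> Sets" "frep c s P" using assms(1) unfolding D_def by blast
  obtain d r where 2: "range r \<subseteq> Sets" "frep d r Q" using assms(2) unfolding D_def by blast
  obtain p q where "delta00 p" "delta00 q" "\<forall>e. P e = sem Sets (mix e (mix c d)) (mix s r) p"
      "\<forall>e. Q e = sem Sets (mix e (mix c d)) (mix s r) q"
    using frep_left[OF 1(2), of d r] frep_right[OF 2(2), of c s] unfolding frep_def by blast
  then have "delta00 (p \<^bold>\<longrightarrow> q) \<and> (\<forall>e. (P e \<longrightarrow> Q e) = sem Sets (mix e (mix c d)) (mix s r) (p \<^bold>\<longrightarrow> q))"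
    by (simp add: delta00.intros)
  then show ?thesis using range_mix[OF 1(1) 2(1)] unfolding D_def frep_def by blast
qed

text \<open>In the formula for \<open>P\<close> the quantified variable is the entry 0 of the assignment, which shifts the
  interleaved variables.\<close>

lemma D_ball_tmf:
  assumes "tmf f" "D (\<lambda>e. P (\<lambda>n. e (Suc n)) (e 0))"
  shows "D (\<lambda>e. \<forall>x<f e. P e x)"
proof -
  obtain c d s where s: "range s \<subseteq> Sets" and 1: "trep c f"
    and 2: "frep d s (\<lambda>e. P (\<lambda>n. e (Suc n)) (e 0))"
    using assms unfolding D_def tmf_def by blast
  let ?c = "mix c d"
  obtain t where t: "\<forall>e. f e = val (mix e ?c) t" using trep_left[OF 1] unfolding trep_def by blast
  obtain p where p: "delta00 p" "\<forall>e. P (\<lambda>n. e (Suc n)) (e 0) = sem Sets (mix e ?c) (mix s s) p"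
    using frep_right[OF 2] unfolding frep_def by blast
  \<comment> \<open>Once \<open>x\<close> takes index 0, entry j of \<open>e\<close> sits at index 2
    j + 1 and parameter j at index 2 j + 2.\<close>
  define h where "h n = (if n = 0 then 0 else if even n then n - 1 else n + 1)" for n :: nat
  have h: "mix (case_nat x e) b n = case_nat x (mix e b) (h n)" for x :: num and e b n
  proof (cases "even n")
    case True
    then obtain m where n: "n = 2 * m" by blast
    show ?thesis
    proof (cases m)
      case (Suc j)
      then have "h n = Suc (2 * j)" using n by (simp add: h_def)
      then show ?thesis by (simp only: n mix_simps nat.case Suc)
    qed (simp add: n h_def mix_def)
  next
    case False
    then obtain m where n: "n = Suc (2 * m)" by (auto elim: oddE)
    then have "h n = Suc (Suc (2 * m))" by (simp add: h_def)
    then show ?thesis by (simp only: n mix_simps nat.case)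
  qed
  have "P e x = sem Sets (case_nat x (mix e ?c)) (mix s s) (subst (\<lambda>n. Var (h n)) (\<lambda>n. n) p)" for x e
    using p(2)[rule_format, of "case_nat x e"] by (simp add: sem_subst h[symmetric])
  then have "\<forall>e. (\<forall>x<f e. P e x) =
      sem Sets (mix e ?c) (mix s s) (BAll t (subst (\<lambda>n. Var (h n)) (\<lambda>n. n) p))"
    using t by simp
  moreover have "delta00 (BAll t (subst (\<lambda>n. Var (h n)) (\<lambda>n. n) p))"
    by (intro delta00.intros delta00_subst p)
  ultimately show ?thesis using range_mix[OF s s] unfolding D_def frep_def by blast
qed

lemma D_not: "D P \<Longrightarrow> D (\<lambda>e. \<not> P e)"
  using D_imp[OF _ D_False] by simp

lemma D_or: "D P \<Longrightarrow> D Q \<Longrightarrow> D (\<lambda>e. P e \<or> Q e)"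
  using D_imp[OF D_not[of P], of Q] by (simp add: disj_imp)

lemma D_and: "D P \<Longrightarrow> D Q \<Longrightarrow> D (\<lambda>e. P e \<and> Q e)"
  using D_not[OF D_or[OF D_not[of P] D_not[of Q]]] by simp

lemma D_bex_tmf:
  assumes "tmf f" "D (\<lambda>e. P (\<lambda>n. e (Suc n)) (e 0))"
  shows "D (\<lambda>e. \<exists>x<f e. P e x)"
  using D_not[OF D_ball_tmf[OF assms(1), of "\<lambda>e x. \<not> P e x"]] D_not[OF assms(2)] by simp

lemma D_rename: assumes "D P" shows "D (\<lambda>e. P (\<lambda>n. e (g n)))"
proof -
  obtain c s p where s: "range s \<subseteq> Sets" and p: "delta00 p" "\<forall>e. P e = sem Sets (mix e c) s p"
    using assms unfolding D_def frep_def by blast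
  define h where "h n = (if even n then 2 * g (n div 2) else n)" for n
  have h: "mix (\<lambda>n. e (g n)) c n = mix e c (h n)" for e n by (simp add: mix_def h_def)
  have "\<forall>e. P (\<lambda>n. e (g n)) = sem Sets (mix e c) s (subst (\<lambda>n. Var (h n)) (\<lambda>n. n) p)"
    using p(2) by (simp add: sem_subst h[symmetric])
  moreover have "delta00 (subst (\<lambda>n. Var (h n)) (\<lambda>n. n) p)" by (intro delta00_subst p)
  ultimately show ?thesis using s unfolding D_def frep_def by blast
qed

lemma D_bool: "D (\<lambda>e. b)"
  using D_False D_not[OF D_False] by (cases b) auto

lemmas D_tmf_intros = D_eq_tmf D_less_tmf D_imp D_ball_tmf D_not D_or D_and D_bex_tmf D_bool


section \<open>Arithmetic of the term model\<close>

lemma num_axioms: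
  fixes x y :: num
  shows "x + 1 \<noteq> 0" "x + 1 = y + 1 \<longleftrightarrow> x = y" "x + 0 = x" "x + (y + 1) = (x + y) + 1"
    "x * 0 = 0" "x * (y + 1) = x * y + x" "\<not> x < 0" "x < y + 1 \<longleftrightarrow> x < y \<or> x = y"
    "x ^^^ 0 = 1" "x ^^^ (y + 1) = x ^^^ y * x"
proof -
  let ?e = "case_nat x (\<lambda>_. y)"
  obtain s :: "nat \<Rightarrow> num set" where s: "range s \<subseteq> Sets" using Sets_nonempty ..
  have "p \<in> basic_axioms \<union> exp_axioms \<Longrightarrow> sem Sets ?e s p" for p
    by (rule sem_axiom[OF _ s]) (auto simp: RCA0_star_def)
  then have "\<forall>p \<in> basic_axioms \<union> exp_axioms. sem Sets ?e s p" by blast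
  then show "x + 1 \<noteq> 0" "x + 1 = y + 1 \<longleftrightarrow> x = y" "x + 0 = x" "x + (y + 1) = (x + y) + 1"
    "x * 0 = 0" "x * (y + 1) = x * y + x" "\<not> x < 0" "x < y + 1 \<longleftrightarrow> x < y \<or> x = y"
    "x ^^^ 0 = 1" "x ^^^ (y + 1) = x ^^^ y * x"
    by (auto simp: basic_axioms_def exp_axioms_def)
qed

lemma D_induct [case_names D 0 Suc]:
  assumes "D (\<lambda>e. Q (e 0))" "Q 0" "\<And>x. Q x \<Longrightarrow> Q (x + 1)"
  shows "Q x"
proof -
  obtain c s p where s: "range s \<subseteq> Sets" and p: "delta00 p" "\<forall>e. Q (e 0) = sem Sets (mix e c) s p"
    using assms(1) unfolding D_def frep_def by blast
  \<comment> \<open>Only variable 0 and the parameters matter for the truth of \<open>p\<close>; the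
    other even variables are set to 0.\<close>
  define e where "e n = mix (\<lambda>_. 0) c (Suc n)" for n
  have "case_nat y e = mix (case_nat y (\<lambda>_. 0)) c" for y
    by (rule ext) (simp add: e_def mix_def split: nat.split)
  then have eq: "sem Sets (case_nat y e) s p = Q y" for y
    using p(2)[rule_format, of "case_nat y (\<lambda>_. 0)"] by simp
  have "sem Sets e s (induction_axiom p)"
  proof (rule sem_axiom[OF _ s])
    show "induction_axiom p \<in> RCA0_star" using p(1) unfolding RCA0_star_def by blast
  qed
  then have "Q 0 \<and> (\<forall>a. Q a \<longrightarrow> Q (a + 1)) \<longrightarrow> (\<forall>a. Q a)"
    unfolding sem_induction_axiom eq .
  then show ?thesis using assms(2,3) by blast
qed

lemma num_add_0: "0 + (x::num) = x"
proof (induction x rule: D_induct)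
  show "D (\<lambda>e. 0 + e 0 = e 0)" by (intro D_tmf_intros tmf_intros)
qed (simp_all only: num_axioms)

lemma num_add_Suc: "(x + 1) + (y::num) = (x + y) + 1"
proof (induction y rule: D_induct)
  show "D (\<lambda>e. (x + 1) + e 0 = (x + e 0) + 1)" by (intro D_tmf_intros tmf_intros)
qed (simp_all only: num_axioms)

lemma num_add_comm: "x + y = y + (x::num)"
proof (induction y rule: D_induct)
  show "D (\<lambda>e. x + e 0 = e 0 + x)" by (intro D_tmf_intros tmf_intros)
qed (simp_all only: num_axioms num_add_0 num_add_Suc)

lemma num_add_assoc: "(x + y) + z = x + (y + (z::num))"
proof (induction z rule: D_induct)
  show "D (\<lambda>e. (x + y) + e 0 = x + (y + e 0))" by (intro D_tmf_intros tmf_intros)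
qed (simp_all only: num_axioms)

interpretation num_add: comm_monoid "(+)" "0 :: num"
  by standard (rule num_add_assoc num_add_comm num_axioms)+

lemma num_mult_0: "0 * (x::num) = 0"
proof (induction x rule: D_induct)
  show "D (\<lambda>e. 0 * e 0 = 0)" by (intro D_tmf_intros tmf_intros)
qed (simp_all only: num_axioms)

lemma num_mult_Suc: "(x + 1) * (y::num) = x * y + y"
proof (induction y rule: D_induct)
  show "D (\<lambda>e. (x + 1) * e 0 = x * e 0 + e 0)" by (intro D_tmf_intros tmf_intros)
qed (simp_all only: num_axioms num_add.left_commute num_add.assoc num_add.commute)

lemma num_mult_comm: "x * y = y * (x::num)"
proof (induction y rule: D_induct)
  show "D (\<lambda>e. x * e 0 = e 0 * x)" by (intro D_tmf_intros tmf_intros)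
qed (simp_all only: num_axioms num_mult_0 num_mult_Suc)

lemma num_distrib: "x * (y + z) = x * y + x * (z::num)"
proof (induction z rule: D_induct)
  show "D (\<lambda>e. x * (y + e 0) = x * y + x * e 0)" by (intro D_tmf_intros tmf_intros)
qed (simp_all only: num_axioms num_add.assoc[symmetric])

lemma num_mult_1: "1 * (x::num) = x"
  using num_mult_Suc[of 0 x] by (simp only: num_mult_0 num_add_0)

lemma num_mult_assoc: "(x * y) * z = x * (y * (z::num))"
proof (induction z rule: D_induct)
  show "D (\<lambda>e. (x * y) * e 0 = x * (y * e 0))" by (intro D_tmf_intros tmf_intros)
qed (simp_all only: num_axioms num_distrib num_mult_1 num_mult_comm[of _ 1])

lemma num_cancel: "x + z = y + z \<Longrightarrow> x = (y::num)"
proof -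
  have "x + z = y + z \<longrightarrow> x = y"
  proof (induction z rule: D_induct)
    show "D (\<lambda>e. x + e 0 = y + e 0 \<longrightarrow> x = y)" by (intro D_tmf_intros tmf_intros)
  qed (simp_all only: num_axioms, simp)
  then show "x + z = y + z \<Longrightarrow> x = y" by blast
qed

lemma num_less_add: "x < x + (z + 1 :: num)"
proof (induction z rule: D_induct)
  show "D (\<lambda>e. x < x + (e 0 + 1))" by (intro D_tmf_intros tmf_intros)
qed (simp_all add: num_axioms)

lemma num_less_iff: "x < y \<longleftrightarrow> (\<exists>z. y = x + (z + 1 :: num))"
proof
  \<comment> \<open>The witness is kept below \<open>y\<close> so that the induction formula is
    bounded.\<close>
  have "x < y \<longrightarrow> (\<exists>z<y. y = x + (z + 1))"
  proof (induction y rule: D_induct)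
    show "D (\<lambda>e. x < e 0 \<longrightarrow> (\<exists>z<e 0. e 0 = x + (z + 1)))" by (intro D_tmf_intros tmf_intros)
  next
    case (Suc y)
    show ?case
    proof
      assume "x < y + 1"
      then consider "x < y" | "x = y" by (auto simp: num_axioms)
      then have "\<exists>z. y + 1 = x + (z + 1)"
      proof cases
        case 1
        then obtain z where "y = x + (z + 1)" using Suc by blast
        then have "y + 1 = x + ((z + 1) + 1)" by (simp only: num_axioms)
        then show ?thesis ..
      next
        case 2
        then have "y + 1 = x + (0 + 1)" by (simp only: num_axioms num_add_0)
        then show ?thesis ..
      qed
      then obtain z where z: "y + 1 = x + (z + 1)" ..
      then have "y + 1 = z + (x + 1)" by (simp only: num_axioms num_add_comm[of x z])
      then have "z < y + 1" using num_less_add[of z x] by simp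
      then show "\<exists>z<y + 1. y + 1 = x + (z + 1)" using z by blast
    qed
  qed (simp add: num_axioms)
  then show "x < y \<Longrightarrow> \<exists>z. y = x + (z + 1)" by blast
qed (auto simp: num_less_add)

lemma num_zero_or_Suc: "x = 0 \<or> (\<exists>z. x = z + (1::num))"
proof -
  have "x = 0 \<or> (\<exists>z<x. x = z + 1)"
  proof (induction x rule: D_induct)
    show "D (\<lambda>e. e 0 = 0 \<or> (\<exists>z<e 0. e 0 = z + 1))" by (intro D_tmf_intros tmf_intros)
  qed (auto simp: num_axioms)
  then show ?thesis by blast
qed

lemma num_le_iff: "x \<le> y \<longleftrightarrow> (\<exists>z::num. y = x + z)"
proof
  assume "x \<le> y"
  then consider "x < y" | "x = y" by (auto simp: less_eq_num_def)
  then show "\<exists>z. y = x + z"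
  proof cases
    case 1
    then show ?thesis by (auto simp: num_less_iff)
  next
    case 2
    then show ?thesis by (intro exI[of _ 0]) (simp add: num_axioms)
  qed
next
  assume "\<exists>z. y = x + z"
  then obtain z where z: "y = x + z" ..
  show "x \<le> y"
    using num_zero_or_Suc[of z]
  proof
    assume "z = 0"
    then show ?thesis using z by (simp add: less_eq_num_def num_axioms)
  next
    assume "\<exists>w. z = w + 1"
    then show ?thesis using z num_less_add unfolding less_eq_num_def by blast
  qed
qed

lemma num_linear: "x \<le> y \<or> y \<le> (x::num)"
proof (induction y rule: D_induct)
  show "D (\<lambda>e. x \<le> e 0 \<or> e 0 \<le> x)"
    unfolding less_eq_num_def by (intro D_tmf_intros tmf_intros)
next
  case 0
  have "0 \<le> x" unfolding num_le_iff by (rule exI[of _ x]) (simp add: num_add_0)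
  then show ?case ..
next
  case (Suc y)
  consider "x \<le> y" | "x = y" | "y < x" using Suc by (auto simp: less_eq_num_def)
  then show ?case
  proof cases
    case 3
    then obtain z where "x = y + (z + 1)" by (auto simp: num_less_iff)
    then have "x = (y + 1) + z" by (simp only: num_axioms num_add_Suc)
    then show ?thesis by (auto simp: num_le_iff)
  qed (auto simp: less_eq_num_def num_axioms)
qed

lemma num_irrefl: "\<not> x < (x::num)"
proof
  assume "x < x"
  then obtain z where "0 + x = (z + 1) + x" by (auto simp: num_less_iff num_add_0 num_add_comm[of x])
  then show False using num_cancel num_axioms(1) by fastforce
qed

lemma num_trans: "x \<le> y \<Longrightarrow> y \<le> z \<Longrightarrow> x \<le> (z::num)"
  by (auto simp: num_le_iff num_add_assoc)

lemma num_less_trans: "x < y \<Longrightarrow> y < z \<Longrightarrow> x < (z::num)"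
proof -
  assume "x < y" "y < z"
  then obtain u v where "z = (x + (u + 1)) + (v + 1)" by (auto simp: num_less_iff)
  then have "z = x + (((u + 1) + v) + 1)" by (simp only: num_add_assoc)
  then show "x < z" by (auto simp: num_less_iff)
qed

instance num :: linorder
proof
  fix x y z :: num
  show "x < y \<longleftrightarrow> x \<le> y \<and> \<not> y \<le> x"
    using num_irrefl num_less_trans by (auto simp: less_eq_num_def)
  show "x \<le> x" by (simp add: less_eq_num_def)
  show "x \<le> y \<Longrightarrow> y \<le> z \<Longrightarrow> x \<le> z" by (rule num_trans)
  show "x \<le> y \<Longrightarrow> y \<le> x \<Longrightarrow> x = y"
    using num_irrefl num_less_trans by (auto simp: less_eq_num_def)
  show "x \<le> y \<or> y \<le> x" by (rule num_linear)
qed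


section \<open>Truncated subtraction and the ordered semiring classes\<close>

lemma num_mult_strict: "x < y \<Longrightarrow> 0 < c \<Longrightarrow> c * x < c * (y::num)"
proof -
  assume "x < y" "0 < c"
  then obtain u v where "y = x + (u + 1)" "c = v + 1" by (auto simp: num_less_iff num_add_0)
  then have "c * y = c * x + ((c * u + v) + 1)"
    by (simp only: num_distrib[of _ x] num_axioms(4,6) num_add_assoc[symmetric])
  then show "c * x < c * y" by (simp only: num_less_add)
qed

instantiation num :: minus
begin
definition minus_num :: "num \<Rightarrow> num \<Rightarrow> num" where
  "minus_num a b = (if b \<le> a then THE c. a = b + c else 0)"
instance ..
end

lemma num_minus: "b + c - b = (c::num)"
proof -
  have "(THE d. b + c = b + d) = c"
    by (rule the_equality) (auto dest: num_cancel simp: num_add_comm[of b])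
  moreover have "b \<le> b + c" by (auto simp: num_le_iff)
  ultimately show ?thesis by (simp add: minus_num_def)
qed

lemma num_minus_0: "a < b \<Longrightarrow> a - b = (0::num)"
  by (auto simp: minus_num_def)

lemma num_0_least: "0 \<le> (x::num)"
  unfolding num_le_iff by (rule exI[of _ x]) (simp add: num_add_0)

lemma num_0_minus: "0 - c = (0::num)"
  using num_0_least[of c] num_minus[of 0 0] num_minus_0[of 0 c]
  by (auto simp: num_add_0 less_eq_num_def)

instance num :: comm_semiring_1_cancel
proof
  fix a b c :: num
  show "a + b + c = a + (b + c)" by (rule num_add_assoc)
  show "a + b = b + a" by (rule num_add_comm)
  show "0 + a = a" by (rule num_add_0)
  show "a * b * c = a * (b * c)" by (rule num_mult_assoc)
  show "a * b = b * a" by (rule num_mult_comm)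
  show "1 * a = a" by (rule num_mult_1)
  show "(a + b) * c = a * c + b * c"
    by (simp only: num_mult_comm[of _ c] num_distrib)
  show "(0::num) \<noteq> 1" using num_axioms(1)[of 0] by (simp add: num_add_0)
  show "a + b - a = b" by (rule num_minus)
  show "a - b - c = a - (b + c)"
  proof (cases "b \<le> a")
    case True
    then obtain d where d: "a = b + d" by (auto simp: num_le_iff)
    show ?thesis
    proof (cases "c \<le> d")
      case True
      then obtain f where "d = c + f" by (auto simp: num_le_iff)
      then show ?thesis
        using d num_minus[of b "c + f"] num_minus[of c f] num_minus[of "b + c" f]
        by (simp add: num_add_assoc)
    next
      case False
      have "\<not> b + c \<le> a"
      proof
        assume "b + c \<le> a"
        then obtain f where "b + d = b + (c + f)" by (auto simp: d num_le_iff num_add_assoc)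
        then have "d = c + f" using num_cancel[of d b "c + f"] by (simp add: num_add_comm[of _ b])
        then show False using False by (auto simp: num_le_iff)
      qed
      then show ?thesis using False d by (simp add: num_minus num_minus_0)
    qed
  next
    case False
    have "b \<le> b + c" by (auto simp: num_le_iff)
    then have "\<not> b + c \<le> a" using False num_trans by blast
    then show ?thesis using False by (simp add: num_minus_0 num_0_minus)
  qed
  show "a * (b - c) = a * b - a * c"
  proof (cases "c \<le> b")
    case True
    then obtain d where "b = c + d" by (auto simp: num_le_iff)
    then show ?thesis by (simp only: num_minus num_distrib)
  next
    case False
    show ?thesis
    proof (cases "a = 0")
      case True
      then show ?thesis using num_minus[of 0 0] by (simp add: num_mult_0 num_add_0)
    next
      case a: False
      then have "a * b < a * c" using False num_0_least[of a] by (intro num_mult_strict) auto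
      then show ?thesis using False by (simp add: num_minus_0 num_axioms)
    qed
  qed
qed

instance num :: "{linordered_semidom, ordered_cancel_comm_monoid_diff}"
proof
  fix a b c :: num
  show "a \<le> b \<Longrightarrow> c + a \<le> c + b" by (auto simp: num_le_iff num_add_assoc)
  show "0 - a = 0" by (rule num_0_minus)
  show "c + a \<le> c + b \<Longrightarrow> a \<le> b"
  proof -
    assume "c + a \<le> c + b"
    then obtain z where "b + c = (a + z) + c" by (auto simp: num_le_iff ac_simps)
    then have "b = a + z" by (rule num_cancel)
    then show "a \<le> b" by (auto simp: num_le_iff)
  qed
  show "(a \<le> b) = (\<exists>c. b = a + c)" by (rule num_le_iff)
  show "(0::num) < 1" using num_less_add[of 0 0] by simp
  show "a < b \<Longrightarrow> 0 < c \<Longrightarrow> c * a < c * b" by (rule num_mult_strict)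
  show "b \<le> a \<Longrightarrow> a - b + b = a" by (auto simp: num_le_iff add.commute)
  show "a \<noteq> 0 \<Longrightarrow> b \<noteq> 0 \<Longrightarrow> a * b \<noteq> 0"
    using num_mult_strict[of 0 b a] num_0_least[of a] num_0_least[of b]
    by (auto simp: less_eq_num_def)
qed

lemma num_less_Suc: "x < y + 1 \<longleftrightarrow> x \<le> (y::num)"
  by (simp add: num_axioms less_eq_num_def)

lemma num_Suc_le: "x + 1 \<le> y \<longleftrightarrow> x < (y::num)"
  using num_less_Suc[of y x] by (auto simp flip: not_le)


section \<open>The ring of differences\<close>

text \<open>Embedding the numbers into an ordered ring makes linear arithmetic available.\<close>

definition drel :: "num \<times> num \<Rightarrow> num \<times> num \<Rightarrow> bool" where
  "drel = (\<lambda>(x, y) (u, v). x + v = u + y)"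

lemma drel_iff [simp]: "drel (x, y) (u, v) \<longleftrightarrow> x + v = u + y"
  by (simp add: drel_def)

quotient_type dif = "num \<times> num" / drel morphisms Rep_dif Abs_dif
proof (rule equivpI)
  show "reflp drel" by (auto simp: reflp_def)
  show "symp drel" by (auto simp: symp_def)
  show "transp drel"
  proof (rule transpI, clarsimp)
    fix a b c d e f :: num
    assume "a + d = c + b" "c + f = e + d"
    then have "(a + d) + (c + f) = (c + b) + (e + d)" by simp
    then show "a + f = e + b"
      using add_right_cancel[of "a + f" "c + d" "e + b"] by (simp add: ac_simps)
  qed
qed

instantiation dif :: comm_ring_1
begin

lift_definition zero_dif :: dif is "(0, 0)" .
lift_definition one_dif :: dif is "(1, 0)" .
lift_definition plus_dif :: "dif \<Rightarrow> dif \<Rightarrow> dif" is "\<lambda>(x, y) (u, v). (x + u, y + v)"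
proof (clarsimp)
  fix a b c d a' b' c' d' :: num
  assume "a + d = c + b" "a' + d' = c' + b'"
  then have "(a + d) + (a' + d') = (c + b) + (c' + b')" by simp
  then show "a + a' + (d + d') = c + c' + (b + b')" by (simp add: ac_simps)
qed
lift_definition uminus_dif :: "dif \<Rightarrow> dif" is "\<lambda>(x, y). (y, x)"
  by (clarsimp simp: ac_simps)
definition minus_dif :: "dif \<Rightarrow> dif \<Rightarrow> dif" where "minus_dif x y = x + - y"
lift_definition times_dif :: "dif \<Rightarrow> dif \<Rightarrow> dif" is "\<lambda>(x, y) (u, v). (x * u + y * v, x * v + y * u)"
proof (clarsimp)
  fix s t u v w x y z :: num
  assume "s + v = u + t" "w + z = y + x"
  then have "(s + v) * w + (u + t) * x + u * (w + z) + v * (y + x)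
    = (u + t) * w + (s + v) * x + u * (y + x) + v * (w + z)" by simp
  \<comment> \<open>Both sides agree after adding the mixed products of (u, v) and (w, x), which are
    then cancelled.\<close>
  then show "s * w + t * x + (u * z + v * y) = u * y + v * z + (s * x + t * w)"
    using add_right_cancel[of "s * w + t * x + (u * z + v * y)" "v * w + u * x + u * w + v * x"
        "u * y + v * z + (s * x + t * w)"]
    by (simp add: algebra_simps)
qed

instance
proof
  fix x y z :: dif
  show "x - y = x + - y" by (rule minus_dif_def)
qed (transfer; clarsimp simp: algebra_simps)+

end

instantiation dif :: linordered_idom
begin

lift_definition less_dif :: "dif \<Rightarrow> dif \<Rightarrow> bool" is "\<lambda>(x, y) (u, v). x + v < u + y"
proof (clarsimp)
  fix a b c d a' b' c' d' :: num
  assume *: "a + d = c + b" "a' + d' = c' + b'"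
  have "a + b' < a' + b \<longleftrightarrow> (a + d) + (b' + d') < (a' + d') + (b + d)"
    using add_less_cancel_right[of "a + b'" "d + d'" "a' + b"] by (simp add: ac_simps)
  also have "\<dots> \<longleftrightarrow> c + d' < c' + d"
    unfolding * using add_less_cancel_right[of "c + d'" "b + b'" "c' + d"] by (simp add: ac_simps)
  finally show "a + b' < a' + b \<longleftrightarrow> c + d' < c' + d" .
qed
definition less_eq_dif :: "dif \<Rightarrow> dif \<Rightarrow> bool" where "less_eq_dif x y \<longleftrightarrow> x < y \<or> x = y"
definition abs_dif :: "dif \<Rightarrow> dif" where "abs_dif x = (if x < 0 then - x else x)"
definition sgn_dif :: "dif \<Rightarrow> dif" where "sgn_dif x = (if x = 0 then 0 else if 0 < x then 1 else - 1)"

instance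
proof
  fix x y z :: dif
  have asym: "x < y \<Longrightarrow> \<not> y < x" for x y :: dif by transfer auto
  have tr: "x < y \<Longrightarrow> y < z \<Longrightarrow> x < z" for x y z :: dif
  proof (transfer, clarsimp)
    fix a b c d e f :: num
    assume "a + d < c + b" "c + f < e + d"
    then have "(a + d) + (c + f) < (c + b) + (e + d)" by (rule add_strict_mono)
    then show "a + f < e + b"
      using add_less_cancel_right[of "a + f" "c + d" "e + b"] by (simp add: ac_simps)
  qed
  have lin: "x < y \<or> x = y \<or> y < x" for x y :: dif by transfer (auto simp: ac_simps)
  show "x \<le> y \<or> y \<le> x" using lin[of x y] by (auto simp: less_eq_dif_def)
  show "x < y \<longleftrightarrow> x \<le> y \<and> \<not> y \<le> x" using asym[of x y] asym[of x x] by (auto simp: less_eq_dif_def)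
  show "x \<le> x" by (simp add: less_eq_dif_def)
  show "x \<le> y \<Longrightarrow> y \<le> z \<Longrightarrow> x \<le> z" using tr[of x y z] by (auto simp: less_eq_dif_def)
  show "x \<le> y \<Longrightarrow> y \<le> x \<Longrightarrow> x = y" using asym[of x y] by (auto simp: less_eq_dif_def)
  have "x < y \<Longrightarrow> z + x < z + y" by transfer (clarsimp simp: ac_simps)
  then show "x \<le> y \<Longrightarrow> z + x \<le> z + y" by (auto simp: less_eq_dif_def)
  show "\<bar>x\<bar> = (if x < 0 then - x else x)" by (rule abs_dif_def)
  show "sgn x = (if x = 0 then 0 else if 0 < x then 1 else - 1)" by (rule sgn_dif_def)
  show "x < y \<Longrightarrow> 0 < z \<Longrightarrow> z * x < z * y"
  proof (transfer, clarsimp)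
    fix a b c d e f :: num
    assume 1: "a + d < c + b" and "f < e"
    then obtain g where g: "e = f + g" "0 < g"
      by (metis le_iff_add less_imp_le add.right_neutral less_le zero_le)
    have "g * (a + d) < g * (c + b)" using 1 g by (intro mult_strict_left_mono)
    then show "e * a + f * b + (e * d + f * c) < e * c + f * d + (e * b + f * a)"
      using g add_less_cancel_right[of "g * (a + d)" "f * (a + b + c + d)" "g * (c + b)"]
      by (simp add: algebra_simps)
  qed
qed

end

definition emb :: "num \<Rightarrow> dif" where "emb x = Abs_dif (x, 0)"

lemma emb_hom:
  "emb 0 = 0" "emb 1 = 1" "emb (x + y) = emb x + emb y" "emb (x * y) = emb x * emb y"
  by (simp_all add: emb_def zero_dif.abs_eq one_dif.abs_eq plus_dif.abs_eq times_dif.abs_eq)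

lemma emb_eq: "x = y \<longleftrightarrow> emb x = emb y" and emb_less: "x < y \<longleftrightarrow> emb x < emb y"
  by (simp_all add: emb_def dif.abs_eq_iff less_dif.abs_eq)

lemma emb_le: "x \<le> y \<longleftrightarrow> emb x \<le> emb y"
  unfolding le_less emb_eq emb_less ..

text \<open>Makes discreteness visible: in an ordered ring \<open>linarith\<close> cannot infer x +
  1 \<le> y from x < y.\<close>

lemma emb_less_Suc: "x < y \<longleftrightarrow> emb x + 1 \<le> emb y"
  using emb_le[of "x + 1" y] by (simp add: num_Suc_le emb_hom)

lemmas num_emb = emb_less_Suc emb_le emb_eq emb_hom

text \<open>Nonnegativity is lost in passing to the ring and has to be supplied to
  \<open>linarith\<close> term by term.\<close>

lemma emb_nonneg: "0 \<le> emb x"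
  using zero_le[of x] unfolding num_emb .


section \<open>Definable bounded functions\<close>

lemma tmf_rename:
  assumes "tmf f"
  shows "tmf (\<lambda>e. f (\<lambda>n. e (g n)))"
proof -
  obtain c t where t: "\<forall>e. f e = val (mix e c) t" using assms unfolding tmf_def trep_def by blast
  define h where "h n = (if even n then 2 * g (n div 2) else n)" for n
  have h: "mix (\<lambda>n. e (g n)) c n = mix e c (h n)" for e n by (simp add: mix_def h_def)
  have "\<forall>e. f (\<lambda>n. e (g n)) = val (mix e c) (substt (\<lambda>n. Var (h n)) t)"
    using t by (simp add: val_substt h[symmetric])
  then show ?thesis unfolding tmf_def trep_def by blast
qed

definition bdd :: "((nat \<Rightarrow> num) \<Rightarrow> num) \<Rightarrow> bool" where
  "bdd f \<longleftrightarrow> (\<exists>t. tmf t \<and> (\<forall>e. f e \<le> t e))"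

text \<open>The bounding term is what permits substitution into formulas: a statement about
  \<open>f e\<close> becomes a bounded existential statement about a value satisfying the graph of
  \<open>f\<close>.\<close>

definition Df :: "((nat \<Rightarrow> num) \<Rightarrow> num) \<Rightarrow> bool" where
  "Df f \<longleftrightarrow> bdd f \<and> D (\<lambda>e. e 0 = f (\<lambda>n. e (Suc n)))"

lemma bdd_le: "bdd g \<Longrightarrow> (\<And>e. f e \<le> g e) \<Longrightarrow> bdd f"
  unfolding bdd_def by (meson order_trans)

lemma bdd_tmf: "tmf f \<Longrightarrow> bdd f"
  unfolding bdd_def by blast

lemma bdd_add: "bdd f \<Longrightarrow> bdd g \<Longrightarrow> bdd (\<lambda>e. f e + g e)"
  unfolding bdd_def using tmf_add add_mono by blast

lemma bdd_mult: "bdd f \<Longrightarrow> bdd g \<Longrightarrow> bdd (\<lambda>e. f e * g e)"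
  unfolding bdd_def using tmf_mult mult_mono zero_le by (metis (no_types, lifting))

lemma Df_bdd: "Df f \<Longrightarrow> bdd f"
  unfolding Df_def by blast

lemma D_subst:
  assumes "Df f" "D (\<lambda>e. P (\<lambda>n. e (Suc n)) (e 0))"
  shows "D (\<lambda>e. P e (f e))"
proof -
  obtain t where t: "tmf t" "\<And>e. f e \<le> t e" using assms(1) unfolding Df_def bdd_def by blast
  have "D (\<lambda>e. \<exists>x<t e + 1. x = f e \<and> P e x)"
    by (intro D_bex_tmf D_and tmf_add tmf_const t(1) assms(2)) (use assms(1) in \<open>simp add: Df_def\<close>)
  moreover have "(\<exists>x<t e + 1. x = f e \<and> P e x) \<longleftrightarrow> P e (f e)" for e
    using t(2)[of e] by (auto simp: num_less_Suc)
  ultimately show ?thesis by simp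
qed

lemma Df_rename:
  assumes "Df f"
  shows "Df (\<lambda>e. f (\<lambda>n. e (g n)))"
proof -
  have "bdd (\<lambda>e. f (\<lambda>n. e (g n)))"
    using assms tmf_rename unfolding Df_def bdd_def by blast
  moreover have "D (\<lambda>e. e 0 = f (\<lambda>n. e (Suc n)))" using assms unfolding Df_def ..
  from D_rename[OF this, of "case_nat 0 (\<lambda>n. Suc (g n))"]
  have "D (\<lambda>e. e 0 = f (\<lambda>n. e (Suc (g n))))" by simp
  ultimately show ?thesis unfolding Df_def ..
qed

lemma D_rel1: "Df f \<Longrightarrow> D (\<lambda>e. R (e 0)) \<Longrightarrow> D (\<lambda>e. R (f e))"
  using D_subst[of f "\<lambda>e. R"] by simp

lemma D_rel2:
  assumes "Df f" "Df g" "D (\<lambda>e. R (e 0) (e 1))"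
  shows "D (\<lambda>e. R (f e) (g e))"
proof (rule D_subst[OF assms(1), of "\<lambda>e x. R x (g e)"],
    rule D_subst[OF Df_rename[OF assms(2), of Suc], of "\<lambda>e. R (e 0)"])
  \<comment> \<open>Nested substitution leaves the arguments in reverse order. Truncated subtraction
    from 1 swaps entries 0 and 1, the only ones that \<open>R\<close> reads.\<close>
  show "D (\<lambda>e. R (e (Suc 0)) (e 0))" using D_rename[OF assms(3), of "\<lambda>n. 1 - n"] by simp
qed

lemma D_rel3:
  assumes "Df f" "Df g" "Df h" "D (\<lambda>e. R (e 0) (e 1) (e 2))"
  shows "D (\<lambda>e. R (f e) (g e) (h e))"
proof (rule D_subst[OF assms(1), of "\<lambda>e x. R x (g e) (h e)"],
    rule D_subst[OF Df_rename[OF assms(2), of Suc], of "\<lambda>e x. R (e 0) x (h (\<lambda>n. e (Suc n)))"],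
    rule D_subst[OF Df_rename[OF assms(3), of "\<lambda>n. Suc (Suc n)"], of "\<lambda>e. R (e (Suc 0)) (e 0)"])
  show "D (\<lambda>e. R (e (Suc (Suc 0))) (e (Suc 0)) (e 0))"
    using D_rename[OF assms(4), of "\<lambda>n. 2 - n"] by (simp add: numeral_2_eq_2)
qed

lemma D_rel4:
  assumes "Df f" "Df g" "Df h" "Df k" "D (\<lambda>e. R (e 0) (e 1) (e 2) (e 3))"
  shows "D (\<lambda>e. R (f e) (g e) (h e) (k e))"
proof (rule D_subst[OF assms(1), of "\<lambda>e x. R x (g e) (h e) (k e)"],
    rule D_subst[OF Df_rename[OF assms(2), of Suc], of "\<lambda>e x. R (e 0) x (h (\<lambda>n. e (Suc n))) (k (\<lambda>n. e (Suc n)))"],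
    rule D_subst[OF Df_rename[OF assms(3), of "\<lambda>n. Suc (Suc n)"], of "\<lambda>e x. R (e (Suc 0)) (e 0) x (k (\<lambda>n. e (Suc (Suc n))))"],
    rule D_subst[OF Df_rename[OF assms(4), of "\<lambda>n. Suc (Suc (Suc n))"], of "\<lambda>e. R (e (Suc (Suc 0))) (e (Suc 0)) (e 0)"])
  show "D (\<lambda>e. R (e (Suc (Suc (Suc 0)))) (e (Suc (Suc 0))) (e (Suc 0)) (e 0))"
    using D_rename[OF assms(5), of "\<lambda>n. 3 - n"] by (simp add: numeral_2_eq_2 numeral_3_eq_3)
qed

lemma D_eq: "Df f \<Longrightarrow> Df g \<Longrightarrow> D (\<lambda>e. f e = g e)"
  by (erule (1) D_rel2) (intro D_eq_tmf tmf_var)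

lemma D_less: "Df f \<Longrightarrow> Df g \<Longrightarrow> D (\<lambda>e. f e < g e)"
  by (erule (1) D_rel2) (intro D_less_tmf tmf_var)

lemma D_le: "Df f \<Longrightarrow> Df g \<Longrightarrow> D (\<lambda>e. f e \<le> g e)"
  using D_not[OF D_less[of g f]] by (simp add: not_less)

lemma D_mem: "A \<in> Sets \<Longrightarrow> Df f \<Longrightarrow> D (\<lambda>e. f e \<in> A)"
  by (erule D_rel1) (intro D_mem_tmf tmf_var)

lemma D_ball:
  assumes "Df f" "D (\<lambda>e. P (\<lambda>n. e (Suc n)) (e 0))"
  shows "D (\<lambda>e. \<forall>x<f e. P e x)"
proof (rule D_subst[OF assms(1), of "\<lambda>e y. \<forall>x<y. P e x"], rule D_ball_tmf[OF tmf_var])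
  show "D (\<lambda>e. P (\<lambda>n. e (Suc (Suc n))) (e 0))"
    using D_rename[OF assms(2), of "case_nat 0 (\<lambda>n. Suc (Suc n))"] by simp
qed

lemma D_bex: "Df f \<Longrightarrow> D (\<lambda>e. P (\<lambda>n. e (Suc n)) (e 0)) \<Longrightarrow> D (\<lambda>e. \<exists>x<f e. P e x)"
  using D_not[OF D_ball[of f "\<lambda>e x. \<not> P e x"]] D_not[of "\<lambda>e. P (\<lambda>n. e (Suc n)) (e 0)"] by simp

text \<open>A quantifier over standard numbers unfolds to a conjunction of fixed length and so costs
  no quantifier of the language.\<close>

lemma D_ball_nat: "(\<And>j. j < n \<Longrightarrow> D (P j)) \<Longrightarrow> D (\<lambda>e. \<forall>j<n. P j e)" for n :: nat
proof (induction n)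
  case (Suc n)
  have "D (\<lambda>e. (\<forall>j<n. P j e) \<and> P n e)" using Suc by (intro D_and) auto
  then show ?case by (simp add: All_less_Suc conj_commute)
qed (simp add: D_bool)

lemma D_bex_nat: "(\<And>j. j < n \<Longrightarrow> D (P j)) \<Longrightarrow> D (\<lambda>e. \<exists>j<n. P j e)" for n :: nat
proof (induction n)
  case (Suc n)
  have "D (\<lambda>e. (\<exists>j<n. P j e) \<or> P n e)" using Suc by (intro D_or) auto
  then show ?case by (simp add: Ex_less_Suc disj_commute)
qed (simp add: D_bool)

lemma Df_var: "Df (\<lambda>e. e n)"
  unfolding Df_def by (intro conjI bdd_tmf D_eq_tmf tmf_var)

lemma Df_const: "Df (\<lambda>e. a)"
  unfolding Df_def by (intro conjI bdd_tmf D_eq_tmf tmf_var tmf_const)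

lemma Df_comp1:
  assumes "Df f" "D (\<lambda>e. e 0 = F (e 1))" "bdd (\<lambda>e. F (f e))"
  shows "Df (\<lambda>e. F (f e))"
  unfolding Df_def
  using assms(3) D_rel2[OF Df_var[of 0] Df_rename[OF assms(1), of Suc], of "\<lambda>x y. x = F y"] assms(2)
  by simp

lemma Df_comp2:
  assumes "Df f" "Df g" "D (\<lambda>e. e 0 = F (e 1) (e 2))" "bdd (\<lambda>e. F (f e) (g e))"
  shows "Df (\<lambda>e. F (f e) (g e))"
  unfolding Df_def
  using assms(4) assms(3) D_rel3[OF Df_var[of 0] Df_rename[OF assms(1), of Suc]
    Df_rename[OF assms(2), of Suc], of "\<lambda>x y z. x = F y z"]
  by simp

lemma Df_comp3:
  assumes "Df f" "Df g" "Df h" "D (\<lambda>e. e 0 = F (e 1) (e 2) (e 3))" "bdd (\<lambda>e. F (f e) (g e) (h e))"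
  shows "Df (\<lambda>e. F (f e) (g e) (h e))"
  unfolding Df_def
  using assms(4,5) D_rel4[OF Df_var[of 0] Df_rename[OF assms(1), of Suc]
    Df_rename[OF assms(2), of Suc] Df_rename[OF assms(3), of Suc], of "\<lambda>x y z w. x = F y z w"]
  by simp

lemma Df_add: assumes "Df f" "Df g" shows "Df (\<lambda>e. f e + g e)"
proof (rule Df_comp2[OF assms, of "(+)"])
  show "D (\<lambda>e. e 0 = e 1 + e 2)" by (intro D_eq_tmf tmf_intros)
  show "bdd (\<lambda>e. f e + g e)" by (intro bdd_add Df_bdd assms)
qed

lemma Df_mult: assumes "Df f" "Df g" shows "Df (\<lambda>e. f e * g e)"
proof (rule Df_comp2[OF assms, of times])
  show "D (\<lambda>e. e 0 = e 1 * e 2)" by (intro D_eq_tmf tmf_intros)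
  show "bdd (\<lambda>e. f e * g e)" by (intro bdd_mult Df_bdd assms)
qed

lemma pw_pos: assumes "0 < b" shows "0 < b ^^^ (i :: num)"
proof (induction i rule: D_induct)
  show "D (\<lambda>e. 0 < b ^^^ e 0)" by (intro D_tmf_intros tmf_intros)
qed (simp_all add: num_axioms(9,10) assms)

lemma pw_add: "b ^^^ (i + j) = b ^^^ i * b ^^^ (j :: num)"
proof (induction j rule: D_induct)
  show "D (\<lambda>e. b ^^^ (i + e 0) = b ^^^ i * b ^^^ e 0)" by (intro D_tmf_intros tmf_intros)
qed (simp_all only: num_axioms(3,4,9,10) mult_1_right mult.assoc)

lemma pw_mono_base: assumes "a \<le> b" shows "a ^^^ i \<le> b ^^^ (i :: num)"
proof (induction i rule: D_induct)
  show "D (\<lambda>e. a ^^^ e 0 \<le> b ^^^ e 0)"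
    unfolding le_less by (intro D_tmf_intros tmf_intros)
qed (simp_all add: num_axioms(9,10) mult_mono assms)

lemma pw_mono: "0 < b \<Longrightarrow> i \<le> j \<Longrightarrow> b ^^^ i \<le> b ^^^ (j :: num)"
proof -
  assume b: "0 < b" and "i \<le> j"
  then obtain k where "j = i + k" using le_iff_add by blast
  moreover have "1 \<le> b ^^^ k" using pw_pos[OF b, of k] by (simp flip: num_Suc_le)
  ultimately show ?thesis using mult_left_mono[of 1 "b ^^^ k" "b ^^^ i"] by (simp add: pw_add)
qed

lemma Df_pw: assumes "Df f" "Df g" shows "Df (\<lambda>e. f e ^^^ g e)"
proof (rule Df_comp2[of f g "(^^^)"])
  obtain t u where t: "tmf t" "\<And>e. f e \<le> t e" and u: "tmf u" "\<And>e. g e \<le> u e"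
    using assms unfolding Df_def bdd_def by blast
  \<comment> \<open>The base is raised by 1 because monotonicity in the exponent fails for base 0,
    where the power with exponent 0 is 1.\<close>
  have "f e ^^^ g e \<le> (t e + 1) ^^^ u e" for e
  proof -
    have "f e ^^^ g e \<le> (t e + 1) ^^^ g e"
      using t(2)[of e] by (intro pw_mono_base) (simp add: num_less_Suc less_imp_le)
    also have "\<dots> \<le> (t e + 1) ^^^ u e" using u(2) by (intro pw_mono) (simp_all add: num_less_Suc)
    finally show ?thesis .
  qed
  moreover have "tmf (\<lambda>e. (t e + 1) ^^^ u e)" by (intro tmf_intros t u)
  ultimately show "bdd (\<lambda>e. f e ^^^ g e)" unfolding bdd_def by blast
qed (use assms in \<open>auto intro!: D_eq_tmf tmf_intros\<close>)

lemma Df_minus: assumes "Df f" "Df g" shows "Df (\<lambda>e. f e - g e)"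
proof (rule Df_comp2[OF assms, of "(-)"])
  have "x = y - z \<longleftrightarrow> (z \<le> y \<and> y = z + x) \<or> (y < z \<and> x = 0)" for x y z :: num
  proof (cases "z \<le> y")
    case True
    then obtain c where "y = z + c" using le_iff_add by blast
    then show ?thesis by auto
  qed (auto simp: num_minus_0 not_le)
  then show "D (\<lambda>e. e 0 = e 1 - e 2)"
    by (simp only:) (intro D_or D_and D_le D_less D_eq Df_add Df_var Df_const)
  have "f e - g e \<le> f e" for e
  proof (cases "g e \<le> f e")
    case True
    then obtain c where "f e = g e + c" using le_iff_add by blast
    then show ?thesis by simp
  qed (simp add: num_minus_0 not_le)
  then show "bdd (\<lambda>e. f e - g e)" by (rule bdd_le[OF Df_bdd[OF assms(1)]])
qed

lemma Df_if:
  assumes "D P" "Df f" "Df g"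
  shows "Df (\<lambda>e. if P e then f e else g e)"
proof -
  have "bdd (\<lambda>e. if P e then f e else g e)"
    by (rule bdd_le[OF bdd_add[OF Df_bdd[OF assms(2)] Df_bdd[OF assms(3)]]]) simp
  moreover have "D (\<lambda>e. (P (\<lambda>n. e (Suc n)) \<longrightarrow> e 0 = f (\<lambda>n. e (Suc n)))
      \<and> (\<not> P (\<lambda>n. e (Suc n)) \<longrightarrow> e 0 = g (\<lambda>n. e (Suc n))))"
    by (intro D_and D_imp D_not D_eq Df_var Df_rename[OF assms(2)] Df_rename[OF assms(3)] D_rename[OF assms(1)])
  moreover have "e 0 = (if P (\<lambda>n. e (Suc n)) then f (\<lambda>n. e (Suc n)) else g (\<lambda>n. e (Suc n)))
      \<longleftrightarrow> (P (\<lambda>n. e (Suc n)) \<longrightarrow> e 0 = f (\<lambda>n. e (Suc n)))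
        \<and> (\<not> P (\<lambda>n. e (Suc n)) \<longrightarrow> e 0 = g (\<lambda>n. e (Suc n)))" for e
    by (rule if_split)
  ultimately show ?thesis unfolding Df_def by (simp only: simp_thms)
qed

lemmas D_intros = D_eq D_less D_le D_imp D_not D_or D_and D_ball D_bex D_bool
lemmas Df_intros = Df_const Df_var Df_add Df_mult Df_pw Df_minus Df_if

text \<open>Definable number-theoretic functions; closure under definable substitution replaces the choice
  of a bounding term.\<close>

definition Dfun :: "(num \<Rightarrow> num) \<Rightarrow> bool" where
  "Dfun F \<longleftrightarrow> (\<forall>f. Df f \<longrightarrow> Df (\<lambda>e. F (f e)))"

lemma DfunI: "(\<And>f. Df f \<Longrightarrow> Df (\<lambda>e. F (f e))) \<Longrightarrow> Dfun F"
  unfolding Dfun_def by blast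

lemma DfunD: "Dfun F \<Longrightarrow> Df f \<Longrightarrow> Df (\<lambda>e. F (f e))"
  unfolding Dfun_def by blast

lemma D_less_induct:
  assumes "D (\<lambda>e. Q (e 0))" "\<And>x. (\<And>y. y < x \<Longrightarrow> Q y) \<Longrightarrow> Q x"
  shows "Q (x :: num)"
proof -
  have "\<forall>y<z. Q y" for z
  proof (induction z rule: D_induct)
    show "D (\<lambda>e. \<forall>y<e 0. Q y)" by (intro D_intros Df_intros assms(1))
  next
    case (Suc z)
    then show ?case using assms(2) by (auto simp: num_axioms(8))
  qed simp
  from this[of "x + 1"] show ?thesis by (simp add: num_less_Suc)
qed

lemma least_number:
  assumes "D (\<lambda>e. Q (e 0))" "Q x"
  obtains y where "Q y" "\<And>z. z < y \<Longrightarrow> \<not> Q z" "y \<le> (x :: num)"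
proof -
  have "\<exists>y. Q y \<and> (\<forall>z<y. \<not> Q z)"
  proof (rule ccontr)
    assume *: "\<not> ?thesis"
    have "\<not> Q y" for y
    proof (induction y rule: D_less_induct)
      show "D (\<lambda>e. \<not> Q (e 0))" by (intro D_not assms(1))
    next
      fix z assume "\<And>y. y < z \<Longrightarrow> \<not> Q y"
      then show "\<not> Q z" using * by blast
    qed
    then show False using assms(2) by blast
  qed
  then obtain y where y: "Q y" "\<forall>z<y. \<not> Q z" by blast
  then have "y \<le> x" using assms(2) by (simp flip: not_less) blast
  then show thesis using that y by blast
qed


section \<open>Codes of sequences and of pairs\<close>

lemma num_less_1 [simp]: "x < 1 \<longleftrightarrow> x = (0::num)"
  using num_less_Suc[of x 0] by simp

lemma div_ex:
  assumes "0 < (d::num)"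
  shows "\<exists>q r. c = q * d + r \<and> r < d"
proof -
  have "\<exists>q<c + 1. \<exists>r<d. c = q * d + r"
  proof (induction c rule: D_induct)
    show "D (\<lambda>e. \<exists>q<e 0 + 1. \<exists>r<d. e 0 = q * d + r)" by (intro D_intros Df_intros)
  next
    case 0
    show ?case using assms by (intro exI[of _ 0]) simp
  next
    case (Suc c)
    then obtain q r where qr: "q < c + 1" "r < d" "c = q * d + r" by blast
    show ?case
    proof (cases "r + 1 < d")
      case True
      have "q < c + 1 + 1" using qr(1) by (simp add: num_axioms(8))
      moreover have "c + 1 = q * d + (r + 1)" using qr(3) by (simp add: ac_simps)
      ultimately show ?thesis using True by blast
    next
      case False
      then have "d = r + 1" using qr(2) by (metis num_Suc_le order_antisym not_le)
      then have "c + 1 = (q + 1) * d + 0" using qr(3) by (simp add: algebra_simps)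
      moreover have "q + 1 < c + 1 + 1" using qr(1) by simp
      ultimately show ?thesis using assms by blast
    qed
  qed
  then show ?thesis by blast
qed

lemma div_unique:
  assumes eq: "q * d + r = q' * d + (r'::num)" and r: "r < d" "r' < d"
  shows "q = q' \<and> r = r'"
proof -
  have aux: False if "q < q'" "q * d + r = q' * d + r'" "r < d" for q q' r r' :: num
  proof -
    have "(q + 1) * d \<le> q' * d" using that(1) by (intro mult_right_mono) (simp_all add: num_Suc_le)
    moreover have "q' * d \<le> q * d + r" using that(2) by simp
    ultimately have "(q + 1) * d \<le> q * d + r" by (rule order_trans)
    then show False using that(3) by (simp add: algebra_simps)
  qed
  have "q = q'" using aux[of q q' r r'] aux[of q' q r' r] eq r by (metis linorder_neqE)
  then show ?thesis using eq by simp
qed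

definition ent :: "num \<Rightarrow> num \<Rightarrow> num \<Rightarrow> num \<Rightarrow> bool" where
  "ent c b i a \<longleftrightarrow> a < b \<and> (\<exists>u<c + 1. \<exists>r<b ^^^ i. c = (u * b + a) * b ^^^ i + r)"

text \<open>The value is 0 for base 0.\<close>

definition dg :: "num \<Rightarrow> num \<Rightarrow> num \<Rightarrow> num" where
  "dg c b i = (if 0 < b then THE a. ent c b i a else 0)"

lemma le_mult_pos: "0 < b \<Longrightarrow> a \<le> a * (b::num)"
  using mult_left_mono[of 1 b a] by (simp flip: num_Suc_le)

text \<open>For positive \<open>b\<close> the high part \<open>u\<close> never exceeds
  \<open>c\<close>, so the bound on \<open>u\<close> in \<open>ent\<close> is automatic.\<close>

lemma entI:
  assumes "c = (u * b + a) * b ^^^ i + r" "a < b" "r < b ^^^ i"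
  shows "ent c b i a"
proof -
  have b: "0 < b" using assms(2) by (rule le_less_trans[OF zero_le])
  have "u \<le> u * b + a" using le_mult_pos[OF b, of u] by (rule order_trans) simp
  also have "\<dots> \<le> (u * b + a) * b ^^^ i" by (rule le_mult_pos[OF pw_pos[OF b]])
  also have "\<dots> \<le> c" using assms(1) by simp
  finally show ?thesis using assms unfolding ent_def num_less_Suc by blast
qed

lemma ent_unique: "ent c b i a \<Longrightarrow> ent c b i a' \<Longrightarrow> a = a'"
  unfolding ent_def using div_unique by (metis (no_types, lifting))

lemma ent_iff: "ent c b i a \<longleftrightarrow> 0 < b \<and> dg c b i = a"
proof (cases "0 < b")
  case True
  obtain q r where qr: "c = q * b ^^^ i + r" "r < b ^^^ i" using div_ex[OF pw_pos[OF True]] by blast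
  obtain u a' where "q = u * b + a'" "a' < b" using div_ex[OF True] by blast
  then have *: "ent c b i a'" using qr by (intro entI) auto
  then have "dg c b i = a'" unfolding dg_def using True ent_unique by (simp add: the_equality)
  then show ?thesis using * True ent_unique by blast
next
  case False
  then show ?thesis using le_less_trans[OF zero_le] unfolding ent_def by blast
qed

lemma dg_less: "0 < b \<Longrightarrow> dg c b i < b"
  using ent_iff[of c b i "dg c b i"] by (simp add: ent_def)

lemma dgI:
  assumes "c = (u * b + a) * b ^^^ i + r" "a < b" "r < b ^^^ i"
  shows "dg c b i = a"
  using entI[OF assms] by (simp add: ent_iff)

lemma dgE:
  assumes "0 < b"
  obtains u r where "c = (u * b + dg c b i) * b ^^^ i + r" "r < b ^^^ i"
  using ent_iff[of c b i "dg c b i"] assms unfolding ent_def by blast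

lemma dg_le: "dg c b i \<le> c"
proof (cases "0 < b")
  case True
  obtain u r where c: "c = (u * b + dg c b i) * b ^^^ i + r" by (rule dgE[OF True])
  have "dg c b i \<le> u * b + dg c b i" by simp
  also have "\<dots> \<le> (u * b + dg c b i) * b ^^^ i" by (rule le_mult_pos[OF pw_pos[OF True]])
  also have "\<dots> \<le> (u * b + dg c b i) * b ^^^ i + r" by simp
  finally show ?thesis using c by simp
qed (simp add: dg_def)

text \<open>As \<open>m\<close> exceeds \<open>i\<close>, the added summand is a multiple of b^(i +
  1) and changes only the part above digit \<open>i\<close>.\<close>

lemma dg_add_high:
  assumes b: "0 < b" and "i < m"
  shows "dg (a * b ^^^ m + c) b i = dg c b i"
proof -
  obtain j where m: "m = i + 1 + j" using assms(2) le_iff_add by (metis num_Suc_le)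
  have bm: "b ^^^ m = b ^^^ i * b * b ^^^ j" by (simp only: m pw_add[of b "i + 1"] num_axioms(10))
  obtain u r where ur: "c = (u * b + dg c b i) * b ^^^ i + r" "r < b ^^^ i" by (rule dgE[OF b])
  show ?thesis
  proof (rule dgI[of _ "a * b ^^^ j + u" _ _ _ r])
    have "a * b ^^^ m + c = a * b ^^^ m + ((u * b + dg c b i) * b ^^^ i + r)" using ur(1) by simp
    then show "a * b ^^^ m + c = ((a * b ^^^ j + u) * b + dg c b i) * b ^^^ i + r"
      unfolding bm by (simp add: algebra_simps)
  qed (use ur(2) dg_less[OF b] in simp_all)
qed

lemma D_ent:
  assumes "Df f" "Df g" "Df h" "Df k"
  shows "D (\<lambda>e. ent (f e) (g e) (h e) (k e))"
  unfolding ent_def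
  by (rule D_rel4[OF assms]) (intro D_intros Df_intros)

lemma Df_dg:
  assumes "Df f" "Df g" "Df h"
  shows "Df (\<lambda>e. dg (f e) (g e) (h e))"
proof (rule Df_comp3[OF assms, of dg])
  have "x = dg c b i \<longleftrightarrow> ent c b i x \<or> (b = 0 \<and> x = 0)" for x c b i
    using zero_le[of b] by (auto simp: ent_iff dg_def less_le)
  then show "D (\<lambda>e. e 0 = dg (e 1) (e 2) (e 3))"
    by (simp only:) (intro D_intros Df_intros D_ent)
  show "bdd (\<lambda>e. dg (f e) (g e) (h e))" by (rule bdd_le[OF Df_bdd[OF assms(1)] dg_le])
qed

text \<open>The value \<open>f m\<close> is appended as a new top digit, which keeps the code below
  b^(m + 1). This a priori bound on the code makes the induction formula bounded.\<close>

lemma sequence_ex: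
  assumes f: "Dfun f" and b: "0 < b" "\<And>i. i < n \<Longrightarrow> f i < b"
  shows "\<exists>c<b ^^^ n. \<forall>i<n. dg c b i = f i"
proof -
  have "m \<le> n \<longrightarrow> (\<exists>c<b ^^^ m. \<forall>i<m. dg c b i = f i)" for m
  proof (induction m rule: D_induct)
    show "D (\<lambda>e. e 0 \<le> n \<longrightarrow> (\<exists>c<b ^^^ e 0. \<forall>i<e 0. dg c b i = f i))"
      by (intro D_intros Df_intros Df_dg DfunD[OF f])
  next
    case (Suc m)
    show ?case
    proof
      assume "m + 1 \<le> n"
      then have m: "m < n" by (simp add: num_Suc_le)
      then obtain c where c: "c < b ^^^ m" "\<And>i. i < m \<Longrightarrow> dg c b i = f i" using Suc by auto
      let ?c = "f m * b ^^^ m + c"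
      have "?c < (f m + 1) * b ^^^ m" using c(1) by (simp add: algebra_simps)
      also have "\<dots> \<le> b * b ^^^ m"
        using b(2)[OF m] by (intro mult_right_mono) (simp_all add: num_Suc_le)
      finally have "?c < b ^^^ (m + 1)" by (simp add: num_axioms(10) mult.commute)
      moreover have "dg ?c b i = f i" if "i < m + 1" for i
      proof (cases "i = m")
        case True
        show ?thesis unfolding True
          by (rule dgI[of _ 0 _ _ _ c]) (use c(1) b(2)[OF m] in simp_all)
      next
        case False
        then have i: "i < m" using that by (simp add: num_less_Suc)
        have "dg ?c b i = dg c b i" by (rule dg_add_high[OF b(1) i])
        then show ?thesis using c(2)[OF i] by simp
      qed
      ultimately show "\<exists>c<b ^^^ (m + 1). \<forall>i<m + 1. dg c b i = f i" by blast
    qed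
  qed (auto simp: num_axioms(9) intro!: exI[of _ 0])
  then show ?thesis by blast
qed

definition pr :: "num \<Rightarrow> num \<Rightarrow> num" where "pr x y = (x + y) * (x + y) + x"

lemma Df_pr: "Df f \<Longrightarrow> Df g \<Longrightarrow> Df (\<lambda>e. pr (f e) (g e))"
  unfolding pr_def by (intro Df_intros)

text \<open>Pairs with sum s have codes between s^2 and s^2 + s, which is below (s + 1)^2; so the
  code determines the sum, and then the first component.\<close>

lemma pr_inject [simp]: "pr x y = pr x' y' \<longleftrightarrow> x = x' \<and> y = y'"
proof
  have aux: False if "x + y < x' + y'" "pr x y = pr x' y'" for x y x' y'
  proof -
    have "(x + y + 1) * (x + y + 1) \<le> (x' + y') * (x' + y')"
      using that(1) by (intro mult_mono) (simp_all add: num_Suc_le)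
    also have "\<dots> \<le> pr x' y'" by (simp add: pr_def)
    also have "\<dots> = (x + y) * (x + y) + x" using that(2) by (simp add: pr_def)
    finally have "emb ((x + y + 1) * (x + y + 1)) \<le> emb ((x + y) * (x + y) + x)"
      by (simp add: emb_le)
    then show False
      using emb_nonneg[of x] emb_nonneg[of y] unfolding emb_hom by (simp add: algebra_simps)
  qed
  assume eq: "pr x y = pr x' y'"
  then have s: "x + y = x' + y'" using aux[of x y x' y'] aux[of x' y' x y] by (metis linorder_neqE)
  then have "x = x'" using eq by (simp add: pr_def)
  then show "x = x' \<and> y = y'" using s by simp
qed simp

lemma pr_ge: "x \<le> pr x y" "y \<le> pr x y"
proof -
  show "x \<le> pr x y" by (simp add: pr_def)
  have "x + y \<le> (x + y) * (x + y)"
    using le_mult_pos[of "x + y" "x + y"] zero_le[of "x + y"] by (cases "x + y = 0") (auto simp: less_le)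
  then have "y \<le> (x + y) * (x + y)" by (rule order_trans[rotated]) simp
  then show "y \<le> pr x y" unfolding pr_def by (rule order_trans) simp
qed


section \<open>Comprehension and collection\<close>

lemma comprehension:
  assumes "D (\<lambda>e. P (e 0) (e 1))" "D (\<lambda>e. Q (e 0) (e 1))"
    and eq: "\<And>z. (\<exists>w. P z w) \<longleftrightarrow> (\<forall>w. Q z w)"
  shows "\<exists>A\<in>Sets. \<forall>z. z \<in> A \<longleftrightarrow> (\<exists>w. P z w)"
proof -
  obtain c1 s1 where 1: "range s1 \<subseteq> Sets" "frep c1 s1 (\<lambda>e. P (e 0) (e 1))"
    using assms(1) unfolding D_def by blast
  obtain c2 s2 where 2: "range s2 \<subseteq> Sets" "frep c2 s2 (\<lambda>e. Q (e 0) (e 1))"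
    using assms(2) unfolding D_def by blast
  let ?c = "mix c1 c2" and ?s = "mix s1 s2"
  obtain p where p: "delta00 p" "\<forall>e. P (e 0) (e 1) \<longleftrightarrow> sem Sets (mix e ?c) ?s p"
    using frep_left[OF 1(2)] unfolding frep_def by blast
  obtain q where q: "delta00 q" "\<forall>e. Q (e 0) (e 1) \<longleftrightarrow> sem Sets (mix e ?c) ?s q"
    using frep_right[OF 2(2)] unfolding frep_def by blast
  define env where "env = mix (\<lambda>_. 0) ?c"
  \<comment> \<open>In the given formulas \<open>z\<close> is variable 0 and \<open>w\<close> is
    variable 2. Under the quantifiers of the axiom \<open>w\<close> has index 0 and \<open>z\<close>
    index 1, and everything else moves up by two.\<close>
  define h where "h n = (if n = 0 then 1 else if n = 2 then 0 else Suc (Suc n))" for n :: nat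
  have h: "mix (case_nat z (case_nat w (\<lambda>_. 0))) ?c n = case_nat w (case_nat z env) (h n)" for z w n
  proof (cases "n = 0 \<or> n = 2")
    case False
    then have "case_nat z (case_nat w (\<lambda>_. 0)) (n div 2) = 0" if "even n"
      using that by (auto elim!: evenE split: nat.split)
    moreover have "h n = Suc (Suc n)" using False by (simp add: h_def)
    ultimately show ?thesis by (simp add: env_def mix_def)
  qed (auto simp: h_def mix_def)
  let ?p = "subst (\<lambda>n. Var (h n)) (\<lambda>n. n) p" and ?q = "subst (\<lambda>n. Var (h n)) (\<lambda>n. n) q"
  have P: "sem Sets (case_nat w (case_nat z env)) ?s ?p = P z w" for w z
  proof -
    have "P z w = sem Sets (mix (case_nat z (case_nat w (\<lambda>_. 0))) ?c) ?s p"
      using p(2)[rule_format, of "case_nat z (case_nat w (\<lambda>_. 0))"] by simp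
    then show ?thesis by (simp only: sem_subst val.simps h[symmetric])
  qed
  have Q: "sem Sets (case_nat w (case_nat z env)) ?s ?q = Q z w" for w z
  proof -
    have "Q z w = sem Sets (mix (case_nat z (case_nat w (\<lambda>_. 0))) ?c) ?s q"
      using q(2)[rule_format, of "case_nat z (case_nat w (\<lambda>_. 0))"] by simp
    then show ?thesis by (simp only: sem_subst val.simps h[symmetric])
  qed
  have "sem Sets env ?s (comprehension_axiom (ExN ?p) (AllN ?q))"
  proof (rule sem_axiom[OF _ range_mix[OF 1(1) 2(1)]])
    have "sigma01 (ExN ?p)" "pi01 (AllN ?q)"
      unfolding sigma01_def pi01_def using delta00_subst[OF p(1)] delta00_subst[OF q(1)] by blast+
    then show "comprehension_axiom (ExN ?p) (AllN ?q) \<in> RCA0_star"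
      unfolding RCA0_star_def by blast
  qed
  then show ?thesis
    unfolding sem_comprehension_axiom sem_connectives sem.simps P Q using eq by simp
qed

text \<open>The components of a pair are at most its code, so the property is bounded and serves as
  both the existential and the universal form, with \<open>w\<close> vacuous.\<close>

lemma relation_comprehension:
  assumes "D (\<lambda>e. P (e 0) (e 1))"
  shows "\<exists>A\<in>Sets. \<forall>z. z \<in> A \<longleftrightarrow> (\<exists>x y. z = pr x y \<and> P x y)"
proof -
  let ?Q = "\<lambda>z w :: num. \<exists>x<z + 1. \<exists>y<z + 1. z = pr x y \<and> P x y"
  have D: "D (\<lambda>e. ?Q (e 0) (e 1))"
    by (intro D_intros Df_intros Df_pr D_rel2[OF _ _ assms])
  have "\<exists>A\<in>Sets. \<forall>z. z \<in> A \<longleftrightarrow> (\<exists>w. ?Q z w)"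
    by (rule comprehension[OF D D]) simp
  moreover have "(\<exists>w. ?Q z w) \<longleftrightarrow> (\<exists>x y. z = pr x y \<and> P x y)" for z
    using pr_ge by (auto simp: num_less_Suc)
  ultimately show ?thesis by simp
qed

text \<open>Bounding for \<open>\<Sigma>\<^sup>0\<^sub>1\<close> formulas: the relation \<open>\<mu> i \<le> \<mu> j\<close> between the least witnesses is
  \<open>\<Delta>\<^sup>0\<^sub>1\<close>, so that bounded induction with this set as a parameter finds a maximal one.\<close>

lemma collection:
  assumes "D (\<lambda>e. P (e 0) (e 1))" and ex: "\<And>i. i < n \<Longrightarrow> \<exists>w. P i w"
  shows "\<exists>B. \<forall>i<n. \<exists>w<B. P i w"
proof -
  let ?W = "\<lambda>i w. P i w \<and> (\<forall>v<w. \<not> P i v)"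
  note DP = D_rel2[OF _ _ assms(1)]
  have "\<forall>i. \<exists>w. i < n \<longrightarrow> ?W i w"
  proof
    fix i
    show "\<exists>w. i < n \<longrightarrow> ?W i w"
    proof (cases "i < n")
      case True
      then obtain w where "P i w" using ex by blast
      moreover have "D (\<lambda>e. P i (e 0))" by (intro DP Df_intros)
      ultimately obtain y where "P i y" "\<And>z. z < y \<Longrightarrow> \<not> P i z" using least_number by metis
      then show ?thesis by blast
    qed simp
  qed
  then obtain \<mu> where "\<forall>i. i < n \<longrightarrow> ?W i (\<mu> i)" by (rule choice[THEN exE])
  then have \<mu>: "P i (\<mu> i)" "P i w \<Longrightarrow> \<mu> i \<le> w" if "i < n" for i w
    using that by (auto simp: not_less[symmetric])
  have W: "?W i w \<longleftrightarrow> w = \<mu> i" if "i < n" for i w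
    using \<mu>[OF that] by (metis not_le order_antisym)
  have le: "(\<exists>u<w + 1. P i u) \<longleftrightarrow> \<mu> i \<le> w" if "i < n" for i w
    using \<mu>[OF that] by (auto simp: num_less_Suc intro: order_trans)
  \<comment> \<open>Both express \<open>\<mu> i \<le> \<mu> j\<close>: since \<open>\<mu> j\<close>
    is the only least witness of \<open>j\<close>, it makes no difference whether some or every such
    \<open>w\<close> is asked to bound a witness of \<open>i\<close>.\<close>
  let ?E1 = "\<lambda>z w. \<exists>i<z + 1. \<exists>j<z + 1. (z = pr i j \<and> i < n \<and> j < n) \<and> ?W j w \<and> (\<exists>u<w + 1. P i u)"
  let ?E2 = "\<lambda>z w. \<exists>i<z + 1. \<exists>j<z + 1. (z = pr i j \<and> i < n \<and> j < n) \<and> (?W j w \<longrightarrow> (\<exists>u<w + 1. P i u))"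
  have E1: "(\<exists>w. ?E1 z w) \<longleftrightarrow> (\<exists>i j. (z = pr i j \<and> i < n \<and> j < n) \<and> \<mu> i \<le> \<mu> j)" (is "_ \<longleftrightarrow> ?E z") for z
  proof
    assume "\<exists>w. ?E1 z w"
    then obtain w i j where *: "z = pr i j \<and> i < n \<and> j < n" "?W j w" "\<exists>u<w + 1. P i u" by blast
    then have "\<mu> i \<le> \<mu> j" using W[of j w] le[of i w] by simp
    then show "?E z" using * by blast
  next
    assume "?E z"
    then obtain i j where *: "z = pr i j" "i < n" "j < n" "\<mu> i \<le> \<mu> j" by blast
    then have "?W j (\<mu> j)" "\<exists>u<\<mu> j + 1. P i u" using W[of j "\<mu> j"] le[of i "\<mu> j"] by simp_all
    moreover have "i < z + 1" "j < z + 1" using pr_ge * by (simp_all add: num_less_Suc)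
    ultimately show "\<exists>w. ?E1 z w" using * by blast
  qed
  have E2: "?E z \<longleftrightarrow> (\<forall>w. ?E2 z w)" for z
  proof
    assume "?E z"
    then obtain i j where *: "z = pr i j" "i < n" "j < n" "\<mu> i \<le> \<mu> j" by blast
    then have "?W j w \<longrightarrow> (\<exists>u<w + 1. P i u)" for w
      using W[of j w] le[of i w] le[of i "\<mu> j"] by simp
    moreover have "i < z + 1" "j < z + 1" using pr_ge * by (simp_all add: num_less_Suc)
    ultimately show "\<forall>w. ?E2 z w" using * by blast
  next
    assume a: "\<forall>w. ?E2 z w"
    obtain i j where *: "z = pr i j" "i < n" "j < n" using a by blast
    have "?E2 z (\<mu> j)" using a by blast
    then have "?W j (\<mu> j) \<longrightarrow> (\<exists>u<\<mu> j + 1. P i u)" using * by auto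
    then have "\<mu> i \<le> \<mu> j" using W[of j "\<mu> j"] le[of i "\<mu> j"] * by simp
    then show "?E z" using * by blast
  qed
  have "\<exists>A\<in>Sets. \<forall>z. z \<in> A \<longleftrightarrow> (\<exists>w. ?E1 z w)"
  proof (rule comprehension[where Q = ?E2])
    show "D (\<lambda>e. ?E1 (e 0) (e 1))" by (intro D_intros Df_intros Df_pr DP)
    show "D (\<lambda>e. ?E2 (e 0) (e 1))" by (intro D_intros Df_intros Df_pr DP)
    show "(\<exists>w. ?E1 z w) \<longleftrightarrow> (\<forall>w. ?E2 z w)" for z unfolding E1 by (rule E2)
  qed
  then obtain A where A: "A \<in> Sets" "\<And>z. z \<in> A \<longleftrightarrow> ?E z" unfolding E1 by blast
  have A': "pr i j \<in> A \<longleftrightarrow> i < n \<and> j < n \<and> \<mu> i \<le> \<mu> j" for i j unfolding A(2) by auto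
  \<comment> \<open>Finds an index whose least witness is largest. With \<open>A\<close> as
    parameter the formula is bounded, although \<open>\<mu>\<close> need not have a bounding
    term.\<close>
  have "m \<le> n \<longrightarrow> m = 0 \<or> (\<exists>j<m. \<forall>i<m. pr i j \<in> A)" for m
  proof (induction m rule: D_induct)
    show "D (\<lambda>e. e 0 \<le> n \<longrightarrow> e 0 = 0 \<or> (\<exists>j<e 0. \<forall>i<e 0. pr i j \<in> A))"
      by (intro D_intros D_mem A(1) Df_intros Df_pr)
  next
    case (Suc m)
    show ?case
    proof (intro impI disjI2)
      assume "m + 1 \<le> n"
      then have m: "m < n" by (simp add: num_Suc_le)
      show "\<exists>j<m + 1. \<forall>i<m + 1. pr i j \<in> A"
      proof (cases "m = 0")
        case True
        then show ?thesis using m by (intro exI[of _ 0]) (auto simp: A' num_axioms(8))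
      next
        case False
        then obtain j where j: "j < m" "\<forall>i<m. pr i j \<in> A" using Suc m by auto
        show ?thesis
        proof (cases "\<mu> m \<le> \<mu> j")
          case True
          then show ?thesis using j m by (intro exI[of _ j]) (auto simp: A' num_axioms(8))
        next
          case False
          then show ?thesis using j m by (intro exI[of _ m]) (auto simp: A' num_axioms(8))
        qed
      qed
    qed
  qed simp
  from this[of n] consider "n = 0" | j where "j < n" "\<forall>i<n. pr i j \<in> A" by auto
  then show ?thesis
  proof cases
    case 2
    then have "\<forall>i<n. \<exists>w<\<mu> j + 1. P i w" by (auto simp: A' num_less_Suc intro!: \<mu>(1))
    then show ?thesis ..
  qed auto
qed


section \<open>The fast growing hierarchy in the term model\<close>

primrec FG :: "nat \<Rightarrow> num \<Rightarrow> num \<Rightarrow> bool" where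
  "FG 0 x y \<longleftrightarrow> y = x + 1"
| "FG (Suc n) x y \<longleftrightarrow> (\<exists>c<(y + 1) ^^^ (x + 1 + 1). ent c (y + 1) 0 x \<and> ent c (y + 1) (x + 1) y
    \<and> (\<forall>i<x + 1. \<exists>u<y + 1. \<exists>v<y + 1. ent c (y + 1) i u \<and> ent c (y + 1) (i + 1) v \<and> FG n u v))"

text \<open>Presents the coded iterates as a definable function, the form in which they can enter
  bounded inductions.\<close>

lemma FG_SucE:
  assumes "FG (Suc n) x y"
  obtains z where "Dfun z" "z 0 = x" "z (x + 1) = y" "\<forall>i\<le>x. FG n (z i) (z (i + 1))"
proof -
  obtain c where c: "ent c (y + 1) 0 x" "ent c (y + 1) (x + 1) y"
    "\<forall>i<x + 1. \<exists>u<y + 1. \<exists>v<y + 1. ent c (y + 1) i u \<and> ent c (y + 1) (i + 1) v \<and> FG n u v"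
    using assms by auto
  have "FG n (dg c (y + 1) i) (dg c (y + 1) (i + 1))" if "i \<le> x" for i
    using c(3) that unfolding ent_iff num_less_Suc by blast
  moreover have "Dfun (dg c (y + 1))" by (intro DfunI Df_dg Df_intros)
  ultimately show thesis using that c(1,2) by (simp add: ent_iff)
qed

text \<open>An external induction on the standard index \<open>n\<close>, with an internal one along
  the iterates showing that the two sequences coincide.\<close>

lemma FG_functional: "FG n x y \<Longrightarrow> FG n x y' \<Longrightarrow> y = y'"
proof (induction n arbitrary: x y y')
  case (Suc n)
  note FG_unique = Suc.IH
  obtain z where z: "Dfun z" "z 0 = x" "z (x + 1) = y" "\<forall>i\<le>x. FG n (z i) (z (i + 1))"
    by (rule FG_SucE[OF Suc.prems(1)])
  obtain w where w: "Dfun w" "w 0 = x" "w (x + 1) = y'" "\<forall>i\<le>x. FG n (w i) (w (i + 1))"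
    by (rule FG_SucE[OF Suc.prems(2)])
  have "i \<le> x + 1 \<longrightarrow> z i = w i" for i
  proof (induction i rule: D_induct)
    show "D (\<lambda>e. e 0 \<le> x + 1 \<longrightarrow> z (e 0) = w (e 0))"
      by (intro D_intros Df_intros DfunD[OF z(1)] DfunD[OF w(1)])
  next
    case (Suc i)
    show ?case
    proof
      assume "i + 1 \<le> x + 1"
      then have i: "i \<le> x" by simp
      then have "i \<le> x + 1" by (rule order_trans) simp
      then have "z i = w i" using Suc by simp
      then show "z (i + 1) = w (i + 1)" using FG_unique[OF z(4)[rule_format, OF i]] w(4)[rule_format, OF i] by simp
    qed
  qed (use z w in simp)
  from this[of "x + 1"] show ?case using z w by simp
qed simp


section \<open>Descending tuples\<close>

text \<open>One step of the descent in \<open>\<omega>\<^sup>n\<close>, the entries having increasing weight: the lowest nonzero entry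
  is decremented and all entries below it are replaced by \<open>a\<close>.\<close>

definition row_step :: "nat \<Rightarrow> (nat \<Rightarrow> num) \<Rightarrow> (nat \<Rightarrow> num) \<Rightarrow> num \<Rightarrow> bool" where
  "row_step n s s' a \<longleftrightarrow> (\<exists>l<n. s l = s' l + 1 \<and> (\<forall>j<l. s j = 0 \<and> s' j = a) \<and> (\<forall>j<n. l < j \<longrightarrow> s' j = s j))"

text \<open>\<open>A\<close> is the increasing chain, and \<open>\<tau> j i\<close> is entry
  \<open>j\<close> of the tuple that stands at \<open>A i\<close>.\<close>

locale descent =
  fixes n :: nat and m :: num and A :: "num \<Rightarrow> num" and \<tau> :: "nat \<Rightarrow> num \<Rightarrow> num"
  assumes DA: "Dfun A" and D\<tau>: "\<And>j. Dfun (\<tau> j)"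
    and init: "\<And>j. j < n \<Longrightarrow> \<tau> j 0 = A 0"
    and incr: "\<And>i. i < m \<Longrightarrow> A i < A (i + 1)"
    and step: "\<And>i. i < m \<Longrightarrow> row_step n (\<lambda>j. \<tau> j i) (\<lambda>j. \<tau> j (i + 1)) (A (i + 1))"
begin

lemma A_ge: "i \<le> m \<longrightarrow> A 0 + i \<le> A i"
proof (induction i rule: D_induct)
  show "D (\<lambda>e. e 0 \<le> m \<longrightarrow> A 0 + e 0 \<le> A (e 0))" by (intro D_intros Df_intros DfunD[OF DA])
next
  case (Suc i)
  show ?case
  proof
    assume "i + 1 \<le> m"
    then have i: "i < m" by (simp add: num_Suc_le)
    then have "A 0 + i \<le> A i" using Suc by simp
    then show "A 0 + (i + 1) \<le> A (i + 1)" using incr[OF i] unfolding num_emb by linarith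
  qed
qed simp

text \<open>While some entry below \<open>j\<close> is nonzero, the lowest nonzero entry lies below
  \<open>j\<close>, and a step leaves everything above that entry alone.\<close>

lemma entry_constant:
  assumes j: "j < n" and "r \<le> m" and nz: "\<forall>i. p \<le> i \<and> i < r \<longrightarrow> (\<exists>l<j. \<tau> l i \<noteq> 0)"
  shows "p \<le> x \<and> x \<le> r \<longrightarrow> \<tau> j x = \<tau> j p"
proof (induction x rule: D_induct)
  show "D (\<lambda>e. p \<le> e 0 \<and> e 0 \<le> r \<longrightarrow> \<tau> j (e 0) = \<tau> j p)"
    by (intro D_intros Df_intros DfunD[OF D\<tau>])
next
  case 0
  then show ?case by simp
next
  case (Suc x)
  show ?case
  proof
    assume x: "p \<le> x + 1 \<and> x + 1 \<le> r"
    show "\<tau> j (x + 1) = \<tau> j p"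
    proof (cases "p = x + 1")
      case False
      then have "p < x + 1" using x by (simp add: less_le)
      then have x': "p \<le> x" "x < r" using x by (simp_all add: num_less_Suc num_Suc_le)
      then have "x < m" using assms(2) by simp
      from step[OF this] obtain l where l: "l < n" "\<forall>i<l. \<tau> i x = 0" "\<forall>i<n. l < i \<longrightarrow> \<tau> i (x + 1) = \<tau> i x"
        unfolding row_step_def by blast
      have "l < j" using nz x' l(2) by (metis not_less order_less_le_trans)
      then have "\<tau> j (x + 1) = \<tau> j x" using l(3) j by blast
      then show ?thesis using Suc x' by simp
    qed simp
  qed
qed

text \<open>Row \<open>r\<close> ends a run of the entries below \<open>j\<close>: until then
  \<open>entry_constant\<close> applies, and the next step, if any, must decrement an entry from
  \<open>j\<close> on.\<close>

lemma first_zero_row: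
  assumes "p \<le> q" "\<And>l. l < j \<Longrightarrow> \<tau> l q = 0"
  obtains r where "p \<le> r" "r \<le> q" "\<forall>l<j. \<tau> l r = 0"
    "\<forall>i. p \<le> i \<and> i < r \<longrightarrow> (\<exists>l<j. \<tau> l i \<noteq> 0)"
proof -
  have "D (\<lambda>e. p \<le> e 0 \<and> (\<forall>l<j. \<tau> l (e 0) = 0))"
    by (intro D_intros D_ball_nat Df_intros DfunD[OF D\<tau>])
  then obtain r where "p \<le> r \<and> (\<forall>l<j. \<tau> l r = 0)" "\<forall>z<r. \<not> (p \<le> z \<and> (\<forall>l<j. \<tau> l z = 0))" "r \<le> q"
    by (rule least_number[of "\<lambda>x. p \<le> x \<and> (\<forall>l<j. \<tau> l x = 0)" q]) (use assms in auto)
  then show thesis by (intro that[of r]) auto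
qed

text \<open>Clearing \<open>j + 1\<close> entries takes at least \<open>v\<close> decrements of
  entry \<open>j\<close>. Before each of them, and once more at the end, the \<open>j\<close> lower
  entries run down to 0, which by the induction hypothesis accounts for one application of F_j. The
  decrement resets them to A (r + 1) >= A 0 + r + 1, enough to start the next application. So F_j is
  iterated \<open>v + 1\<close> times.\<close>

lemma growth:
  "FG j v y \<Longrightarrow> j \<le> n \<Longrightarrow> p \<le> q \<Longrightarrow> q \<le> m \<Longrightarrow> (\<And>l. l < j \<Longrightarrow> v \<le> \<tau> l p) \<Longrightarrow> (\<And>l. l < j \<Longrightarrow> \<tau> l q = 0)
    \<Longrightarrow> v \<le> A 0 + p \<Longrightarrow> y \<le> A 0 + q + 1"
proof (induction j arbitrary: v y p q)
  case 0
  then show ?case unfolding FG.simps num_emb by linarith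
next
  case (Suc j)
  note growth = Suc.IH
  note prems = Suc.prems
  have j: "j < n" using prems(2) by simp
  obtain z where z: "Dfun z" "z 0 = v" "z (v + 1) = y" "\<forall>i\<le>v. FG j (z i) (z (i + 1))"
    by (rule FG_SucE[OF prems(1)])
  \<comment> \<open>Run \<open>i\<close>, counted from 0, starts at row \<open>r\<close>; by then
    entry \<open>j\<close> has lost at most \<open>i\<close>.\<close>
  have ex: "i \<le> v \<longrightarrow> (\<exists>r<q + 1. p \<le> r \<and> z i \<le> A 0 + r \<and> (\<forall>l<j. z i \<le> \<tau> l r) \<and> v \<le> \<tau> j r + i)" for i
  proof (induction i rule: D_induct)
    show "D (\<lambda>e. e 0 \<le> v \<longrightarrow> (\<exists>r<q + 1. p \<le> r \<and> z (e 0) \<le> A 0 + r \<and> (\<forall>l<j. z (e 0) \<le> \<tau> l r) \<and> v \<le> \<tau> j r + e 0))"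
      by (intro D_intros D_ball_nat Df_intros DfunD[OF D\<tau>] DfunD[OF z(1)])
  next
    case 0
    show ?case using prems z(2) by (intro impI exI[of _ p]) (simp add: num_less_Suc)
  next
    case (Suc i)
    show ?case
    proof
      assume iv: "i + 1 \<le> v"
      then have i: "i \<le> v" by (simp add: num_Suc_le less_imp_le)
      then obtain p' where p': "p' \<le> q" "p \<le> p'" "z i \<le> A 0 + p'" "\<forall>l<j. z i \<le> \<tau> l p'" "v \<le> \<tau> j p' + i"
        using Suc by (auto simp: num_less_Suc)
      obtain r where r: "p' \<le> r" "r \<le> q" "\<forall>l<j. \<tau> l r = 0"
        "\<forall>i. p' \<le> i \<and> i < r \<longrightarrow> (\<exists>l<j. \<tau> l i \<noteq> 0)"
        by (rule first_zero_row[OF p'(1), of j]) (use prems(6) in auto)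
      have "r \<le> m" using r(2) prems(4) by simp
      from entry_constant[OF j this r(4), of r] have eq: "\<tau> j r = \<tau> j p'" using r(1) by simp
      \<comment> \<open>Entry \<open>j\<close> was at least \<open>v\<close> and has lost at most
        \<open>i < v\<close>, so it is positive and receives the next decrement.\<close>
      have "\<tau> j r \<noteq> 0"
      proof
        assume "\<tau> j r = 0"
        then have "i + 1 \<le> i" using eq p'(5) order_trans[OF iv, of i] \<open>\<tau> j r = 0\<close> by simp
        then show False by (simp add: num_Suc_le)
      qed
      moreover have "\<tau> j q = 0" using prems(6) by simp
      ultimately have "r < q" using r(2) by (auto simp: less_le)
      then have "r < m" using prems(4) by simp
      from step[OF this] obtain l where l: "l < n" "\<tau> l r = \<tau> l (r + 1) + 1"
        "\<forall>i<l. \<tau> i r = 0 \<and> \<tau> i (r + 1) = A (r + 1)"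
        unfolding row_step_def by blast
      have "\<not> l < j" using r(3) l(2) by auto
      moreover have "\<not> j < l" using l(3) \<open>\<tau> j r \<noteq> 0\<close> by auto
      ultimately have "l = j" by simp
      have y: "z (i + 1) \<le> A 0 + r + 1"
        by (rule growth[OF z(4)[rule_format, OF i] _ r(1) \<open>r \<le> m\<close>]) (use p' r j in auto)
      have "A 0 + (r + 1) \<le> A (r + 1)" using A_ge[of "r + 1"] \<open>r < m\<close> by (simp add: num_Suc_le)
      then have "\<forall>l<j. z (i + 1) \<le> \<tau> l (r + 1)"
        using l(3) y \<open>l = j\<close> by (auto simp: add.assoc)
      moreover have "v \<le> \<tau> j (r + 1) + (i + 1)"
        using p'(5) eq l(2) \<open>l = j\<close> unfolding num_emb by simp
      moreover have "p \<le> r + 1" using p'(2) r(1) unfolding num_emb by linarith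
      moreover have "r + 1 < q + 1" using \<open>r < q\<close> by simp
      ultimately show "\<exists>r<q + 1. p \<le> r \<and> z (i + 1) \<le> A 0 + r \<and> (\<forall>l<j. z (i + 1) \<le> \<tau> l r) \<and> v \<le> \<tau> j r + (i + 1)"
        using y by (intro exI[of _ "r + 1"]) (simp add: add.assoc)
    qed
  qed
  \<comment> \<open>The last run may use all rows up to \<open>q\<close>, where the lower entries
    vanish by assumption.\<close>
  from ex[of v] obtain r where r: "r \<le> q" "z v \<le> A 0 + r" "\<forall>l<j. z v \<le> \<tau> l r" by (auto simp: num_less_Suc)
  have "z (v + 1) \<le> A 0 + q + 1"
    by (rule growth[OF z(4)[rule_format, OF order_refl] _ r(1) prems(4)]) (use r j prems(6) in auto)
  then show ?case using z(3) by simp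
qed

text \<open>The \<open>k\<close> lower entries reach 0 at row \<open>q\<close>, and
  \<open>growth\<close> gives y \<le> A 0 + q + 1. The top entry is then still \<open>A 0\<close>
  and loses at most 1 per step, so at least \<open>A 0\<close> more steps follow and absorb the
  summand \<open>A 0\<close>.\<close>

lemma stuck_bound:
  assumes n: "n = Suc k" and stuck: "\<And>j. j < n \<Longrightarrow> \<tau> j m = 0" and y: "FG k (A 0) y"
  shows "y \<le> m + 1"
proof -
  have k: "k < n" using n by simp
  obtain q where q: "0 \<le> q" "q \<le> m" "\<forall>l<k. \<tau> l q = 0"
    "\<forall>i. 0 \<le> i \<and> i < q \<longrightarrow> (\<exists>l<k. \<tau> l i \<noteq> 0)"
    by (rule first_zero_row[OF zero_le, of k m]) (use stuck n in auto)
  have "\<tau> k q = A 0" using entry_constant[OF k q(2) q(4), of q] init[OF k] by simp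
  have yq: "y \<le> A 0 + q + 1" by (rule growth[OF y _ q(1,2)]) (use q init n in auto)
  have "q \<le> r \<and> r \<le> m \<longrightarrow> A 0 + q \<le> \<tau> k r + r" for r
  proof (induction r rule: D_induct)
    show "D (\<lambda>e. q \<le> e 0 \<and> e 0 \<le> m \<longrightarrow> A 0 + q \<le> \<tau> k (e 0) + e 0)"
      by (intro D_intros Df_intros DfunD[OF D\<tau>])
  next
    case 0
    show ?case using \<open>\<tau> k q = A 0\<close> by auto
  next
    case (Suc r)
    show ?case
    proof
      assume r: "q \<le> r + 1 \<and> r + 1 \<le> m"
      show "A 0 + q \<le> \<tau> k (r + 1) + (r + 1)"
      proof (cases "q = r + 1")
        case True
        then show ?thesis using \<open>\<tau> k q = A 0\<close> by simp
      next
        case False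
        then have "q < r + 1" using r by (simp add: less_le)
        then have "q \<le> r" "r < m" using r by (simp_all add: num_less_Suc num_Suc_le)
        then have IH: "A 0 + q \<le> \<tau> k r + r" using Suc by simp
        from step[OF \<open>r < m\<close>] obtain l where l: "l < n" "\<tau> l r = \<tau> l (r + 1) + 1"
          "\<forall>j<n. l < j \<longrightarrow> \<tau> j (r + 1) = \<tau> j r"
          unfolding row_step_def by blast
        have "\<tau> k r \<le> \<tau> k (r + 1) + 1"
          using l k n by (cases "l = k") auto
        then show ?thesis using IH unfolding num_emb by linarith
      qed
    qed
  qed
  from this[of m] have "A 0 + q \<le> m" using stuck[OF k] q(2) by simp
  then show ?thesis using yq unfolding num_emb by linarith
qed

end


section \<open>Concatenation of paths\<close>

definition path :: "num set \<Rightarrow> num \<Rightarrow> num \<Rightarrow> num \<Rightarrow> num \<Rightarrow> num \<Rightarrow> bool" where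
  "path R c b l x y \<longleftrightarrow> 0 < l \<and> 0 < b \<and> dg c b 0 = x \<and> dg c b l = y
    \<and> (\<forall>j<l. pr (dg c b j) (dg c b (j + 1)) \<in> R)"

lemma D_path:
  assumes "R \<in> Sets" "Df c" "Df b" "Df l" "Df x" "Df y"
  shows "D (\<lambda>e. path R (c e) (b e) (l e) (x e) (y e))"
proof -
  have "D (\<lambda>e. \<forall>j<l e. pr (dg (c e) (b e) j) (dg (c e) (b e) (j + 1)) \<in> R)"
    by (intro D_ball D_mem Df_pr Df_dg Df_add Df_var Df_const assms(1,4) Df_rename[OF assms(2)] Df_rename[OF assms(3)])
  then show ?thesis
    unfolding path_def by (intro D_and D_less D_eq Df_const Df_dg assms) assumption
qed

text \<open>A descent lists R-predecessors, whereas a path runs forward along R; the appended path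
  is therefore read from its end. As \<open>b\<close> exceeds \<open>b'\<close>, its entries are
  admissible digits in base \<open>b\<close>.\<close>

lemma append_path:
  assumes b: "0 < (b::num)" "b' < b" and l: "path R c' b' l (f' :: num) (dg c b L)"
    and R: "\<And>j. j < L \<Longrightarrow> pr (dg c b (j + 1)) (dg c b j) \<in> R"
  shows "\<exists>d<b ^^^ (L + l + 1). dg d b 0 = dg c b 0 \<and> dg d b (L + l) = f'
    \<and> (\<forall>j<L + l. pr (dg d b (j + 1)) (dg d b j) \<in> R)"
proof -
  define g where "g j = (if j \<le> L then dg c b j else dg c' b' (l - (j - L)))" for j
  have l': "0 < l" "0 < b'" "dg c' b' 0 = f'" "dg c' b' l = dg c b L"
    "\<And>j. j < l \<Longrightarrow> pr (dg c' b' j) (dg c' b' (j + 1)) \<in> R"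
    using l unfolding path_def by auto
  have "Dfun g" unfolding g_def by (intro DfunI D_intros Df_intros Df_dg)
  moreover have "g j < b" for j
    using dg_less[OF b(1)] less_trans[OF dg_less[OF l'(2)] b(2)] by (simp add: g_def)
  ultimately obtain d where d: "d < b ^^^ (L + l + 1)" "\<And>j. j \<le> L + l \<Longrightarrow> dg d b j = g j"
    using sequence_ex[of g b "L + l + 1"] b(1) unfolding num_less_Suc by blast
  have g1: "g j = dg c b j" if "j \<le> L" for j using that by (simp add: g_def)
  \<comment> \<open>At the junction \<open>j = 0\<close> the two branches of \<open>g\<close> agree,
    because the path ends in digit \<open>L\<close> of \<open>c\<close>.\<close>
  have g2: "g (L + j) = dg c' b' (l - j)" for j
    using l'(4) zero_le[of j] by (cases "j = 0") (auto simp: g_def less_le not_le)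
  have "pr (g (j + 1)) (g j) \<in> R" if "j < L + l" for j
  proof (cases "j < L")
    case True
    then show ?thesis using R by (simp add: g1 num_Suc_le)
  next
    case False
    then obtain i where i: "j = L + i" using le_iff_add by (auto simp: not_less)
    then have "i + 1 \<le> l" using that by (simp add: num_Suc_le)
    then obtain h where h: "l = i + 1 + h" using le_iff_add by blast
    have "l - (i + 1) = h" "l - i = h + 1" unfolding h by (simp_all add: add.assoc add.commute[of 1])
    moreover have "h < l" using emb_nonneg[of i] unfolding h num_emb by linarith
    ultimately show ?thesis
      using l'(5)[of h] g2[of i] g2[of "i + 1"] unfolding i by (simp add: add.assoc)
  qed
  moreover have "dg d b 0 = dg c b 0" using d(2)[of 0] by (simp add: g1)
  moreover have "dg d b (L + l) = f'" using d(2)[of "L + l"] l'(3) by (simp add: g2)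
  moreover have "dg d b (j + 1) = g (j + 1)" "dg d b j = g j" if "j < L + l" for j
    using that d(2)[of "j + 1"] d(2)[of j] by (simp_all add: num_Suc_le)
  ultimately show ?thesis using d(1) by auto
qed

text \<open>Collection bounds the codes, bases and lengths of all connecting paths by one
  \<open>B\<close>. The joined descent then has length at most \<open>i * B\<close> after
  \<open>i\<close> paths and a fixed base, so it can be built by bounded induction. Each path has
  positive length, whence \<open>n \<le> L\<close>.\<close>

lemma concat_paths:
  assumes R: "R \<in> Sets" and f: "Dfun f"
    and ex: "\<And>i. i < n \<Longrightarrow> \<exists>c b l. path R c b l (f (i + 1)) (f i)"
  obtains c b L where "n \<le> L" "0 < b" "dg c b 0 = f 0"
    "\<forall>j<L. pr (dg c b (j + 1)) (dg c b j) \<in> R"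
proof -
  have "\<exists>B. \<forall>i<n. \<exists>w<B. \<exists>c<w. \<exists>b<w. \<exists>l<w. path R c b l (f (i + 1)) (f i)"
  proof (rule collection[of "\<lambda>i w. \<exists>c<w. \<exists>b<w. \<exists>l<w. path R c b l (f (i + 1)) (f i)"])
    show "D (\<lambda>e. \<exists>c<e 1. \<exists>b<e 1. \<exists>l<e 1. path R c b l (f (e 0 + 1)) (f (e 0)))"
      by (intro D_intros D_path R Df_intros DfunD[OF f])
  next
    fix i assume "i < n"
    then obtain c b l where "path R c b l (f (i + 1)) (f i)" using ex by blast
    moreover have "c < c + b + l + 1" "b < c + b + l + 1" "l < c + b + l + 1"
      using emb_nonneg[of c] emb_nonneg[of b] emb_nonneg[of l] unfolding num_emb by linarith+
    ultimately show "\<exists>w. \<exists>c<w. \<exists>b<w. \<exists>l<w. path R c b l (f (i + 1)) (f i)" by blast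
  qed
  then obtain B where B: "\<forall>i<n. \<exists>w<B. \<exists>c<w. \<exists>b<w. \<exists>l<w. path R c b l (f (i + 1)) (f i)" ..
  \<comment> \<open>Exceeds the bases of all the paths, which are below \<open>B\<close>, and the
    starting point \<open>f 0\<close>.\<close>
  define b where "b = B + f 0 + 1"
  have b: "0 < b" by (simp add: b_def num_less_Suc)
  have "i \<le> n \<longrightarrow> (\<exists>L<i * B + 1. \<exists>c<b ^^^ (L + 1). i \<le> L \<and> dg c b 0 = f 0 \<and> dg c b L = f i
      \<and> (\<forall>j<L. pr (dg c b (j + 1)) (dg c b j) \<in> R))" for i
  proof (induction i rule: D_induct)
    show "D (\<lambda>e. e 0 \<le> n \<longrightarrow> (\<exists>L<e 0 * B + 1. \<exists>c<b ^^^ (L + 1). e 0 \<le> L \<and> dg c b 0 = f 0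
        \<and> dg c b L = f (e 0) \<and> (\<forall>j<L. pr (dg c b (j + 1)) (dg c b j) \<in> R)))"
      by (intro D_intros D_mem R Df_pr Df_dg Df_intros DfunD[OF f])
  next
    case 0
    have "f 0 < b" by (simp add: b_def num_less_Suc)
    moreover then have "dg (f 0) b 0 = f 0"
      by (intro dgI[of _ 0 _ _ _ 0]) (simp_all add: num_axioms(9))
    ultimately show ?case
      using num_axioms(10)[of b 0] by (intro impI exI[of _ 0]) (auto simp: num_axioms(9) intro!: exI[of _ "f 0"])
  next
    case (Suc i)
    show ?case
    proof
      assume "i + 1 \<le> n"
      then have i: "i < n" by (simp add: num_Suc_le)
      then obtain L c where L: "L \<le> i * B" "i \<le> L" and c: "dg c b 0 = f 0" "dg c b L = f i"
        "\<forall>j<L. pr (dg c b (j + 1)) (dg c b j) \<in> R"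
        using Suc by (auto simp: num_less_Suc)
      obtain w c' b' l where w: "w < B" "b' < w" "l < w" "path R c' b' l (f (i + 1)) (f i)"
        using B i by blast
      have "b' < b" using w(1,2) zero_le[of "f 0"] unfolding b_def num_emb by linarith
      from append_path[OF b this, of R c' l "f (i + 1)" c L] obtain d where d: "d < b ^^^ (L + l + 1)"
        "dg d b 0 = f 0" "dg d b (L + l) = f (i + 1)" "\<forall>j<L + l. pr (dg d b (j + 1)) (dg d b j) \<in> R"
        using w(4) c by auto
      have "0 < l" using w(4) by (simp add: path_def)
      then have "i + 1 \<le> L + l" using L(2) unfolding num_emb by linarith
      moreover have "L + l < (i + 1) * B + 1"
        using L(1) w(1,3) unfolding num_emb by (simp add: algebra_simps)
      ultimately show "\<exists>L<(i + 1) * B + 1. \<exists>c<b ^^^ (L + 1). i + 1 \<le> L \<and> dg c b 0 = f 0 \<and> dg c b L = f (i + 1)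
          \<and> (\<forall>j<L. pr (dg c b (j + 1)) (dg c b j) \<in> R)"
        using d by blast
    qed
  qed
  from this[of n] show thesis using that b by blast
qed


text \<open>The quotients by b^n either differ, which settles the top digit, or pass the comparison
  to the remainders. So a least code stands for a lexicographically least tuple. The number of
  digits is standard, hence the external induction.\<close>

lemma digits_lex:
  "s < t \<Longrightarrow> t < b ^^^ of_nat n \<Longrightarrow> \<exists>j<n. dg s b (of_nat j) < dg t b (of_nat j)
    \<and> (\<forall>i<n. j < i \<longrightarrow> dg s b (of_nat i) = dg t b (of_nat i))"
proof (induction n arbitrary: s t)
  case 0
  then show ?case by (simp add: num_axioms(9))
next
  case (Suc n)
  define N :: num where "N = of_nat n"
  have t: "t < b ^^^ N * b" using Suc.prems(2) by (simp add: N_def num_axioms(10) add.commute[of 1])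
  have "b \<noteq> 0" using t by auto
  then have b: "0 < b" using zero_le[of b] by (simp add: less_le)
  obtain qs rs where s': "s = qs * b ^^^ N + rs" "rs < b ^^^ N" using div_ex[OF pw_pos[OF b]] by blast
  obtain qt rt where t': "t = qt * b ^^^ N + rt" "rt < b ^^^ N" using div_ex[OF pw_pos[OF b]] by blast
  have aux: "q \<le> q'" if "q * b ^^^ N \<le> q' * b ^^^ N + r" "r < b ^^^ N" for q q' r
  proof -
    have "q * b ^^^ N < (q' + 1) * b ^^^ N"
      using le_less_trans[OF that(1), of "(q' + 1) * b ^^^ N"] that(2) by (simp add: algebra_simps)
    then have "q < q' + 1" by (rule mult_right_less_imp_less) simp
    then show ?thesis by (simp add: num_less_Suc)
  qed
  have "qs * b ^^^ N \<le> s" using s'(1) by simp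
  then have q: "qs \<le> qt" using aux[of qs qt rt] t' Suc.prems(1) by simp
  have "qt < b"
  proof (rule ccontr)
    assume "\<not> qt < b"
    then have "b * b ^^^ N \<le> qt * b ^^^ N" by (intro mult_right_mono) simp_all
    also have "\<dots> \<le> t" using t'(1) by simp
    finally show False using t by (simp add: mult.commute)
  qed
  have dt: "dg t b N = qt" by (rule dgI[of _ 0 _ _ _ rt]) (use t' \<open>qt < b\<close> in simp_all)
  have ds: "dg s b N = qs" by (rule dgI[of _ 0 _ _ _ rs]) (use s' q \<open>qt < b\<close> in simp_all)
  show ?case
  proof (cases "qs = qt")
    case True
    then have "rs < rt" using Suc.prems(1) s' t' by simp
    then obtain j where j: "j < n" "dg rs b (of_nat j) < dg rt b (of_nat j)"
      "\<forall>i<n. j < i \<longrightarrow> dg rs b (of_nat i) = dg rt b (of_nat i)"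
      using Suc.IH[of rs rt] t'(2) unfolding N_def by blast
    have low: "dg s b (of_nat i) = dg rs b (of_nat i)" "dg t b (of_nat i) = dg rt b (of_nat i)" if "i < n" for i
      using that unfolding s'(1) t'(1) by (auto intro!: dg_add_high[OF b] simp: N_def)
    show ?thesis
      using j low dt ds True by (intro exI[of _ j]) (auto simp: less_Suc_eq N_def)
  next
    case False
    then have "qs < qt" using q by simp
    then show ?thesis using dt ds by (intro exI[of _ n]) (auto simp: N_def)
  qed
qed


section \<open>Ranks for the transitive closure\<close>

locale bounded_relation =
  fixes k :: nat and P R :: "num set"
  assumes P: "P \<in> Sets" and R: "R \<in> Sets"
    and P_path: "\<And>x y. pr x y \<in> P \<Longrightarrow> \<exists>c b l. path R c b l x y"
    and R_bound: "\<And>c b L. 0 < b \<Longrightarrow> \<forall>j<L. pr (dg c b (j + 1)) (dg c b j) \<in> R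
      \<Longrightarrow> \<exists>y. FG k (dg c b 0) y \<and> L + 1 \<le> y"
begin

text \<open>Refining every \<open>P\<close>-step to an R-path can only lengthen the descent, so the
  bound on R carries over.\<close>

lemma chain_bound:
  assumes "Dfun f" "\<And>i. i < m \<Longrightarrow> pr (f (i + 1)) (f i) \<in> P"
  shows "\<exists>y. FG k (f 0) y \<and> m + 1 \<le> y"
proof -
  obtain c b L where L: "m \<le> L" "0 < b" "dg c b 0 = f 0" "\<forall>j<L. pr (dg c b (j + 1)) (dg c b j) \<in> R"
    by (rule concat_paths[OF R assms(1), of m]) (use assms(2) P_path in auto)
  from R_bound[OF L(2,4)] obtain y where "FG k (f 0) y" "L + 1 \<le> y" unfolding L(3) by blast
  moreover have "m + 1 \<le> L + 1" using L(1) by simp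
  ultimately show ?thesis by (blast intro: order_trans)
qed

lemma P_irrefl: "pr x x \<notin> P"
proof
  assume x: "pr x x \<in> P"
  \<comment> \<open>The constant sequence is a \<open>P\<close>-descent with any number of steps.
    Taking 0 steps yields the value \<open>y\<close> of F_k at \<open>x\<close>; taking
    \<open>y\<close> steps exceeds it.\<close>
  have "Dfun (\<lambda>_. x)" by (intro DfunI Df_intros)
  note bnd = chain_bound[OF this]
  obtain y where y: "FG k x y" using bnd[of 0] by auto
  obtain y' where "FG k x y'" "y + 1 \<le> y'" using bnd[of y] x by auto
  then show False using FG_functional[OF y] by (simp add: num_Suc_le)
qed

text \<open>A descent is coded by a matrix with rows \<open>0, \<dots>, m\<close>; its columns \<open>0, \<dots>, k\<close> contain the tuples
  and column \<open>k + 1\<close> contains the elements of a \<open>P\<close>-chain.\<close>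

definition mat :: "num \<Rightarrow> num \<Rightarrow> num \<Rightarrow> nat \<Rightarrow> num" where
  "mat c b i j = dg c b (i * of_nat (k + 2) + of_nat j)"

lemma Df_mat: "Df c \<Longrightarrow> Df b \<Longrightarrow> Df i \<Longrightarrow> Df (\<lambda>e. mat (c e) (b e) (i e) j)"
  unfolding mat_def by (intro Df_dg Df_intros)

definition rows :: "num \<Rightarrow> num \<Rightarrow> num \<Rightarrow> bool" where
  "rows c b m \<longleftrightarrow> (\<forall>j<Suc k. mat c b 0 j = mat c b 0 (Suc k)) \<and>
    (\<forall>i<m. mat c b i (Suc k) < mat c b (i + 1) (Suc k)
      \<and> pr (mat c b (i + 1) (Suc k)) (mat c b i (Suc k)) \<in> P
      \<and> row_step (Suc k) (mat c b i) (mat c b (i + 1)) (mat c b (i + 1) (Suc k)))"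

lemma rows_descent:
  assumes "rows c b m"
  shows "descent (Suc k) m (\<lambda>i. mat c b i (Suc k)) (\<lambda>j i. mat c b i j)"
proof
  show "Dfun (\<lambda>i. mat c b i (Suc k))" "Dfun (\<lambda>i. mat c b i j)" for j
    by (intro DfunI Df_mat Df_intros; assumption)+
qed (use assms in \<open>auto simp: rows_def\<close>)

text \<open>Together with \<open>x\<close> the chain is a \<open>P\<close>-descent of m + 2
  elements, so F_k at its start is at least m + 2. A zero tuple in row \<open>m\<close> would make
  it at most m + 1.\<close>

lemma rows_not_stuck:
  assumes rows: "rows c b m" and x: "pr x (mat c b m (Suc k)) \<in> P"
  shows "\<exists>j<Suc k. mat c b m j \<noteq> 0"
proof (rule ccontr)
  assume stuck: "\<not> ?thesis"
  interpret descent "Suc k" m "\<lambda>i. mat c b i (Suc k)" "\<lambda>j i. mat c b i j"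
    by (rule rows_descent[OF rows])
  define f where "f i = (if i \<le> m then mat c b i (Suc k) else x)" for i
  have "Dfun f" unfolding f_def by (intro DfunI D_intros Df_intros Df_mat)
  moreover have "pr (f (i + 1)) (f i) \<in> P" if "i < m + 1" for i
  proof (cases "i = m")
    case True
    then show ?thesis using x num_Suc_le[of m m] by (simp add: f_def)
  next
    case False
    then have "i < m" using that by (simp add: num_axioms(8))
    then show ?thesis using rows by (simp add: f_def rows_def num_Suc_le less_imp_le)
  qed
  ultimately obtain y where y: "FG k (f 0) y" "m + 1 + 1 \<le> y" using chain_bound[of f "m + 1"] by blast
  have "y \<le> m + 1" by (rule stuck_bound[OF refl]) (use stuck y(1) in \<open>auto simp: f_def\<close>)
  then have "m + 1 + 1 \<le> m + 1" using y(2) by (rule order_trans[rotated])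
  then show False by (simp add: num_Suc_le)
qed

text \<open>The new row contains \<open>x\<close>, so the whole matrix is recoded in base
  \<open>x + 1\<close>. There is an entry to decrement by \<open>rows_not_stuck\<close>.\<close>

lemma rows_extend:
  assumes rows: "rows c (y + 1) m" and y: "mat c (y + 1) m (Suc k) = y" and x: "pr x y \<in> P" "y < x"
  shows "\<exists>d<(x + 1) ^^^ ((m + 1 + 1) * of_nat (k + 2)). rows d (x + 1) (m + 1)
    \<and> mat d (x + 1) (m + 1) (Suc k) = x
    \<and> row_step (Suc k) (mat c (y + 1) m) (mat d (x + 1) (m + 1)) x"
proof -
  define \<kappa> :: num where "\<kappa> = of_nat (k + 2)"
  have mat: "mat c b i j = dg c b (i * \<kappa> + of_nat j)" for c b i j by (simp only: mat_def \<kappa>_def)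
  let ?M = "mat c (y + 1)"
  have "\<exists>j<Suc k. ?M m j \<noteq> 0" using rows_not_stuck[OF rows] x y by simp
  then obtain l where l: "l < Suc k" "?M m l \<noteq> 0" "\<forall>j<l. ?M m j = 0"
    using exists_least_iff[of "\<lambda>j. j < Suc k \<and> ?M m j \<noteq> 0"] by (metis less_trans)
  \<comment> \<open>Indexed by numbers of the model instead of standard column numbers, as
    \<open>sequence_ex\<close> requires.\<close>
  define row where "row z = (if z = of_nat (Suc k) then x else if z < of_nat l then x
    else if z = of_nat l then ?M m l - 1 else dg c (y + 1) (m * \<kappa> + z))" for z
  define f where "f i = (if i < (m + 1) * \<kappa> then dg c (y + 1) i else row (i - (m + 1) * \<kappa>))" for i
  have "Dfun f" unfolding f_def row_def by (intro DfunI D_intros Df_intros Df_dg)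
  moreover have fx: "f i < x + 1" for i
  proof -
    have d: "dg c (y + 1) z \<le> x" for z
      using dg_less[of "y + 1" c z] x(2) by (simp add: num_less_Suc)
    moreover have "?M m l - 1 \<le> ?M m l"
      using l(2) zero_le[of "?M m l"] by (metis add_diff_inverse le_add_same_cancel2 num_less_1 not_less zero_le)
    ultimately show ?thesis
      unfolding num_less_Suc f_def row_def using d[of "m * \<kappa> + of_nat l"]
      by (auto simp: mat intro: order_trans)
  qed
  ultimately obtain d where d: "d < (x + 1) ^^^ ((m + 1 + 1) * \<kappa>)"
    "\<And>i. i < (m + 1 + 1) * \<kappa> \<Longrightarrow> dg d (x + 1) i = f i"
    using sequence_ex[of f "x + 1" "(m + 1 + 1) * \<kappa>"] by (auto simp: num_less_Suc)
  let ?N = "mat d (x + 1)"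
  \<comment> \<open>A row occupies k + 2 cells, so each cell of row \<open>i\<close> precedes the
    beginning of row \<open>i + 1\<close>.\<close>
  have idx: "i * \<kappa> + of_nat j < (i + 1) * \<kappa>" if "j \<le> Suc k" for i j
    using that by (simp add: algebra_simps \<kappa>_def del: of_nat_Suc of_nat_add)
  have old: "?N i j = ?M i j" if "i \<le> m" "j \<le> Suc k" for i j
  proof -
    have "(i + 1) * \<kappa> \<le> (m + 1) * \<kappa>" using that(1) by (intro mult_right_mono) simp_all
    then have 1: "i * \<kappa> + of_nat j < (m + 1) * \<kappa>" using idx[OF that(2)] by (rule less_le_trans[rotated])
    have "(m + 1) * \<kappa> \<le> (m + 1 + 1) * \<kappa>" by (intro mult_right_mono) simp_all
    then have "i * \<kappa> + of_nat j < (m + 1 + 1) * \<kappa>" using 1 by (rule less_le_trans[rotated])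
    then show ?thesis using d(2) 1 by (simp add: mat f_def)
  qed
  have new: "?N (m + 1) j = (if j = Suc k \<or> j < l then x else if j = l then ?M m l - 1 else ?M m j)"
    if "j \<le> Suc k" for j
    using d(2)[OF idx[OF that]] by (simp add: mat f_def row_def del: of_nat_Suc)
  have x': "?N (m + 1) (Suc k) = x" by (simp add: new)
  have step: "row_step (Suc k) (?M m) (?N (m + 1)) x"
    unfolding row_step_def
  proof (intro exI[of _ l] conjI allI impI)
    have "1 \<le> ?M m l" using l(2) by (metis num_less_1 not_less)
    then show "?M m l = ?N (m + 1) l + 1" using l(1) by (simp add: new)
  next
    fix j assume "j < Suc k" "l < j"
    then show "?N (m + 1) j = ?M m j" by (simp add: new)
  qed (use l in \<open>auto simp: new row_def\<close>)
  have "rows d (x + 1) (m + 1)"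
    unfolding rows_def
  proof (intro conjI allI impI)
    fix j assume "j < Suc k"
    then show "?N 0 j = ?N 0 (Suc k)" using rows by (simp add: old rows_def)
  next
    fix i assume i: "i < m + 1"
    have *: "?N i (Suc k) < ?N (i + 1) (Suc k) \<and> pr (?N (i + 1) (Suc k)) (?N i (Suc k)) \<in> P
      \<and> row_step (Suc k) (?N i) (?N (i + 1)) (?N (i + 1) (Suc k))"
    proof (cases "i = m")
      case True
      have "row_step (Suc k) (?N m) (?N (m + 1)) x"
        using step by (auto simp: row_step_def old)
      then show ?thesis using x y True by (simp add: x' old)
    next
      case False
      then have i': "i < m" using i by (simp add: num_axioms(8))
      then have "i \<le> m" "i + 1 \<le> m" by (simp_all add: num_Suc_le)
      moreover have "row_step (Suc k) (?N i) (?N (i + 1)) (?N (i + 1) (Suc k)) \<longleftrightarrow>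
          row_step (Suc k) (?M i) (?M (i + 1)) (?M (i + 1) (Suc k))"
        using calculation by (simp add: row_step_def old cong: conj_cong)
      ultimately show ?thesis using rows i' by (simp add: old rows_def)
    qed
    show "?N i (Suc k) < ?N (i + 1) (Suc k)" "pr (?N (i + 1) (Suc k)) (?N i (Suc k)) \<in> P"
      "row_step (Suc k) (?N i) (?N (i + 1)) (?N (i + 1) (Suc k))"
      using * by blast+
  qed
  then show ?thesis using d(1) x' step unfolding \<kappa>_def by blast
qed

end


section \<open>Least reachable tuples and the ranks\<close>

context bounded_relation
begin

text \<open>\<open>h\<close> codes the last tuple of a chain ending in \<open>x\<close>. Since the
  chain increases strictly, it has at most \<open>x\<close> steps and its matrix needs only digits
  up to \<open>x\<close>; thus the bounds exclude no chain and the property is bounded.\<close>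

definition reach :: "num \<Rightarrow> num \<Rightarrow> bool" where
  "reach x h \<longleftrightarrow> h < (x + 1) ^^^ of_nat (Suc k) \<and>
    (\<exists>m<x + 1. \<exists>c<(x + 1) ^^^ ((m + 1) * of_nat (k + 2)).
      rows c (x + 1) m \<and> mat c (x + 1) m (Suc k) = x
      \<and> (\<forall>j<Suc k. dg h (x + 1) (of_nat j) = mat c (x + 1) m j))"

lemma D_rows:
  assumes "Df c" "Df b" "Df m"
  shows "D (\<lambda>e. rows (c e) (b e) (m e))"
proof (rule D_rel3[OF assms, of rows])
  show "D (\<lambda>e. rows (e 0) (e 1) (e 2))"
    unfolding rows_def row_step_def
    by (intro D_intros D_ball_nat D_bex_nat D_mem P Df_pr Df_mat Df_intros)
qed

lemma D_reach:
  assumes "Df x" "Df h"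
  shows "D (\<lambda>e. reach (x e) (h e))"
proof (rule D_rel2[OF assms, of reach])
  show "D (\<lambda>e. reach (e 0) (e 1))"
    unfolding reach_def by (intro D_intros D_ball_nat D_rows Df_mat Df_dg Df_intros)
qed

lemma digits_ex:
  assumes "Dfun f" "0 < b" "\<And>i. f i < b"
  shows "\<exists>h<b ^^^ of_nat n. \<forall>j<n. dg h b (of_nat j) = f (of_nat j)"
proof -
  obtain h where "h < b ^^^ of_nat n" "\<forall>i<of_nat n. dg h b i = f i"
    using sequence_ex[of f b "of_nat n"] assms by blast
  then show ?thesis by (intro exI[of _ h]) simp
qed

text \<open>The chain consisting of \<open>x\<close> alone, with all entries of its tuple equal to
  \<open>x\<close>.\<close>

lemma reach_ex: "\<exists>h. reach x h"
proof -
  have f: "Dfun (\<lambda>_. x)" by (intro DfunI Df_intros)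
  have x: "0 < x + 1" "x < x + 1" by (simp_all add: num_less_Suc)
  obtain c where c: "c < (x + 1) ^^^ ((0 + 1) * of_nat (k + 2))"
    "\<forall>i<(0 + 1) * of_nat (k + 2). dg c (x + 1) i = x"
    using sequence_ex[OF f x(1), of "(0 + 1) * of_nat (k + 2)"] x(2) by blast
  have mat: "mat c (x + 1) 0 j = x" if "j < k + 2" for j
  proof -
    have "of_nat j < (0 + 1) * (of_nat (k + 2) :: num)" using that by (simp del: of_nat_Suc of_nat_add)
    then show ?thesis using c(2) by (simp add: mat_def)
  qed
  obtain h where "h < (x + 1) ^^^ of_nat (Suc k)" "\<forall>j<Suc k. dg h (x + 1) (of_nat j) = x"
    using digits_ex[OF f x(1), of "Suc k"] x(2) by blast
  moreover have "rows c (x + 1) 0" by (simp add: rows_def mat)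
  ultimately have "reach x h"
    unfolding reach_def using c(1) mat
    by (intro conjI exI[of _ 0] exI[of _ c]) (auto simp: num_less_Suc)
  then show ?thesis ..
qed

definition least_code :: "num \<Rightarrow> num" where
  "least_code x = (THE h. reach x h \<and> (\<forall>z<h. \<not> reach x z))"

lemma least_code_iff: "h = least_code x \<longleftrightarrow> reach x h \<and> (\<forall>z<h. \<not> reach x z)"
proof -
  obtain h0 where h0: "reach x h0" using reach_ex by blast
  have "D (\<lambda>e. reach x (e 0))" by (intro D_reach Df_intros)
  then obtain h1 where h1: "reach x h1" "\<forall>z<h1. \<not> reach x z"
    by (rule least_number[of "reach x" h0]) (use h0 in auto)
  then have "\<exists>!h. reach x h \<and> (\<forall>z<h. \<not> reach x z)"
    by (intro ex1I[of _ h1]) (auto dest: linorder_neqE)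
  from theI'[OF this] show ?thesis unfolding least_code_def[symmetric] by (auto dest: linorder_neqE)
qed

lemma least_code: "reach x (least_code x)" "reach x h \<Longrightarrow> least_code x \<le> h"
  using least_code_iff[of "least_code x" x] by (auto simp flip: not_less)

text \<open>The bound on codes built into \<open>reach\<close> is what makes the minimum a bounded
  definable function.\<close>

lemma Dfun_least_code: "Dfun least_code"
proof (rule DfunI)
  fix f assume f: "Df f"
  show "Df (\<lambda>e. least_code (f e))"
  proof (rule Df_comp1[OF f])
    show "D (\<lambda>e. e 0 = least_code (e 1))"
      unfolding least_code_iff by (intro D_intros D_reach Df_intros)
    have "least_code x \<le> (x + 1) ^^^ of_nat (Suc k)" for x
      using least_code(1)[of x] unfolding reach_def by (simp add: less_imp_le)
    then show "bdd (\<lambda>e. least_code (f e))"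
      by (intro bdd_le[OF Df_bdd[OF Df_pw[OF Df_add[OF f Df_const] Df_const]]])
  qed
qed

definition rank :: "nat \<Rightarrow> num \<Rightarrow> num" where
  "rank j x = dg (least_code x) (x + 1) (of_nat j)"

lemma Dfun_rank: "Dfun (rank j)"
  unfolding rank_def by (intro DfunI Df_dg Df_intros DfunD[OF Dfun_least_code])

lemma rank_le: "rank j x \<le> x"
  using dg_less[of "x + 1" "least_code x" "of_nat j"] unfolding rank_def by (simp add: num_less_Suc)

text \<open>The codes at \<open>x\<close> and \<open>y\<close> have different bases, so they are
  compared through a third tuple: the one that arises when a chain realizing the least tuple of
  \<open>y\<close> is extended by \<open>x\<close>. It is lexicographically smaller than the tuple
  of \<open>y\<close>, and the least tuple of \<open>x\<close> is at most it.\<close>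

lemma rank_decreases:
  assumes xy: "pr x y \<in> P" "y < x"
  shows "\<exists>j<Suc k. rank j x < rank j y"
proof -
  obtain m c where m: "m \<le> y" and c: "rows c (y + 1) m" "mat c (y + 1) m (Suc k) = y"
    "\<And>j. j < Suc k \<Longrightarrow> rank j y = mat c (y + 1) m j"
    using least_code(1)[of y] unfolding reach_def rank_def num_less_Suc by blast
  obtain d where d: "d < (x + 1) ^^^ ((m + 1 + 1) * of_nat (k + 2))" "rows d (x + 1) (m + 1)"
    "mat d (x + 1) (m + 1) (Suc k) = x"
    "row_step (Suc k) (mat c (y + 1) m) (mat d (x + 1) (m + 1)) x"
    using rows_extend[OF c(1,2) xy] by blast
  let ?f = "\<lambda>z. dg d (x + 1) ((m + 1) * of_nat (k + 2) + z)"
  have x: "0 < x + 1" by (simp add: num_less_Suc)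
  have "Dfun ?f" by (intro DfunI Df_dg Df_intros)
  from digits_ex[OF this x dg_less[OF x], of "Suc k"]
  obtain h where h: "h < (x + 1) ^^^ of_nat (Suc k)"
    "\<forall>j<Suc k. dg h (x + 1) (of_nat j) = mat d (x + 1) (m + 1) j"
    unfolding mat_def by blast
  have "m + 1 < x + 1" using m xy(2) by simp
  then have "reach x h" unfolding reach_def using h d by blast
  then have "least_code x \<le> h" by (rule least_code(2))
  \<comment> \<open>Let \<open>i - 1\<close> be the highest position where the least tuple of
    \<open>x\<close> differs from the extended one, with \<open>i = 0\<close> if they agree; the
    value there is smaller.\<close>
  then consider "least_code x = h" | "least_code x < h" by (auto simp: le_less)
  then obtain i where i: "\<And>j. j < Suc k \<Longrightarrow> i \<le> j \<Longrightarrow> rank j x \<le> mat d (x + 1) (m + 1) j"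
    "i = 0 \<or> (i \<le> Suc k \<and> rank (i - 1) x < mat d (x + 1) (m + 1) (i - 1))"
  proof cases
    case 1
    then show ?thesis using that[of 0] h(2) by (simp add: rank_def)
  next
    case 2
    from digits_lex[OF this h(1)] obtain j where j: "j < Suc k"
      "dg (least_code x) (x + 1) (of_nat j) < dg h (x + 1) (of_nat j)"
      "\<forall>i<Suc k. j < i \<longrightarrow> dg (least_code x) (x + 1) (of_nat i) = dg h (x + 1) (of_nat i)"
      by blast
    show ?thesis
      by (rule that[of "Suc j"]) (use j h(2) in \<open>auto simp: rank_def\<close>)
  qed
  obtain l where l: "l < Suc k" "mat c (y + 1) m l = mat d (x + 1) (m + 1) l + 1"
    "\<forall>j<Suc k. l < j \<longrightarrow> mat d (x + 1) (m + 1) j = mat c (y + 1) m j"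
    using d(4) unfolding row_step_def by blast
  show ?thesis
  \<comment> \<open>The higher of the positions \<open>i - 1\<close> and \<open>l\<close> carries
    the decreasing entry.\<close>
  proof (cases "i \<le> l")
    case True
    then have "rank l x < rank l y" using i(1)[OF l(1)] c(3)[OF l(1)] l(2) by (simp add: num_less_Suc)
    then show ?thesis using l(1) by blast
  next
    case False
    then have j: "i - 1 < Suc k" "rank (i - 1) x < mat d (x + 1) (m + 1) (i - 1)" "l \<le> i - 1"
      using i(2) by auto
    have "mat d (x + 1) (m + 1) (i - 1) \<le> rank (i - 1) y"
      using l j(1,3) c(3)[OF j(1)] by (cases "l = i - 1") auto
    then show ?thesis using j by (meson order_less_le_trans)
  qed
qed

text \<open>Along a descent in \<open>T i\<close> the measure \<open>\<mu> i\<close> decreases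
  strictly, and it never exceeds its argument. So consecutive pairs alone already limit the number
  of steps to the first element.\<close>

lemma decomposition:
  shows "\<exists>T. (\<forall>i<k + 2. T i \<in> Sets \<and> (\<forall>z\<in>T i. \<exists>x y. z = pr x y)
      \<and> (\<forall>c b m. 0 < b \<longrightarrow> (\<forall>j<m. pr (dg c b (j + 1)) (dg c b j) \<in> T i) \<longrightarrow> m \<le> dg c b 0))
    \<and> (\<forall>x y. pr x y \<in> P \<longrightarrow> (\<exists>i<k + 2. pr x y \<in> T i))"
proof -
  \<comment> \<open>The identity at index 0 lets the increasing pairs be treated like the
    ranks.\<close>
  define \<mu> where "\<mu> i x = (case i of 0 \<Rightarrow> x | Suc j \<Rightarrow> rank j x)" for i x
  have D\<mu>: "Dfun (\<mu> i)" for i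
    using Dfun_rank by (cases i) (auto simp: \<mu>_def Dfun_def)
  have \<mu>_le: "\<mu> i x \<le> x" for i x using rank_le by (cases i) (auto simp: \<mu>_def)
  have "\<exists>T\<in>Sets. \<forall>z. z \<in> T \<longleftrightarrow> (\<exists>x y. z = pr x y \<and> pr x y \<in> P \<and> \<mu> i x < \<mu> i y)" for i
    by (rule relation_comprehension) (intro D_intros D_mem P Df_pr Df_intros DfunD[OF D\<mu>])
  then have "\<forall>i. \<exists>T. T \<in> Sets \<and> (\<forall>z. z \<in> T \<longleftrightarrow> (\<exists>x y. z = pr x y \<and> pr x y \<in> P \<and> \<mu> i x < \<mu> i y))"
    by blast
  then obtain T where T: "\<And>i. T i \<in> Sets"
    "\<And>i z. z \<in> T i \<longleftrightarrow> (\<exists>x y. z = pr x y \<and> pr x y \<in> P \<and> \<mu> i x < \<mu> i y)"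
    by (metis (no_types, lifting) choice)
  have T': "pr x y \<in> T i \<longleftrightarrow> pr x y \<in> P \<and> \<mu> i x < \<mu> i y" for i x y
    unfolding T(2) by auto
  have "m \<le> dg c b 0" if "0 < b" and *: "\<forall>j<m. pr (dg c b (j + 1)) (dg c b j) \<in> T i" for i c b m
  proof -
    have "j \<le> m \<longrightarrow> \<mu> i (dg c b j) + j \<le> \<mu> i (dg c b 0)" for j
    proof (induction j rule: D_induct)
      show "D (\<lambda>e. e 0 \<le> m \<longrightarrow> \<mu> i (dg c b (e 0)) + e 0 \<le> \<mu> i (dg c b 0))"
        by (intro D_intros Df_dg Df_intros DfunD[OF D\<mu>])
    next
      case (Suc j)
      show ?case
      proof
        assume "j + 1 \<le> m"
        then have j: "j < m" by (simp add: num_Suc_le)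
        then have "\<mu> i (dg c b (j + 1)) < \<mu> i (dg c b j)" using * T' by blast
        moreover have "\<mu> i (dg c b j) + j \<le> \<mu> i (dg c b 0)" using Suc j by simp
        ultimately show "\<mu> i (dg c b (j + 1)) + (j + 1) \<le> \<mu> i (dg c b 0)"
          unfolding num_emb by linarith
      qed
    qed simp
    from this[of m] have "m \<le> \<mu> i (dg c b 0)"
      using emb_nonneg[of "\<mu> i (dg c b m)"] unfolding num_emb by simp
    then show ?thesis using \<mu>_le by (rule order_trans)
  qed
  moreover have "\<exists>i<k + 2. pr x y \<in> T i" if p: "pr x y \<in> P" for x y
  proof (cases "x < y")
    case True
    then show ?thesis using p by (intro exI[of _ 0]) (simp add: T' \<mu>_def)
  next
    case False
    then have "y < x" using p P_irrefl by (metis linorder_neqE)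
    then obtain j where "j < Suc k" "rank j x < rank j y" using rank_decreases[OF p] by blast
    then show ?thesis using p by (intro exI[of _ "Suc j"]) (simp add: T' \<mu>_def)
  qed
  ultimately show ?thesis using T(1) T(2) by (intro exI[of _ T]) blast
qed

end


section \<open>Semantics of the theorem\<close>

lemma sem_entry: "sem U e s (entry c b i a) \<longleftrightarrow> ent (val e c) (val e b) (val e i) (val e a)"
  by (simp add: entry_def ent_def)

lemma sem_chain:
  assumes "\<And>e t u. sem U e s (Q t u) \<longleftrightarrow> S (val e t) (val e u)"
  shows "sem U e s (chain Q c b m) \<longleftrightarrow> (\<forall>i<val e m. \<exists>u<val e b. \<exists>v<val e b.
    ent (val e c) (val e b) i u \<and> ent (val e c) (val e b) (i + 1) v \<and> S u v)"
  by (simp add: chain_def entries_rel_def sem_entry assms)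

lemma sem_trans_chain:
  assumes "\<And>e t u. sem U e s (Q t u) \<longleftrightarrow> S (val e t) (val e u)"
  shows "sem U e s (trans_chain Q c b m) \<longleftrightarrow> (\<forall>j<val e m + 1. \<forall>i<j. \<exists>u<val e b. \<exists>v<val e b.
    ent (val e c) (val e b) i u \<and> ent (val e c) (val e b) j v \<and> S u v)"
  by (simp add: trans_chain_def entries_rel_def sem_entry assms)

lemma sem_F_graph: "sem U e s (F_graph n t u) \<longleftrightarrow> FG n (val e t) (val e u)"
proof (induction n arbitrary: e t u)
  case (Suc n)
  show ?case by (simp add: sem_entry sem_chain[of U s "F_graph n" "FG n", OF Suc.IH])
qed simp

lemma sem_rel: "sem U e s (rel Q t u) \<longleftrightarrow> pr (val e t) (val e u) \<in> s Q"
  by (simp add: rel_def pair_def pr_def)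

lemma sem_is_rel: "sem U e s (is_rel Q) \<longleftrightarrow> (\<forall>z\<in>s Q. \<exists>x y. z = pr x y)"
  by (auto simp: is_rel_def pair_def pr_def)

lemma ent_chain_iff:
  "0 < b \<Longrightarrow> (\<forall>i<m. \<exists>u<b. \<exists>v<b. ent c b i u \<and> ent c b (i + 1) v \<and> S u v)
    \<longleftrightarrow> (\<forall>i<m. S (dg c b i) (dg c b (i + 1)))"
  using dg_less by (auto simp: ent_iff)

lemma sem_trancl:
  "sem U e s (trancl_fm Q t u) \<longleftrightarrow> (\<exists>c b l. path (s Q) c b l (val e t) (val e u))"
proof -
  have "sem U e s (trancl_fm Q t u) \<longleftrightarrow> (\<exists>c b l. 0 < l \<and> ent c b 0 (val e t) \<and> ent c b l (val e u)
    \<and> (\<forall>i<l. \<exists>u<b. \<exists>v<b. ent c b i u \<and> ent c b (i + 1) v \<and> pr u v \<in> s Q))"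
    by (simp add: trancl_fm_def sem_entry
        sem_chain[of U s "rel Q" "\<lambda>u v. pr u v \<in> s Q", OF sem_rel] numeral_2_eq_2)
  also have "\<dots> \<longleftrightarrow> (\<exists>c b l. path (s Q) c b l (val e t) (val e u))"
  proof -
    have "0 < l \<and> ent c b 0 x \<and> ent c b l y
        \<and> (\<forall>i<l. \<exists>u<b. \<exists>v<b. ent c b i u \<and> ent c b (i + 1) v \<and> pr u v \<in> s Q)
      \<longleftrightarrow> path (s Q) c b l x y" for c b l x y
    proof (cases "0 < b")
      case True
      then show ?thesis
        by (simp only: ent_chain_iff[OF True, of l c "\<lambda>u v. pr u v \<in> s Q"])
          (simp add: path_def ent_iff)
    qed (simp add: path_def ent_iff)
    then show ?thesis by (simp only:)
  qed
  finally show ?thesis .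
qed

lemma sem_bounded_by:
  "sem U e s (bounded_by Q (F_graph n)) \<longleftrightarrow> (\<forall>c b m. 0 < b
    \<longrightarrow> (\<forall>i<m. pr (dg c b (i + 1)) (dg c b i) \<in> s Q) \<longrightarrow> (\<exists>y. FG n (dg c b 0) y \<and> m + 1 \<le> y))"
proof -
  have "sem U e s (bounded_by Q (F_graph n)) \<longleftrightarrow> (\<forall>c b m a. ent c b 0 a
      \<and> (\<forall>i<m. \<exists>u<b. \<exists>v<b. ent c b i u \<and> ent c b (i + 1) v \<and> pr v u \<in> s Q)
      \<longrightarrow> (\<exists>y. FG n a y \<and> m + 1 \<le> y))"
    by (simp add: bounded_by_def sem_entry sem_F_graph numeral_2_eq_2 numeral_3_eq_3 le_less
        sem_chain[of U s "\<lambda>u v. rel Q v u" "\<lambda>u v. pr v u \<in> s Q", OF sem_rel])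
  also have "\<dots> \<longleftrightarrow> (\<forall>c b m. 0 < b
    \<longrightarrow> (\<forall>i<m. pr (dg c b (i + 1)) (dg c b i) \<in> s Q) \<longrightarrow> (\<exists>y. FG n (dg c b 0) y \<and> m + 1 \<le> y))"
  proof -
    have "(\<forall>a. ent c b 0 a \<and> (\<forall>i<m. \<exists>u<b. \<exists>v<b. ent c b i u \<and> ent c b (i + 1) v \<and> pr v u \<in> s Q)
        \<longrightarrow> (\<exists>y. FG n a y \<and> m + 1 \<le> y))
      \<longleftrightarrow> (0 < b \<longrightarrow> (\<forall>i<m. pr (dg c b (i + 1)) (dg c b i) \<in> s Q)
        \<longrightarrow> (\<exists>y. FG n (dg c b 0) y \<and> m + 1 \<le> y))" for c b m
    proof (cases "0 < b")
      case True
      then show ?thesis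
        by (simp only: ent_chain_iff[OF True, of m c "\<lambda>u v. pr v u \<in> s Q"])
          (simp add: ent_iff)
    qed (simp add: ent_iff)
    then show ?thesis by (simp only:)
  qed
  finally show ?thesis .
qed

text \<open>A transitive descent contains its consecutive pairs, and m + 1 \<le> F_0(a) amounts to m
  \<le> a.\<close>

lemma sem_H_bounded_by_F0:
  assumes "\<And>c b m. 0 < b \<Longrightarrow> \<forall>j<m. pr (dg c b (j + 1)) (dg c b j) \<in> s Q \<Longrightarrow> m \<le> dg c b 0"
  shows "sem U e s (H_bounded_by Q (F_graph 0))"
proof -
  have "m \<le> a"
    if c: "ent c b 0 a" and *: "\<forall>j<m + 1. \<forall>i<j. \<exists>u<b. \<exists>v<b. ent c b i u \<and> ent c b j v \<and> pr v u \<in> s Q"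
    for c b m a
  proof -
    have b: "0 < b" "a = dg c b 0" using c by (simp_all add: ent_iff)
    have "pr (dg c b (j + 1)) (dg c b j) \<in> s Q" if "j < m" for j
    proof -
      have "j + 1 < m + 1" "j < j + 1" using that by (simp_all add: num_less_Suc num_Suc_le)
      then show ?thesis using * by (fastforce simp: ent_iff)
    qed
    then show ?thesis using assms[OF b(1)] b(2) by blast
  qed
  then show ?thesis
    by (simp add: H_bounded_by_def sem_entry numeral_2_eq_2 numeral_3_eq_3 le_less
        sem_trans_chain[of U s "\<lambda>u v. rel Q v u" "\<lambda>u v. pr v u \<in> s Q", OF sem_rel])
      blast
qed

lemma sem_big_conj: "sem U e s (big_conj ps) \<longleftrightarrow> (\<forall>p\<in>set ps. sem U e s p)"
  by (induction ps) (auto simp: big_conj_def)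

lemma sem_big_disj: "sem U e s (big_disj ps) \<longleftrightarrow> (\<exists>p\<in>set ps. sem U e s p)"
  by (induction ps) (auto simp: big_disj_def)

text \<open>Under \<open>n\<close> further quantifiers the outermost one has index \<open>n\<close>;
  hence \<open>T n\<close> is its witness in the induction step.\<close>

lemma sem_ExS_funpow:
  "(\<And>i. i < n \<Longrightarrow> T i \<in> U) \<Longrightarrow> sem U e (\<lambda>i. if i < n then T i else s (i - n)) p
    \<Longrightarrow> sem U e s ((ExS ^^ n) p)"
proof (induction n arbitrary: s)
  case (Suc n)
  have eq: "(\<lambda>i. if i < n then T i else case_nat (T n) s (i - n)) = (\<lambda>i. if i < Suc n then T i else s (i - Suc n))"
  proof (rule ext)
    fix i
    consider "i < n" | "i = n" | "i > n" by linarith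
    then show "(if i < n then T i else case_nat (T n) s (i - n)) = (if i < Suc n then T i else s (i - Suc n))"
    proof cases
      case 3
      then have "i - n = Suc (i - Suc n)" by simp
      then show ?thesis using 3 by simp
    qed simp_all
  qed
  have "sem U e (case_nat (T n) s) ((ExS ^^ n) p)"
    by (rule Suc.IH) (use Suc.prems in \<open>simp_all only: eq less_SucI\<close>)
  then show ?case using Suc.prems(1)[of n] by auto
qed simp

lemma sem_termination_fm:
  assumes "range s \<subseteq> Sets"
  shows "sem Sets e s (termination_fm k)"
  unfolding termination_fm_def sem.simps
proof (intro ballI impI)
  fix R P
  assume R: "R \<in> Sets" and P: "P \<in> Sets"
  let ?s = "case_nat P (case_nat R s)"
  assume "sem Sets e (case_nat R s) (is_rel 0 \<^bold>\<and> bounded_by 0 (F_graph k))"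
  then have bounded: "\<And>c b m. 0 < b \<Longrightarrow> \<forall>i<m. pr (dg c b (i + 1)) (dg c b i) \<in> R
      \<Longrightarrow> \<exists>y. FG k (dg c b 0) y \<and> m + 1 \<le> y"
    by (simp add: sem_bounded_by)
  assume trancl: "sem Sets e ?s (is_trancl 0 1)"
  have P_path: "\<exists>c b l. path R c b l x y" if "pr x y \<in> P" for x y
    using trancl that by (simp add: is_trancl_def sem_rel sem_trancl)
  interpret bounded_relation k P R
  proof
    show "P \<in> Sets" "R \<in> Sets" by (rule P, rule R)
    show "pr x y \<in> P \<Longrightarrow> \<exists>c b l. path R c b l x y" for x y by (rule P_path)
    show "0 < b \<Longrightarrow> \<forall>j<L. pr (dg c b (j + 1)) (dg c b j) \<in> R
      \<Longrightarrow> \<exists>y. FG k (dg c b 0) y \<and> L + 1 \<le> y" for c b L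
      by (rule bounded)
  qed
  obtain T where T': "(\<forall>i<k + 2. T i \<in> Sets \<and> (\<forall>z\<in>T i. \<exists>x y. z = pr x y)
      \<and> (\<forall>c b m. 0 < b \<longrightarrow> (\<forall>j<m. pr (dg c b (j + 1)) (dg c b j) \<in> T i) \<longrightarrow> m \<le> dg c b 0))
    \<and> (\<forall>x y. pr x y \<in> P \<longrightarrow> (\<exists>i<k + 2. pr x y \<in> T i))"
    using decomposition ..
  have T: "T i \<in> Sets" "\<forall>z\<in>T i. \<exists>x y. z = pr x y"
    "0 < b \<Longrightarrow> \<forall>j<m. pr (dg c b (j + 1)) (dg c b j) \<in> T i \<Longrightarrow> m \<le> dg c b 0"
    if "i < k + 2" for i c b m
    using T' that by simp_all
  have cover: "\<exists>i<k + 2. pr x y \<in> T i" if "pr x y \<in> P" for x y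
    using T' that by simp
  show "sem Sets e ?s ((ExS ^^ (k + 2))
      (big_conj (map is_rel [0..<k + 2])
       \<^bold>\<and> AllN (AllN (rel (k + 2) (Var 1) (Var 0)
            \<^bold>\<longrightarrow> big_disj (map (\<lambda>i. rel i (Var 1) (Var 0)) [0..<k + 2])))
       \<^bold>\<and> big_conj (map (\<lambda>i. H_bounded_by i (F_graph 0)) [0..<k + 2])))"
  proof (rule sem_ExS_funpow[OF T(1)], assumption)
    define t where "t = (\<lambda>i. if i < k + 2 then T i else ?s (i - (k + 2)))"
    have t: "t i = T i" if "i < k + 2" for i using that by (simp add: t_def)
    have tP: "t (k + 2) = P" by (simp add: t_def)
    have "sem Sets e t (H_bounded_by i (F_graph 0))" if "i < k + 2" for i
      by (rule sem_H_bounded_by_F0) (simp only: t[OF that], rule T(3)[OF that])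
    then have H: "sem Sets e t (big_conj (map (\<lambda>i. H_bounded_by i (F_graph 0)) [0..<k + 2]))"
      by (auto simp only: sem_big_conj set_map set_upt atLeastLessThan_iff)
    have "sem Sets e t (is_rel i)" if "i < k + 2" for i
      using T(2)[OF that] by (simp only: sem_is_rel t[OF that])
    then have rel: "sem Sets e t (big_conj (map is_rel [0..<k + 2]))"
      by (auto simp only: sem_big_conj set_map set_upt atLeastLessThan_iff)
    have "sem Sets (case_nat y (case_nat x e)) t (big_disj (map (\<lambda>i. rel i (Var 1) (Var 0)) [0..<k + 2]))"
      if p: "pr x y \<in> P" for x y
    proof -
      obtain i where i: "i < k + 2" "pr x y \<in> T i" using cover[OF p] by blast
      then have "sem Sets (case_nat y (case_nat x e)) t (rel i (Var 1) (Var 0))"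
        by (simp add: sem_rel t)
      moreover have "rel i (Var 1) (Var 0) \<in> set (map (\<lambda>i. rel i (Var 1) (Var 0)) [0..<k + 2])"
        unfolding set_map set_upt by (rule imageI) (use i(1) in simp)
      ultimately show ?thesis unfolding sem_big_disj by blast
    qed
    moreover have "sem Sets (case_nat y (case_nat x e)) t (rel (k + 2) (Var 1) (Var 0)) \<longleftrightarrow> pr x y \<in> P" for x y
      unfolding sem_rel tP by simp
    ultimately have "sem Sets e t (big_conj (map is_rel [0..<k + 2])
       \<^bold>\<and> AllN (AllN (rel (k + 2) (Var 1) (Var 0)
            \<^bold>\<longrightarrow> big_disj (map (\<lambda>i. rel i (Var 1) (Var 0)) [0..<k + 2])))
       \<^bold>\<and> big_conj (map (\<lambda>i. H_bounded_by i (F_graph 0)) [0..<k + 2]))"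
      using H rel by (simp only: sem_connectives sem.simps simp_thms) blast
    then show "sem Sets e (\<lambda>i. if i < k + 2 then T i else ?s (i - (k + 2))) (big_conj (map is_rel [0..<k + 2])
       \<^bold>\<and> AllN (AllN (rel (k + 2) (Var 1) (Var 0)
            \<^bold>\<longrightarrow> big_disj (map (\<lambda>i. rel i (Var 1) (Var 0)) [0..<k + 2])))
       \<^bold>\<and> big_conj (map (\<lambda>i. H_bounded_by i (F_graph 0)) [0..<k + 2]))"
      unfolding t_def .
  qed
qed


theorem theorem8p11:
  fixes k :: nat
  shows "RCA0_star \<union> {Tot k} \<^bold>\<turnstile> termination_fm k"
proof -
  have "RCA0_star \<^bold>\<turnstile> termination_fm k" by (rule provable_if_sem) (rule sem_termination_fm)
  then show ?thesis unfolding proves_def by (rule deriv_mono) auto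
qed

end
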